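(* For every $\eta>0$ there is $\mathcal{A}=\mathcal{A}(\eta)<\infty$ such that, as $N\to\infty$, $$\#\{\gamma\in\Gamma_{\mathcal{A}}\cap B_N:\ \mathrm{tr}({}^{t}\gamma\,\gamma)^2-4\text{ is square-free}\}\gg N^{2-\eta}.$$
   Context: For an integer $\mathcal{A}\ge 1$, $\Gamma_{\mathcal{A}}$ is the semigroup consisting of all products of even length of the matrices $\begin{pmatrix} a&1\\1&0\end{pmatrix}$, $1\le a\le\mathcal{A}$ (so $\Gamma_{\mathcal{A}}\subset \mathrm{SL}_2(\mathbb{Z})$). For $N>0$, $B_N=\{g=\begin{pmatrix}a&b\\c&d\end{pmatrix}\in\mathrm{SL}_2(\mathbb{R}): a^2+b^2+c^2+d^2<N^2\}$. ${}^{t}\gamma$ denotes the transpose of $\gamma$. *)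

theory Defs
  imports
    "HOL-Analysis.Analysis"
    "HOL-Library.Landau_Symbols"
    "HOL-Computational_Algebra.Squarefree"
begin

definition cf_matrix :: "nat \<Rightarrow> int^2^2" where
  "cf_matrix a = vector [vector [int a, 1], vector [1, 0]]"

text \<open>
  Multiplication \<open>(*)\<close> on \<open>int^2^2\<close> is entrywise, so the matrix product of a list
  has to be spelled out with \<open>(**)\<close>. The empty product is excluded.
\<close>

definition cf_semigroup :: "nat \<Rightarrow> (int^2^2) set" where
  "cf_semigroup A = {foldr (\<lambda>a M. cf_matrix a ** M) as (mat 1) | as.
                as \<noteq> [] \<and> even (length as) \<and> set as \<subseteq> {1..A}}"

definition SL2_ball :: "real \<Rightarrow> (real^2^2) set" where
  "SL2_ball N = {g. det g = 1 \<and>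
     (g$1$1)\<^sup>2 + (g$1$2)\<^sup>2 + (g$2$1)\<^sup>2 + (g$2$2)\<^sup>2 < N\<^sup>2}"

end

theory Submission
  imports Defs "HOL-Number_Theory.Number_Theory" "HOL-Real_Asymp.Real_Asymp"
begin

text \<open>
  Write $t = \mathrm{tr}({}^t\gamma\gamma)$; since $t - 2\sigma = (a - \sigma d)^2 + (b + \sigma c)^2$ for $\sigma = \pm 1$,
  one has to sieve out the $\gamma$ with $p^2 \mid t \mp 2$. As a power $N^\eta$ may be lost, no spectral gap
  is needed.

  Primes $p > N^\delta$: the number of $\gamma \in \mathrm{SL}_2(\mathbb{Z})$ with given $t$ is at most
  $r_2(t-2)\, r_2(t+2) = N^{o(1)}$, so only $N^{2+o(1)-\delta}$ matrices are lost.

  Primes $p_0 < p \le N^\delta$: the matrices are products containing, for a scale $M$ between $p^4$ and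
  $p^8$, two independent factors from a set $S$ of at least $M^{2-\eta}$ elements of size $M$. A count of
  the elements of the principal congruence subgroup modulo $q = p^2$ shows that $S$ has about as few
  pairs congruent modulo $q$ as a random set, up to $M^{o(1)}$. By Cauchy--Schwarz the product of two
  factors lies in a given residue class with proportion at most $q^{-3} M^{o(1)+2\eta}$, and there are
  $O(p^4)$ classes to be avoided, so the proportion of bad products is at most $p^{-3/2}$. Doubly
  exponential scales suffice for all these primes.

  Bounded primes: for $p \le 32$ the residue class is fixed by a correcting factor, and for
  $32 < p \le p_0$ one multiplies by a last factor depending on two parameters. This determines how
  large the bound for the partial quotients has to be.
\<close>

section \<open>Divisors and sums of two squares\<close>

text \<open>Two obstacles shape the constants. First, every count loses a power M^o(1), so the
  proportion p^(-2) of bad products expected modulo p^2 is usable only at a scale M that is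
  polynomial in p: for M <= p^8 a loss of M^(1/16) costs p^(1/2), and p^(-3/2) still has a
  convergent sum. No single scale can serve all primes up to a power of N, hence factors of many
  sizes in one product. The estimate at a prime looks at two factors only, uniformly over fixed
  factors on both sides, so the other scales do not interfere. Second, this convergent sum carries a
  constant that is not controlled, so it says nothing about primes below some p_0. There only
  explicit estimates help: 8/p^2 for the last factor, with sum at most 1/4 over p > 32, and one
  explicit residue class for p <= 32. The last factor is chosen after p_0 and enlarges the alphabet,
  but the bound for the larger primes is uniform in it, so nothing becomes circular.\<close>

lemma card_le_fibres:
  assumes "finite A" "finite R" "f ` A \<subseteq> R"
    and "\<And>r. r \<in> R \<Longrightarrow> real (card {a \<in> A. f a = r}) \<le> m"
  shows "real (card A) \<le> real (card R) * m"
proof -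
  have "A = (\<Union>r\<in>R. {a \<in> A. f a = r})"
    using assms(3) by auto
  then have "card A \<le> (\<Sum>r\<in>R. card {a \<in> A. f a = r})"
    by (metis card_UN_le assms(2))
  then have "real (card A) \<le> (\<Sum>r\<in>R. real (card {a \<in> A. f a = r}))"
    by (metis of_nat_le_iff of_nat_sum)
  also have "\<dots> \<le> real (card R) * m"
    using assms(4) by (intro sum_bounded_above) auto
  finally show ?thesis .
qed

section \<open>The divisor bound\<close>

lemma card_divisors_mult:
  fixes m n :: nat
  assumes "m > 0" "n > 0"
  shows "card {d. d dvd m * n} \<le> card {d. d dvd m} * card {d. d dvd n}"
proof -
  have "{d. d dvd m * n} \<subseteq> (\<lambda>(x, y). x * y) ` ({d. d dvd m} \<times> {d. d dvd n})"
  proof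
    fix d assume "d \<in> {d. d dvd m * n}"
    then obtain x y where "d = x * y" "x dvd m" "y dvd n"
      using division_decomp[of d m n] by blast
    then show "d \<in> (\<lambda>(x, y). x * y) ` ({d. d dvd m} \<times> {d. d dvd n})"
      by force
  qed
  then have "card {d. d dvd m * n} \<le> card ({d. d dvd m} \<times> {d. d dvd n})"
    using assms by (intro surj_card_le) (auto simp: finite_divisors_nat)
  then show ?thesis by (simp add: card_cartesian_product)
qed

lemma card_divisors_primepow:
  assumes "prime (p :: nat)"
  shows "card {d. d dvd p ^ e} \<le> e + 1"
proof -
  have "{d. d dvd p ^ e} \<subseteq> (\<lambda>i. p ^ i) ` {..e}"
    using divides_primepow_nat[OF assms] by auto
  then show ?thesis
    by (metis card_atMost finite_atMost surj_card_le Suc_eq_plus1)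
qed

text \<open>A prime power p^e contributes e + 1 divisors. For p >= K this is at most 2^e <= p^(e
  \<epsilon>); for p < K it is at most c p^(e \<epsilon>), and the factor \<open>c\<close> is paid
  once per small prime. The induction removes one prime with its full power.\<close>

lemma divisor_bound_aux:
  fixes \<epsilon> :: real and K :: nat
  assumes "\<epsilon> > 0" and K: "real K powr \<epsilon> \<ge> 2" and "n > 0"
  defines "c \<equiv> 1 + 1 / (\<epsilon> * ln 2)"
  shows "real (card {d. d dvd n}) \<le> c ^ card {p. prime p \<and> p < K \<and> p dvd n} * real n powr \<epsilon>"
  using \<open>n > 0\<close>
proof (induction n rule: less_induct)
  case (less n)
  have c1: "c \<ge> 1" using assms by (simp add: c_def)
  show ?case
  proof (cases "n = 1")
    case True
    then show ?thesis using c1 by simp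
  next
    case False
    then obtain p where p: "prime p" "p dvd n" using prime_factor_nat by blast
    define e where "e = multiplicity p n"
    obtain m where m: "n = p ^ e * m" "\<not> p dvd m"
      using multiplicity_decompose'[of n p] p less.prems unfolding e_def
      by (metis not_prime_unit not_gr_zero)
    have "e > 0" using p less.prems unfolding e_def
      by (simp add: prime_multiplicity_gt_zero_iff)
    have m0: "m > 0" using m less.prems by (cases m) auto
    have p2: "p \<ge> 2" using p prime_ge_2_nat by auto
    have "p ^ e > 1" using p2 \<open>e > 0\<close> by (intro one_less_power) auto
    then have mn: "m < n" using m m0 by simp
    define S where "S = (\<lambda>n. {p. prime p \<and> p < K \<and> p dvd n})"
    have IH: "real (card {d. d dvd m}) \<le> c ^ card (S m) * real m powr \<epsilon>"
      using less.IH[OF mn m0] by (simp add: S_def)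
    have fin: "finite (S k)" for k by (auto simp: S_def)
    have "card {d. d dvd n} \<le> card {d. d dvd p ^ e} * card {d. d dvd m}"
      unfolding m(1) using p2 m0 by (intro card_divisors_mult) auto
    also have "\<dots> \<le> (e + 1) * card {d. d dvd m}"
      using card_divisors_primepow[OF p(1)] by (intro mult_right_mono) auto
    finally have d: "real (card {d. d dvd n}) \<le> (real e + 1) * real (card {d. d dvd m})"
      by (metis of_nat_mult of_nat_le_iff of_nat_Suc Suc_eq_plus1 add.commute)
    have npow: "real n powr \<epsilon> = (real p powr \<epsilon>) ^ e * real m powr \<epsilon>"
      unfolding m(1) using p2 by (simp add: powr_mult powr_power powr_realpow[symmetric] powr_powr mult.commute)
    have main: "(real e + 1) * c ^ card (S m) \<le> c ^ card (S n) * (real p powr \<epsilon>) ^ e"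
    proof (cases "p < K")
      case True
      have "S n = insert p (S m)"
        unfolding S_def m(1) using p True \<open>e > 0\<close>
        by (auto simp: prime_dvd_mult_iff prime_dvd_power_iff primes_dvd_imp_eq)
      moreover have "p \<notin> S m" using m by (auto simp: S_def)
      ultimately have card: "card (S n) = Suc (card (S m))" using fin by simp
      \<comment> \<open>The tangent bound for exp with l = \<epsilon> ln 2; multiplying 1 + e l by c
        = 1 + 1/l gives at least e + 1.\<close>
      have "1 + real e * (\<epsilon> * ln 2) \<le> exp (real e * (\<epsilon> * ln 2))"
        by (rule exp_ge_add_one_self)
      also have "\<dots> = (2 powr \<epsilon>) ^ e"
        by (simp add: powr_def exp_of_nat_mult)
      also have "\<dots> \<le> (real p powr \<epsilon>) ^ e"
        using p2 assms by (intro power_mono powr_mono2) auto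
      finally have le: "1 + real e * (\<epsilon> * ln 2) \<le> (real p powr \<epsilon>) ^ e" .
      have pos: "\<epsilon> * ln 2 > 0" using assms by simp
      have "real e + 1 \<le> c * (1 + real e * (\<epsilon> * ln 2))"
      proof -
        define l where "l = \<epsilon> * ln 2"
        have "(1 + 1 / l) * (1 + real e * l) = 1 + real e * l + 1 / l + real e"
          using pos by (simp add: l_def[symmetric] field_simps)
        moreover have "real e * l \<ge> 0" "1 / l \<ge> 0" using pos by (simp_all add: l_def[symmetric])
        ultimately show ?thesis unfolding c_def l_def[symmetric] by linarith
      qed
      also have "\<dots> \<le> c * (real p powr \<epsilon>) ^ e"
        using le c1 by (intro mult_left_mono) auto
      finally show ?thesis using c1 unfolding card
        by (simp add: mult.commute mult.left_commute mult_left_mono)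
    next
      case False
      have "S n = S m"
        unfolding S_def m(1) using p False \<open>e > 0\<close>
        by (auto simp: prime_dvd_mult_iff prime_dvd_power_iff dest: primes_dvd_imp_eq)
      moreover have "real e + 1 \<le> (real p powr \<epsilon>) ^ e"
      proof -
        have "real e + 1 \<le> 2 ^ e" using Bernoulli_inequality[of "1::real" e] by simp
        also have "\<dots> \<le> (real K powr \<epsilon>) ^ e" using K by (intro power_mono) auto
        also have "\<dots> \<le> (real p powr \<epsilon>) ^ e"
          using False assms by (intro power_mono powr_mono2) auto
        finally show ?thesis .
      qed
      ultimately show ?thesis using c1 by (simp add: mult.commute mult_left_mono)
    qed
    have "real (card {d. d dvd n}) \<le> (real e + 1) * (c ^ card (S m) * real m powr \<epsilon>)"
      using d mult_left_mono[OF IH, of "real e + 1"] by linarith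
    also have "\<dots> \<le> c ^ card (S n) * (real p powr \<epsilon>) ^ e * real m powr \<epsilon>"
      using mult_right_mono[OF main, of "real m powr \<epsilon>"] by (simp add: mult.assoc)
    finally show ?thesis unfolding npow S_def by (simp add: mult.assoc)
  qed
qed

lemma divisor_bound:
  fixes \<epsilon> :: real
  assumes "\<epsilon> > 0"
  obtains C where "C \<ge> 1" "\<And>n :: nat. n > 0 \<Longrightarrow> real (card {d. d dvd n}) \<le> C * real n powr \<epsilon>"
proof -
  \<comment> \<open>Primes from \<open>K\<close> on satisfy p^\<epsilon> >= 2.\<close>
  define K where "K = nat \<lceil>2 powr (1 / \<epsilon>)\<rceil>"
  have "real K \<ge> 2 powr (1 / \<epsilon>)" unfolding K_def by linarith
  then have "real K powr \<epsilon> \<ge> (2 powr (1 / \<epsilon>)) powr \<epsilon>"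
    using assms by (intro powr_mono2) auto
  then have K: "real K powr \<epsilon> \<ge> 2" using assms by (simp add: powr_powr)
  define c where "c = 1 + 1 / (\<epsilon> * ln 2)"
  have c1: "c \<ge> 1" using assms by (simp add: c_def)
  have "real (card {d. d dvd n}) \<le> c ^ K * real n powr \<epsilon>" if "n > 0" for n :: nat
  proof -
    have "card {p. prime p \<and> p < K \<and> p dvd n} \<le> card {..<K}"
      by (intro card_mono) auto
    then have "c ^ card {p. prime p \<and> p < K \<and> p dvd n} \<le> c ^ K"
      using c1 by (intro power_increasing) auto
    then show ?thesis
      using divisor_bound_aux[OF assms K that] unfolding c_def[symmetric]
      by (meson mult_right_mono order_trans powr_ge_zero)
  qed
  moreover have "c ^ K \<ge> 1" using c1 by simp
  ultimately show ?thesis using that by blast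
qed

section \<open>Representations as sums of two squares\<close>

text \<open>Of two primitive representations $n = x^2 + y^2$ with the same $\gcd(n, x y_0 - y x_0)$,
  the determinant is a multiple of $n/2$, which leaves boundedly many possibilities.\<close>

lemma two_squares_det:
  fixes x0 y0 x1 y1 x2 y2 n :: int
  assumes n: "x0\<^sup>2 + y0\<^sup>2 = n" "x1\<^sup>2 + y1\<^sup>2 = n" "x2\<^sup>2 + y2\<^sup>2 = n"
    and cop: "coprime x0 y0" "coprime x1 y1" "coprime x2 y2"
    and g: "gcd n (x1 * y0 - y1 * x0) = gcd n (x2 * y0 - y2 * x0)"
  shows "n dvd 2 * (x1 * y2 - x2 * y1)"
proof -
  define g where "g = gcd n (x1 * y0 - y1 * x0)"
  have n0: "n \<noteq> 0" using n(1) cop(1) by auto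
  have cn: "coprime y n" "coprime x n" if "x\<^sup>2 + y\<^sup>2 = n" "coprime x y" for x y :: int
  proof -
    have x2: "coprime (x\<^sup>2) y" "coprime x (y\<^sup>2)" using that(2) by auto
    show "coprime y n" unfolding that(1)[symmetric]
    proof (rule coprimeI)
      fix d assume d: "d dvd y" "d dvd x\<^sup>2 + y\<^sup>2"
      then have "d dvd y\<^sup>2" by (simp add: power2_eq_square)
      then have "d dvd x\<^sup>2" using d(2) by (simp add: dvd_add_left_iff)
      then show "is_unit d" using d x2(1) coprime_common_divisor by blast
    qed
    show "coprime x n" unfolding that(1)[symmetric]
    proof (rule coprimeI)
      fix d assume d: "d dvd x" "d dvd x\<^sup>2 + y\<^sup>2"
      then have "d dvd x\<^sup>2" by (simp add: power2_eq_square)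
      then have "d dvd y\<^sup>2" using d(2) by (simp add: dvd_add_right_iff)
      then show "is_unit d" using d x2(2) coprime_common_divisor by blast
    qed
  qed
  obtain n' where n': "n = g * n'" unfolding g_def by (meson dvdE gcd_dvd1)
  have g0: "g \<noteq> 0" using n0 n' by auto
  have P: "g dvd x1 * y0 - y1 * x0" "g dvd x2 * y0 - y2 * x0"
    unfolding g_def by (simp, simp add: g)
  \<comment> \<open>The product of x y0 - y x0 and x y0 + y x0 is divisible by n. As
    \<open>g\<close> is the full gcd of n with the first factor, the complementary divisor
    \<open>n'\<close> must divide the second.\<close>
  have Q: "n' dvd x * y0 + y * x0" if q: "x\<^sup>2 + y\<^sup>2 = n" "gcd n (x * y0 - y * x0) = g" for x y
  proof -
    have eq: "(x * y0 - y * x0) * (x * y0 + y * x0) = n * (x\<^sup>2 - x0\<^sup>2)"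
    proof -
      have "(x * y0 - y * x0) * (x * y0 + y * x0) = x\<^sup>2 * y0\<^sup>2 - y\<^sup>2 * x0\<^sup>2"
        by (simp add: algebra_simps power2_eq_square)
      also have "\<dots> = x\<^sup>2 * (n - x0\<^sup>2) - (n - x\<^sup>2) * x0\<^sup>2"
        using n(1) q(1) by (metis add_diff_cancel_left')
      finally show ?thesis by (simp add: algebra_simps)
    qed
    obtain r where r: "x * y0 - y * x0 = g * r" using q(2) by (metis dvdE gcd_dvd2)
    have "gcd (g * n') (g * r) = g" using q(2) r n' by simp
    then have "\<bar>g\<bar> * gcd n' r = g" by (simp add: gcd_mult_distrib_int)
    moreover have "g > 0" using g0 unfolding g_def by (simp add: order_less_le)
    ultimately have "coprime n' r" using g0 by (simp add: coprime_iff_gcd_eq_1)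
    moreover have "n' dvd r * (x * y0 + y * x0)"
      using eq r n' g0 by (simp add: mult.assoc)
    ultimately show ?thesis by (simp add: coprime_dvd_mult_right_iff)
  qed
  have Q1: "n' dvd x1 * y0 + y1 * x0" "n' dvd x2 * y0 + y2 * x0"
    using Q[of x1 y1] Q[of x2 y2] n g by (auto simp: g_def)
  define D where "D = x1 * y2 - x2 * y1"
  have "y0 * D = y2 * (x1 * y0 - y1 * x0) - y1 * (x2 * y0 - y2 * x0)"
    by (simp add: D_def algebra_simps)
  then have "g dvd y0 * D" using P by (metis dvd_diff dvd_mult)
  moreover have "coprime g y0" using cn(1)[OF n(1) cop(1)] n'
    by (metis coprime_commute coprime_mult_left_iff)
  ultimately have gD: "g dvd D" by (simp add: coprime_dvd_mult_right_iff)
  have "y0 * D = y2 * (x1 * y0 + y1 * x0) - y1 * (x2 * y0 + y2 * x0)"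
    by (simp add: D_def algebra_simps)
  then have "n' dvd y0 * D" using Q1 by (metis dvd_diff dvd_mult)
  moreover have "coprime n' y0" using cn(1)[OF n(1) cop(1)] n'
    by (metis coprime_commute coprime_mult_left_iff)
  ultimately have n'D: "n' dvd D" by (simp add: coprime_dvd_mult_right_iff)
  \<comment> \<open>\<open>g\<close> and \<open>n'\<close> may have a common divisor. It divides the
    sum 2 x1 y0 of the two forms, and x1 y0 is prime to n; this is the source of the factor 2 in the
    conclusion.\<close>
  define e where "e = gcd g n'"
  have "e dvd (x1 * y0 - y1 * x0) + (x1 * y0 + y1 * x0)"
    using P(1) Q1(1) unfolding e_def by (meson dvd_add dvd_trans gcd_dvd1 gcd_dvd2)
  then have "e dvd 2 * (x1 * y0)" by (simp add: mult.commute algebra_simps)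
  moreover have "e dvd n" using n' by (simp add: e_def)
  then have "coprime e (x1 * y0)"
    using cn(1)[OF n(1) cop(1)] cn(2)[OF n(2) cop(2)]
    by (metis coprime_commute coprime_divisors coprime_mult_left_iff dvd_refl)
  ultimately have e2: "e dvd 2" by (simp add: coprime_dvd_mult_left_iff)
  \<comment> \<open>Both g and n' divide D, so n = g n' divides e D, and e divides 2.\<close>
  have "g * n' dvd g * D" "g * n' dvd n' * D"
    using gD n'D by (simp_all add: mult.commute[of g n'] mult_dvd_mono)
  then have "g * n' dvd gcd (g * D) (n' * D)" by simp
  also have "gcd (g * D) (n' * D) = e * \<bar>D\<bar>"
    by (simp add: gcd_mult_right e_def gcd.commute abs_mult)
  also have "e * \<bar>D\<bar> dvd e * D" by (simp add: mult_dvd_mono)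
  also have "e * D dvd 2 * D" using e2 by (simp add: mult_dvd_mono)
  finally show ?thesis using n' by (simp add: D_def)
qed

text \<open>By Lagrange's identity the determinant and the scalar product with (x1, y1) have squares
  adding up to n^2, and together they determine (x, y). The determinant is k n / 2 with |k| <= 2,
  and it fixes the scalar product up to sign: 5 times 2 values.\<close>

lemma two_squares_fibre:
  fixes x1 y1 n :: int
  assumes "n > 0" "x1\<^sup>2 + y1\<^sup>2 = n"
  defines "S \<equiv> {(x, y). x\<^sup>2 + y\<^sup>2 = n \<and> n dvd 2 * (x1 * y - x * y1)}"
  shows "finite S" "card S \<le> 10"
proof -
  define f where "f = (\<lambda>(x, y). (2 * (x1 * y - x * y1) div n, x1 * x + y1 * y \<ge> 0))"
  have lag: "(x1 * x + y1 * y)\<^sup>2 + (x1 * y - x * y1)\<^sup>2 = n\<^sup>2" if "x\<^sup>2 + y\<^sup>2 = n" for x y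
  proof -
    have "(x1 * x + y1 * y)\<^sup>2 + (x1 * y - x * y1)\<^sup>2 = (x1\<^sup>2 + y1\<^sup>2) * (x\<^sup>2 + y\<^sup>2)"
      by (simp add: power2_eq_square algebra_simps)
    then show ?thesis using that assms(2) by (simp add: power2_eq_square)
  qed
  have "inj_on f S"
  proof (rule inj_onI, clarify)
    fix x y x' y'
    assume S: "(x, y) \<in> S" "(x', y') \<in> S" and f: "f (x, y) = f (x', y')"
    define D where "D = x1 * y - x * y1"
    define E where "E = x1 * x + y1 * y"
    have D: "x1 * y' - x' * y1 = D"
    proof -
      have "2 * (x1 * y - x * y1) = 2 * (x1 * y - x * y1) div n * n"
        using S(1) by (simp add: S_def)
      also have "\<dots> = 2 * (x1 * y' - x' * y1) div n * n" using f by (simp add: f_def)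
      also have "\<dots> = 2 * (x1 * y' - x' * y1)" using S(2) by (simp add: S_def)
      finally show ?thesis by (simp add: D_def)
    qed
    have "(x1 * x' + y1 * y')\<^sup>2 = E\<^sup>2"
      using lag[of x y] lag[of x' y'] S unfolding D by (auto simp: S_def D_def E_def)
    moreover have "(x1 * x' + y1 * y' \<ge> 0) = (E \<ge> 0)"
      using f by (simp add: f_def E_def)
    ultimately have E: "x1 * x' + y1 * y' = E"
      by (smt (verit) power2_eq_iff)
    have "n * x = x1 * E - y1 * D" "n * y = y1 * E + x1 * D"
      unfolding assms(2)[symmetric] D_def E_def by (simp_all add: power2_eq_square algebra_simps)
    moreover have "n * x' = x1 * E - y1 * D" "n * y' = y1 * E + x1 * D"
      unfolding assms(2)[symmetric] D[symmetric] E[symmetric]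
      by (simp_all add: power2_eq_square algebra_simps)
    ultimately have "n * x = n * x'" "n * y = n * y'" by simp_all
    then show "x = x' \<and> y = y'" using \<open>n > 0\<close> by simp
  qed
  moreover have "f ` S \<subseteq> {-2..2} \<times> UNIV"
  proof
    fix v assume "v \<in> f ` S"
    then obtain x y where v: "v = f (x, y)"
      and *: "x\<^sup>2 + y\<^sup>2 = n" "n dvd 2 * (x1 * y - x * y1)"
      by (auto simp: S_def)
    from *(2)     obtain k where k: "2 * (x1 * y - x * y1) = n * k" by (elim dvdE)
    have "(x1 * y - x * y1)\<^sup>2 \<le> n\<^sup>2" using lag[OF *(1)] by (smt (verit) zero_le_power2)
    then have "\<bar>x1 * y - x * y1\<bar> \<le> n" using \<open>n > 0\<close> by (simp add: abs_le_square_iff flip: abs_le_square_iff)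
    then have "\<bar>n * k\<bar> \<le> n * 2" unfolding k[symmetric] by (simp add: abs_mult)
    then have "\<bar>k\<bar> \<le> 2" using \<open>n > 0\<close> by (simp add: abs_mult)
    moreover have "2 * (x1 * y - x * y1) div n = k" using k \<open>n > 0\<close> by simp
    ultimately show "v \<in> {-2..2} \<times> UNIV" unfolding v f_def by auto
  qed
  ultimately have "finite S" "card S \<le> card ({-2..2::int} \<times> (UNIV :: bool set))"
    by (meson finite_SigmaI finite_atLeastAtMost_int finite_code inj_on_finite card_inj_on_le)+
  then show "finite S" "card S \<le> 10" by (simp_all add: card_cartesian_product)
qed

lemma finite_two_squares: "finite {(x, y :: int). x\<^sup>2 + y\<^sup>2 = n}"
proof (rule finite_subset)
  show "{(x, y). x\<^sup>2 + y\<^sup>2 = n} \<subseteq> {-\<bar>n\<bar>..\<bar>n\<bar>} \<times> {-\<bar>n\<bar>..\<bar>n\<bar>}"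
  proof
    fix v :: "int \<times> int" assume "v \<in> {(x, y). x\<^sup>2 + y\<^sup>2 = n}"
    then obtain x y where v: "v = (x, y)" "x\<^sup>2 + y\<^sup>2 = n" by auto
    have sq: "\<bar>z\<bar> \<le> z\<^sup>2" for z :: int
      using self_le_power[of "\<bar>z\<bar>" 2] by (cases "z = 0") auto
    have "x\<^sup>2 \<ge> 0" "y\<^sup>2 \<ge> 0" by simp_all
    then have "\<bar>x\<bar> \<le> \<bar>n\<bar>" "\<bar>y\<bar> \<le> \<bar>n\<bar>" using v(2) sq[of x] sq[of y] by linarith+
    then show "v \<in> {-\<bar>n\<bar>..\<bar>n\<bar>} \<times> {-\<bar>n\<bar>..\<bar>n\<bar>}" using v(1) by auto
  qed
qed auto

text \<open>The gcd of n with the determinant against one fixed representation is a divisor of n;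
  \<open>two_squares_det\<close> puts all representations with the same gcd into one set of
  \<open>two_squares_fibre\<close>.\<close>

lemma card_primitive_two_squares:
  fixes n :: nat
  assumes "n > 0"
  shows "card {(x, y :: int). x\<^sup>2 + y\<^sup>2 = int n \<and> coprime x y} \<le> card {d. d dvd n} * 10"
    (is "card ?P \<le> _")
proof (cases "?P = {}")
  case False
  then obtain x0 y0 where x0: "x0\<^sup>2 + y0\<^sup>2 = int n" "coprime x0 y0" by auto
  define f where "f = (\<lambda>(x, y). nat (gcd (int n) (x * y0 - y * x0)))"
  have fin: "finite ?P" by (rule finite_subset[OF _ finite_two_squares[of "int n"]]) auto
  have "real (card ?P) \<le> real (card {d. d dvd n}) * 10"
  proof (rule card_le_fibres[where f = f])
    show "f ` ?P \<subseteq> {d. d dvd n}"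
      by (auto simp: f_def) (metis gcd_dvd1 gcd_ge_0_int int_dvd_int_iff int_nat_eq)
    show "finite {d. d dvd n}" using assms by simp
    fix r
    let ?F = "{a \<in> ?P. f a = r}"
    show "real (card ?F) \<le> 10"
    proof (cases "?F = {}")
      case False
      then obtain x1 y1 where x1: "x1\<^sup>2 + y1\<^sup>2 = int n" "coprime x1 y1" "f (x1, y1) = r" by auto
      let ?S = "{(x, y). x\<^sup>2 + y\<^sup>2 = int n \<and> int n dvd 2 * (x1 * y - x * y1)}"
      have "?F \<subseteq> ?S"
      proof
        fix v assume v: "v \<in> ?F"
        obtain x y where xy: "v = (x, y)" by (cases v)
        have *: "x\<^sup>2 + y\<^sup>2 = int n" "coprime x y" "f (x, y) = r"
          using v unfolding xy by auto
        have "gcd (int n) (x1 * y0 - y1 * x0) = gcd (int n) (x * y0 - y * x0)"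
          using x1(3) *(3)[symmetric] by (simp add: f_def eq_nat_nat_iff)
        then show "v \<in> ?S"
          using two_squares_det[OF x0(1) x1(1) *(1) x0(2) x1(2) *(2)] *(1) by (simp add: xy)
      qed
      then have "card ?F \<le> card ?S"
        using two_squares_fibre(1)[OF _ x1(1)] assms by (intro card_mono) auto
      also have "\<dots> \<le> 10" using two_squares_fibre(2)[OF _ x1(1)] assms by simp
      finally show ?thesis by simp
    next
      case True
      show ?thesis unfolding True by simp
    qed
  qed (use fin in auto)
  then have "real (card ?P) \<le> real (card {d. d dvd n} * 10)" by simp
  then show ?thesis by (simp only: of_nat_le_iff)
next
  case True
  show ?thesis unfolding True by simp
qed

text \<open>A representation with gcd r is r times a primitive representation of n / r^2. Here r
  divides n, and the divisors of n / r^2 are among those of n.\<close>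

lemma card_two_squares:
  fixes n :: nat
  assumes "n > 0"
  shows "card {(x, y :: int). x\<^sup>2 + y\<^sup>2 = int n} \<le> 10 * card {d. d dvd n} ^ 2"
    (is "card ?P \<le> _")
proof -
  define f where "f = (\<lambda>(x, y :: int). nat (gcd x y))"
  have "real (card ?P) \<le> real (card {d. d dvd n}) * (10 * real (card {d. d dvd n}))"
  proof (rule card_le_fibres[where f = f])
    show "finite ?P" by (rule finite_two_squares)
    show "finite {d. d dvd n}" using assms by simp
    show "f ` ?P \<subseteq> {d. d dvd n}"
    proof (clarsimp simp: f_def)
      fix x y :: int assume "x\<^sup>2 + y\<^sup>2 = int n"
      moreover have "gcd x y dvd x\<^sup>2 + y\<^sup>2" by (simp add: power2_eq_square)
      ultimately show "nat (gcd x y) dvd n" by (metis gcd_ge_0_int int_dvd_int_iff int_nat_eq)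
    qed
    fix r assume "r \<in> {d. d dvd n}"
    let ?F = "{a \<in> ?P. f a = r}"
    show "real (card ?F) \<le> 10 * real (card {d. d dvd n})"
    proof (cases "?F = {}")
      case False
      then obtain x1 y1 where x1: "x1\<^sup>2 + y1\<^sup>2 = int n" "nat (gcd x1 y1) = r" by (auto simp: f_def)
      have r0: "r > 0" using \<open>r \<in> _\<close> assms by (auto intro: Nat.gr0I)
      have split: "\<exists>x' y'. x = int r * x' \<and> y = int r * y' \<and> coprime x' y'"
        if "nat (gcd x y) = r" for x y
      proof -
        have g: "gcd x y = int r" "gcd x y \<noteq> 0" using that r0 by auto
        obtain x' y' where "x = x' * gcd x y" "y = y' * gcd x y" "coprime x' y'"
          using gcd_coprime_exists[OF g(2)] by auto
        then show ?thesis using g(1) by (metis mult.commute)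
      qed
      obtain x1' y1' where x1': "x1 = int r * x1'" "y1 = int r * y1'"
        using split[OF x1(2)] by auto
      have "int n = int r ^ 2 * (x1'\<^sup>2 + y1'\<^sup>2)"
        using x1(1) unfolding x1' by (simp add: power_mult_distrib algebra_simps)
      then have "int r ^ 2 dvd int n" by simp
      then have "r ^ 2 dvd n" by (metis int_dvd_int_iff of_nat_power)
      then obtain m where m: "n = r ^ 2 * m" by (elim dvdE)
      have m0: "m > 0" using m assms by (intro Nat.gr0I) auto
      let ?Q = "{(x, y :: int). x\<^sup>2 + y\<^sup>2 = int m \<and> coprime x y}"
      have "?F \<subseteq> (\<lambda>(x, y). (int r * x, int r * y)) ` ?Q"
      proof
        fix v assume v: "v \<in> ?F"
        obtain x y where xy: "v = (x, y)" by (cases v)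
        have *: "x\<^sup>2 + y\<^sup>2 = int n" "nat (gcd x y) = r"
          using v unfolding xy by (auto simp: f_def)
        obtain x' y' where x': "x = int r * x'" "y = int r * y'" "coprime x' y'"
          using split[OF *(2)] by blast
        have "int r ^ 2 * (x'\<^sup>2 + y'\<^sup>2) = int r ^ 2 * int m"
          using *(1) unfolding x' m by (simp add: power_mult_distrib algebra_simps)
        then have "x'\<^sup>2 + y'\<^sup>2 = int m" using r0 by simp
        then show "v \<in> (\<lambda>(x, y). (int r * x, int r * y)) ` ?Q"
          unfolding xy using x' by force
      qed
      moreover have "finite ?Q" by (rule finite_subset[OF _ finite_two_squares[of "int m"]]) auto
      ultimately have "card ?F \<le> card ?Q" by (intro surj_card_le) auto
      also have "\<dots> \<le> card {d. d dvd m} * 10" by (rule card_primitive_two_squares[OF m0])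
      also have "card {d. d dvd m} \<le> card {d. d dvd n}"
        using assms m by (intro card_mono) auto
      finally show ?thesis by simp
    next
      case True
      show ?thesis unfolding True by simp
    qed
  qed
  then have "real (card ?P) \<le> real (10 * card {d. d dvd n} ^ 2)"
    by (simp add: power2_eq_square)
  then show ?thesis by (simp only: of_nat_le_iff)
qed

lemma two_squares_bound:
  fixes \<epsilon> :: real
  assumes "\<epsilon> > 0"
  obtains C where "C \<ge> 1"
    "\<And>n :: int. n > 0 \<Longrightarrow> real (card {(x, y :: int). x\<^sup>2 + y\<^sup>2 = n}) \<le> C * real_of_int n powr \<epsilon>"
proof -
  obtain C where C: "C \<ge> 1" "\<And>n :: nat. n > 0 \<Longrightarrow> real (card {d. d dvd n}) \<le> C * real n powr (\<epsilon> / 2)"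
    using divisor_bound[of "\<epsilon> / 2"] assms by auto
  have "real (card {(x, y :: int). x\<^sup>2 + y\<^sup>2 = n}) \<le> (10 * C\<^sup>2) * real_of_int n powr \<epsilon>" if "n > 0" for n
  proof -
    define m where "m = nat n"
    have m: "n = int m" "m > 0" using that by (auto simp: m_def)
    have "real (card {(x, y :: int). x\<^sup>2 + y\<^sup>2 = n}) \<le> real (10 * card {d. d dvd m} ^ 2)"
      unfolding m(1) using card_two_squares[OF m(2)] by (simp only: of_nat_le_iff)
    also have "\<dots> = 10 * real (card {d. d dvd m}) ^ 2" by simp
    also have "\<dots> \<le> 10 * (C * real m powr (\<epsilon> / 2)) ^ 2"
      using C(2)[OF m(2)] by (intro mult_left_mono power_mono) auto
    also have "\<dots> = (10 * C\<^sup>2) * real m powr \<epsilon>"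
      by (simp add: power_mult_distrib power2_eq_square flip: powr_add)
    finally show ?thesis by (simp add: m(1))
  qed
  moreover have "10 * C\<^sup>2 \<ge> 1" using one_le_power[OF C(1), of 2] by linarith
  ultimately show ?thesis using that by blast
qed

section \<open>Matrices with bounded partial quotients\<close>

text \<open>\<open>(a, b, c, d)\<close> is the matrix with rows \<open>(a, b)\<close> and \<open>(c, d)\<close>.\<close>

type_synonym mat2 = "int \<times> int \<times> int \<times> int"

fun mm :: "mat2 \<Rightarrow> mat2 \<Rightarrow> mat2" (infixl "\<odot>" 70) where
  "(a, b, c, d) \<odot> (e, f, g, h) = (a*e + b*g, a*f + b*h, c*e + d*g, c*f + d*h)"

fun dt :: "mat2 \<Rightarrow> int" where "dt (a, b, c, d) = a*d - b*c"
fun adj :: "mat2 \<Rightarrow> mat2" where "adj (a, b, c, d) = (d, -b, -c, a)"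
fun tn :: "mat2 \<Rightarrow> int" where "tn (a, b, c, d) = a\<^sup>2 + b\<^sup>2 + c\<^sup>2 + d\<^sup>2"
fun a11 :: "mat2 \<Rightarrow> int" where "a11 (a, b, c, d) = a"
definition id2 :: mat2 where "id2 = (1, 0, 0, 1)"

lemma mm_assoc: "(x \<odot> y) \<odot> z = x \<odot> (y \<odot> z)"
  by (cases x; cases y; cases z) (simp add: algebra_simps)

lemma mm_id2 [simp]: "id2 \<odot> x = x" "x \<odot> id2 = x"
  by (cases x; simp add: id2_def)+

lemma dt_mm [simp]: "dt (x \<odot> y) = dt x * dt y"
  by (cases x; cases y) (simp add: algebra_simps)

lemma dt_id2 [simp]: "dt id2 = 1"
  by (simp add: id2_def)

lemma dt_adj [simp]: "dt (adj x) = dt x"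
  by (cases x) simp

lemma adj_mm: "dt x = 1 \<Longrightarrow> adj x \<odot> x = id2" "dt x = 1 \<Longrightarrow> x \<odot> adj x = id2"
  by (cases x; simp add: id2_def algebra_simps)+

lemma mm_cancel: "dt x = 1 \<Longrightarrow> x \<odot> y = x \<odot> z \<longleftrightarrow> y = z"
  by (metis adj_mm(1) mm_assoc mm_id2(1))

text \<open>The product of the matrices with rows $(x, 1), (1, 0)$ and $(y, 1), (1, 0)$.\<close>

definition step :: "int \<Rightarrow> int \<Rightarrow> mat2" where "step x y = (x*y + 1, x, y, 1)"

lemma dt_step [simp]: "dt (step x y) = 1"
  by (simp add: step_def)

text \<open>Unlike \<open>cf_semigroup\<close>, this contains the empty product, so it is a monoid
  in which families can grow from \<open>id2\<close>. A final \<open>step\<close> makes the products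
  nonempty again at the end.\<close>

inductive_set sg :: "nat \<Rightarrow> mat2 set" for A where
  id2: "id2 \<in> sg A"
| step: "g \<in> sg A \<Longrightarrow> x \<in> {1..int A} \<Longrightarrow> y \<in> {1..int A} \<Longrightarrow> g \<odot> step x y \<in> sg A"

lemma sg_mm: "h \<in> sg A \<Longrightarrow> g \<in> sg A \<Longrightarrow> g \<odot> h \<in> sg A"
  by (induction rule: sg.induct) (auto simp: mm_assoc[symmetric] intro: sg.step)

lemma sg_mono: "g \<in> sg A \<Longrightarrow> A \<le> B \<Longrightarrow> g \<in> sg B"
  by (induction rule: sg.induct) (auto intro!: sg.intros)

lemma dt_sg: "g \<in> sg A \<Longrightarrow> dt g = 1"
  by (induction rule: sg.induct) auto

text \<open>In a nonempty product the top left entry dominates, so it can serve as the size of the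
  matrix. The identity violates d <= b and has to be set apart for the induction.\<close>

lemma sg_bounds_aux:
  "g \<in> sg A \<Longrightarrow> g = id2 \<or> (case g of (a, b, c, d) \<Rightarrow> 1 \<le> a \<and> 0 \<le> b \<and> b \<le> a \<and> 0 \<le> c \<and> c \<le> a \<and> 0 \<le> d \<and> d \<le> b)"
proof (induction rule: sg.induct)
  case (step g x y)
  obtain a b c d where g: "g = (a, b, c, d)" by (cases g)
  show ?case
  proof (cases "g = id2")
    case True
    have xy: "1 \<le> x" "1 \<le> y" using step.hyps by auto
    then have "x \<le> x * y + 1" "y \<le> x * y + 1"
      using mult_left_mono[of 1 y x] mult_right_mono[of 1 x y] by linarith+
    then show ?thesis using True xy by (auto simp: id2_def step_def)
  next
    case False
    then have *: "1 \<le> a" "0 \<le> b" "b \<le> a" "0 \<le> c" "c \<le> a" "0 \<le> d" "d \<le> b"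
      using step.IH by (auto simp: g)
    have xy: "1 \<le> x" "1 \<le> y" using step.hyps by auto
    have "0 \<le> a * (x * y)" "0 \<le> b * y" "0 \<le> c * (x * y)" "0 \<le> d * y" "0 \<le> a * x" "0 \<le> c * x"
      using * xy by simp_all
    moreover have "c * (x * y) \<le> a * (x * y)" "d * y \<le> b * y" "c * x \<le> a * x"
      using * xy by (auto intro!: mult_right_mono)
    moreover have "a * x + b \<le> a * (x * y) + a + b * y"
    proof -
      have "a * x * 1 \<le> a * x * y" using * xy by (intro mult_left_mono) auto
      moreover have "0 \<le> b * y" using * xy by simp
      moreover have "a * x * y = a * (x * y)" "a * x * 1 = a * x" by simp_all
      ultimately show ?thesis using *(3) by linarith
    qed
    ultimately show ?thesis using * by (auto simp: g step_def algebra_simps)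
  qed
qed simp

lemma sg_bounds:
  assumes "(a, b, c, d) \<in> sg A"
  shows "1 \<le> a" "0 \<le> b" "b \<le> a" "0 \<le> c" "c \<le> a" "0 \<le> d" "d \<le> a" "a * d - b * c = 1"
  using sg_bounds_aux[OF assms] dt_sg[OF assms] by (auto simp: id2_def)

text \<open>In other words 2 \<open>a11\<close> is submultiplicative. This is why the families below
  bound \<open>2 * a11 g\<close>, not \<open>a11 g\<close>, by their scale: products then lose no
  constant.\<close>

lemma a11_mm_le:
  assumes "g \<in> sg A" "h \<in> sg B"
  shows "a11 (g \<odot> h) \<le> 2 * a11 g * a11 h"
proof -
  obtain a b c d where g: "g = (a, b, c, d)" by (cases g)
  obtain a' b' c' d' where h: "h = (a', b', c', d')" by (cases h)
  have "b * c' \<le> a * a'"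
    using sg_bounds[OF assms(1)[unfolded g]] sg_bounds[OF assms(2)[unfolded h]]
    by (intro mult_mono) auto
  then show ?thesis by (simp add: g h algebra_simps)
qed

lemma a11_pos: "g \<in> sg A \<Longrightarrow> a11 g \<ge> 1"
  using sg_bounds(1) by (cases g) auto

lemma tn_le: "g \<in> sg A \<Longrightarrow> tn g \<le> (2 * a11 g)\<^sup>2"
proof -
  assume g: "g \<in> sg A"
  obtain a b c d where [simp]: "g = (a, b, c, d)" by (cases g)
  note * = sg_bounds[OF g[simplified]]
  have "b\<^sup>2 \<le> a\<^sup>2" "c\<^sup>2 \<le> a\<^sup>2" "d\<^sup>2 \<le> a\<^sup>2" using * by (auto intro!: power_mono)
  then show ?thesis by (simp add: power_mult_distrib)
qed

section \<open>Cylinder sets of continued fractions\<close>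

definition cone :: "mat2 \<Rightarrow> (int \<times> int) set" where
  "cone g = (case g of (a, b, c, d) \<Rightarrow> {(a * s + b*t, c * s + d*t) | s t. t \<le> s \<and> 0 < t})"

lemma cone_mm_step: "1 \<le> x \<Longrightarrow> 1 \<le> y \<Longrightarrow> cone (g \<odot> step x y) \<subseteq> cone g"
proof
  fix v assume xy: "1 \<le> x" "1 \<le> y" and v: "v \<in> cone (g \<odot> step x y)"
  obtain a b c d where g: "g = (a, b, c, d)" by (cases g)
  from v obtain s t where st: "t \<le> s" "0 < t"
    "v = ((a*(x*y+1) + b*y) * s + (a*x+b)*t, (c*(x*y+1) + d*y) * s + (c*x+d)*t)"
    by (auto simp: g cone_def step_def)
  define t' where "t' = y * s + t"
  define s' where "s' = x*t' + s"
  have "s \<ge> 1" using st by simp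
  then have "y * s \<ge> 1 * 1" using xy by (intro mult_mono) auto
  then have t': "0 < t'" using st by (simp add: t'_def)
  then have "1 * t' \<le> x * t'" using xy by (intro mult_right_mono) auto
  then have "t' \<le> s'" using st by (simp add: s'_def)
  moreover have "v = (a * s' + b*t', c * s' + d*t')"
    using st by (simp add: s'_def t'_def algebra_simps)
  ultimately show "v \<in> cone g" using t' by (auto simp: cone_def g)
qed

lemma cone_mm: "h \<in> sg A \<Longrightarrow> cone (g \<odot> h) \<subseteq> cone g"
proof (induction rule: sg.induct)
  case (step h x y)
  then show ?case using cone_mm_step[of x y "g \<odot> h"] by (auto simp: mm_assoc[symmetric])
qed simp

lemma cone_nonempty: "cone g \<noteq> {}"
  by (auto simp: cone_def split: prod.splits intro!: exI[of _ 1])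

text \<open>\<open>x\<close> and \<open>y\<close> are the first two quotients of the Euclidean algorithm; the condition $0 < t$ in
  \<open>cone\<close> excludes the ambiguous last quotient.\<close>

lemma cone_step_disjoint:
  assumes "dt g = 1" "1 \<le> x" "1 \<le> y" "1 \<le> x'" "1 \<le> y'"
    and "v \<in> cone (g \<odot> step x y)" "v \<in> cone (g \<odot> step x' y')"
  shows "x = x' \<and> y = y'"
proof -
  \<comment> \<open>Uniqueness of division with remainders in 1, ..., n, the range that the
    condition 0 < t <= s in \<open>cone\<close> leads to.\<close>
  have quot: "q = q'" if "q*n + r = q'*n + r'" "0 < r" "r \<le> n" "0 < r'" "r' \<le> n" for q q' n r r' :: int
  proof -
    have eq: "(q - q') * n = r' - r" using that(1) by (simp add: algebra_simps)
    have "n > 0" using that by linarith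
    have "\<bar>(q - q') * n\<bar> < 1 * n" using that unfolding eq by linarith
    then have "\<bar>q - q'\<bar> < 1" using \<open>n > 0\<close> unfolding abs_mult by (simp add: mult_less_cancel_right)
    then show ?thesis by simp
  qed
  obtain a b c d where g: "g = (a, b, c, d)" by (cases g)
  obtain s t where st: "t \<le> s" "0 < t"
    "v = ((a*(x*y+1) + b*y) * s + (a*x+b)*t, (c*(x*y+1) + d*y) * s + (c*x+d)*t)"
    using assms(6) by (auto simp: g cone_def step_def)
  obtain s' t' where st': "t' \<le> s'" "0 < t'"
    "v = ((a*(x'*y'+1) + b*y') * s' + (a*x'+b)*t', (c*(x'*y'+1) + d*y') * s' + (c*x'+d)*t')"
    using assms(7) by (auto simp: g cone_def step_def)
  define n where "n = y * s + t"
  define n' where "n' = y' * s' + t'"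
  define m where "m = x*n + s"
  define m' where "m' = x'*n' + s'"
  have v: "a*m + b*n = a*m' + b*n'" "c*m + d*n = c*m' + d*n'"
    using st(3) st'(3) by (auto simp: m_def m'_def n_def n'_def algebra_simps)
  have det: "a*d - b*c = 1" using assms(1) by (simp add: g)
  have "(a*d - b*c) * m = d*(a*m + b*n) - b*(c*m + d*n)" by (simp add: algebra_simps)
  also have "\<dots> = (a*d - b*c) * m'" unfolding v by (simp add: algebra_simps)
  finally have mm': "m = m'" using det by simp
  have "(a*d - b*c) * n = a*(c*m + d*n) - c*(a*m + b*n)" by (simp add: algebra_simps)
  also have "\<dots> = (a*d - b*c) * n'" unfolding v by (simp add: algebra_simps)
  finally have nn': "n = n'" using det by simp
  have "1 * s \<le> y * s" "1 * s' \<le> y' * s'" using assms st st' by (intro mult_right_mono; simp)+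
  then have "s \<le> n" "s' \<le> n'" using st(2) st'(2) unfolding n_def n'_def by linarith+
  then have xx: "x = x'" using quot[of x n s x' s'] mm' nn' st st' by (simp add: m_def m'_def)
  then have ss: "s = s'" using mm' nn' by (simp add: m_def m'_def)
  then have "y = y'" using quot[of y s t y' t'] nn' st st' by (simp add: n_def n'_def)
  then show ?thesis using xx by simp
qed

definition disj_cones :: "mat2 set \<Rightarrow> bool" where
  "disj_cones T \<longleftrightarrow> (\<forall>g\<in>T. \<forall>h\<in>T. g \<noteq> h \<longrightarrow> cone g \<inter> cone h = {})"

text \<open>\<open>disj_cones\<close> makes T a prefix code: the cone of a product lies in the cone
  of its left factor, so the product reveals the factor from T. The right factors range over all of
  \<open>sg A\<close>.\<close>

lemma disj_cones_mm_inj: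
  assumes "disj_cones T" "g \<in> T" "h \<in> T" "dt g = 1" "x \<in> sg A" "y \<in> sg A" "g \<odot> x = h \<odot> y"
  shows "g = h \<and> x = y"
proof -
  have "cone (g \<odot> x) \<subseteq> cone g" "cone (h \<odot> y) \<subseteq> cone h" using assms cone_mm by blast+
  then have "cone g \<inter> cone h \<noteq> {}" using cone_nonempty[of "g \<odot> x"] assms(7) by auto
  then have "g = h" using assms unfolding disj_cones_def by blast
  then show ?thesis using assms mm_cancel by auto
qed

section \<open>Interval lengths and stopping families\<close>

text \<open>The interval of the continued fractions with a given beginning has length $1/(a(a+b))$ for the top
  row $(a, b)$. The intervals of its continuations by $x \le A$ cover all but a proportion $2/(A+2)$ of
  it, and each of them is at most half as long, so passing to the power $s < 1$ gains a factor
  $2^{1-s}$, which beats the loss for large $A$.\<close>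

lemma interval_sum:
  fixes a b s :: real and A :: nat
  assumes "a > 0" "0 \<le> b" "b \<le> a" "0 < s" "s < 1"
    and A: "2 powr (1 - s) * (1 - 2 / (real A + 2)) \<ge> 1"
  shows "(1 / (a * (a + b))) powr s \<le> (\<Sum>x=1..A. (1 / ((a * real x + b) * (a * real x + b + a))) powr s)"
proof -
  define u where "u = (\<lambda>x::nat. 1 / ((a * real x + b) * (a * real x + b + a)))"
  define w where "w = 1 / (a * (a + b))"
  have pos: "a * real x + b > 0" if "x \<ge> 1" for x
    using assms that by (intro add_pos_nonneg) auto
  have w: "w > 0" using assms by (simp add: w_def)
  \<comment> \<open>The lengths are differences of consecutive values of 1 / (a (a x + b)).\<close>
  have tele: "(\<Sum>x=1..n. u x) = (1 / (a + b) - 1 / (a * real (n + 1) + b)) / a" for n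
  proof (induction n)
    case (Suc n)
    define p where "p = a * real (n + 1) + b"
    have p: "p > 0" "p + a > 0" using pos[of "n + 1"] assms by (simp_all add: p_def)
    have q: "a * real (Suc n + 1) + b = p + a" by (simp add: p_def algebra_simps)
    have "u (Suc n) = 1 / (p * (p + a))" by (simp add: u_def p_def)
    also have "\<dots> = (1 / p - 1 / (p + a)) / a"
      using p assms by (subst diff_frac_eq) auto
    finally have "u (Suc n) = (1 / (a * real (n + 1) + b) - 1 / (a * real (Suc n + 1) + b)) / a"
      unfolding q by (simp add: p_def)
    then show ?case using Suc by (simp add: diff_divide_distrib)
  qed (use assms in simp)
  \<comment> \<open>The uncovered proportion grows with b; at b = a it is 2 / (A + 2).\<close>
  have "1 - 2 / (real A + 2) \<le> 1 - (a + b) / (a * real (A + 1) + b)"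
  proof -
    have "(a + b) * (real A + 2) \<le> 2 * (a * real (A + 1) + b)"
      using mult_right_mono[OF assms(3), of "real A"] by (simp add: algebra_simps)
    then show ?thesis using pos[of "A + 1"] assms by (simp add: field_simps)
  qed
  also have "\<dots> = (\<Sum>x=1..A. u x) / w"
    proof -
    have X: "(1 / X - 1 / Y) / a / (1 / (a * X)) = 1 - X / Y" if "X > 0" for X Y :: real
      using that assms by (simp add: left_diff_distrib diff_divide_distrib)
    show ?thesis unfolding tele w_def using X[of "a + b"] assms by simp
  qed
  finally have ge: "1 - 2 / (real A + 2) \<le> (\<Sum>x=1..A. u x / w)"
    by (simp add: sum_divide_distrib)
  have half: "u x / w \<le> 1 / 2" "u x / w > 0" if "x \<ge> 1" for x
  proof -
    have "a * 1 \<le> a * real x" using that assms by (intro mult_left_mono) auto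
    then have ax: "a \<le> a * real x" by linarith
    have "(a + b) * (2 * a) \<le> (a * real x + b) * (a * real x + b + a)"
      using ax assms by (intro mult_mono) linarith+
    then have "2 * (a * (a + b)) \<le> (a * real x + b) * (a * real x + b + a)"
      by (simp add: algebra_simps)
    moreover have "(a * real x + b) * (a * real x + b + a) > 0" "a * (a + b) > 0"
      using pos[OF that] assms by simp_all
    moreover have "u x / w = a * (a + b) / ((a * real x + b) * (a * real x + b + a))"
      by (simp add: u_def w_def)
    ultimately show "u x / w \<le> 1 / 2" "u x / w > 0"
      by (simp_all add: divide_le_eq del: mult_pos_pos)
  qed
  have "(u x / w) powr s \<ge> 2 powr (1 - s) * (u x / w)" if "x \<ge> 1" for x
  proof -
    have "2 powr (1 - s) = (1 / 2) powr (s - 1)"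
      by (simp add: powr_divide powr_minus_divide[symmetric])
    also have "\<dots> \<le> (u x / w) powr (s - 1)"
      using half[OF that] assms by (intro powr_mono2') auto
    finally have le: "2 powr (1 - s) \<le> (u x / w) powr (s - 1)" .
    have "2 powr (1 - s) * (u x / w) \<le> (u x / w) powr (s - 1) * (u x / w)"
      using half(2)[OF that] by (intro mult_right_mono[OF le]) linarith
    also have "\<dots> = (u x / w) powr s"
    proof -
      have "y powr (s - 1) * y = y powr s" if "y > 0" for y :: real
        using that by (simp add: powr_diff)
      then show ?thesis using half(2)[OF that] by blast
    qed
    finally show ?thesis .
  qed
  then have "(\<Sum>x=1..A. 2 powr (1 - s) * (u x / w)) \<le> (\<Sum>x=1..A. (u x / w) powr s)"
    by (intro sum_mono) auto
  moreover have "1 \<le> (\<Sum>x=1..A. 2 powr (1 - s) * (u x / w))"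
    unfolding sum_distrib_left[symmetric]
    by (rule order_trans[OF A]) (intro mult_left_mono ge; simp)
  ultimately have "1 \<le> (\<Sum>x=1..A. (u x / w) powr s)" by linarith
  also have "\<dots> = (\<Sum>x=1..A. u x powr s) / w powr s"
  proof -
    have "u x > 0" if "x \<ge> 1" for x
      using pos[OF that] assms by (simp add: u_def)
    then show ?thesis
      unfolding sum_divide_distrib using w by (intro sum.cong) (auto simp: powr_divide)
  qed
  finally show ?thesis using w by (simp add: u_def w_def field_simps)
qed

text \<open>For determinant one this is the length of the interval of slopes spanned by
  \<open>cone g\<close>, raised to the power s.\<close>

definition wt :: "real \<Rightarrow> mat2 \<Rightarrow> real" where
  "wt s g = (case g of (a, b, c, d) \<Rightarrow> (1 / (real_of_int a * (real_of_int a + real_of_int b))) powr s)"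

definition children :: "nat \<Rightarrow> mat2 \<Rightarrow> mat2 set" where
  "children A g = (\<lambda>(x, y). g \<odot> step (int x) (int y)) ` ({1..A} \<times> {1..A})"

lemma childrenE:
  assumes "h \<in> children A g"
  obtains x y where "1 \<le> x" "x \<le> int A" "1 \<le> y" "y \<le> int A" "h = g \<odot> step x y"
proof -
  from assms obtain p where p: "p \<in> {1..A} \<times> {1..A}" "h = (case p of (x, y) \<Rightarrow> g \<odot> step (int x) (int y))"
    unfolding children_def by blast
  show ?thesis by (rule that[of "int (fst p)" "int (snd p)"]) (use p in \<open>auto simp: case_prod_unfold\<close>)
qed

lemma children_inj:
  assumes "g \<in> sg A"
  shows "inj_on (\<lambda>(x, y). g \<odot> step (int x) (int y)) ({1..A} \<times> {1..A})"
proof (rule inj_onI, clarify)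
  fix x y x' y' assume *: "x \<in> {1..A}" "y \<in> {1..A}" "x' \<in> {1..A}" "y' \<in> {1..A}"
    "g \<odot> step (int x) (int y) = g \<odot> step (int x') (int y')"
  then have "step (int x) (int y) = step (int x') (int y')" using mm_cancel dt_sg assms by blast
  then show "x = x' \<and> y = y'" by (simp add: step_def)
qed

text \<open>A \<open>step\<close> consists of two quotients, so \<open>interval_sum\<close> applies
  twice: to the pair (a, b) with the sum over x, then to (a x + b, a) with the sum over y.\<close>

lemma wt_children:
  assumes g: "g \<in> sg A" and s: "0 < s" "s < 1"
    and A: "2 powr (1 - s) * (1 - 2 / (real A + 2)) \<ge> 1"
  shows "wt s g \<le> (\<Sum>h\<in>children A g. wt s h)"
proof -
  obtain a b c d where gg: "g = (a, b, c, d)" by (cases g)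
  define \<alpha> where "\<alpha> = real_of_int a"
  define \<beta> where "\<beta> = real_of_int b"
  have ab: "\<alpha> > 0" "0 \<le> \<beta>" "\<beta> \<le> \<alpha>"
    using sg_bounds[OF g[unfolded gg]] by (auto simp: \<alpha>_def \<beta>_def)
  have "wt s g = (1 / (\<alpha> * (\<alpha> + \<beta>))) powr s" by (simp add: wt_def gg \<alpha>_def \<beta>_def)
  also have "\<dots> \<le> (\<Sum>x=1..A. (1 / ((\<alpha> * real x + \<beta>) * (\<alpha> * real x + \<beta> + \<alpha>))) powr s)"
    by (rule interval_sum[OF ab s A])
  also have "\<dots> \<le> (\<Sum>x=1..A. \<Sum>y=1..A. wt s (g \<odot> step (int x) (int y)))"
  proof (rule sum_mono)
    fix x assume "x \<in> {1..A}"
    then have "\<alpha> * 1 \<le> \<alpha> * real x" using ab by (intro mult_left_mono) auto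
    then have *: "\<alpha> * real x + \<beta> > 0" "\<alpha> \<le> \<alpha> * real x + \<beta>" using ab by linarith+
    have "(1 / ((\<alpha> * real x + \<beta>) * (\<alpha> * real x + \<beta> + \<alpha>))) powr s \<le>
      (\<Sum>y=1..A. (1 / (((\<alpha> * real x + \<beta>) * real y + \<alpha>) * ((\<alpha> * real x + \<beta>) * real y + \<alpha> + (\<alpha> * real x + \<beta>)))) powr s)"
      using interval_sum[OF *(1) _ *(2) s A] ab by simp
    also have "\<dots> = (\<Sum>y=1..A. wt s (g \<odot> step (int x) (int y)))"
      by (intro sum.cong arg_cong[where f = "\<lambda>t. t powr s"] arg_cong[where f = "\<lambda>t. 1 / t"] refl)
        (simp add: wt_def gg step_def \<alpha>_def \<beta>_def algebra_simps)
    finally show "(1 / ((\<alpha> * real x + \<beta>) * (\<alpha> * real x + \<beta> + \<alpha>))) powr s \<le>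
      (\<Sum>y=1..A. wt s (g \<odot> step (int x) (int y)))" .
  qed
  also have "\<dots> = (\<Sum>h\<in>children A g. wt s h)"
    unfolding children_def sum.reindex[OF children_inj[OF g]]
    by (simp add: sum.cartesian_product case_prod_unfold)
  finally show ?thesis .
qed

text \<open>Refinement with a stopping rule: words of a fixed length would vary too much in size,
  while words stopped on reaching L differ at most by the factor that a single \<open>step\<close>
  can contribute.\<close>

definition grow :: "nat \<Rightarrow> real \<Rightarrow> mat2 set \<Rightarrow> mat2 set" where
  "grow A L T = (\<Union>g\<in>T. if real_of_int (a11 g) < L then children A g else {g})"

lemma children_a11:
  assumes g: "g \<in> sg A" and h: "h \<in> children A g"
  shows "2 * a11 g \<le> a11 h" "a11 h \<le> (int A + 1)\<^sup>2 * a11 g"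
proof -
  obtain a b c d where gg: "g = (a, b, c, d)" by (cases g)
  note ab = sg_bounds[OF g[unfolded gg]]
  obtain x y where xy: "1 \<le> x" "x \<le> int A" "1 \<le> y" "y \<le> int A" and hh: "h = g \<odot> step x y"
    using h by (rule childrenE)
  have "1 * 1 \<le> x * y" using xy by (intro mult_mono) auto
  then have "a \<le> a * (x * y)" "0 \<le> b * y" using ab xy mult_left_mono[of 1 "x * y" a] by (linarith, simp)
  moreover have "a11 h = a * (x * y) + a + b * y" by (simp add: gg hh step_def algebra_simps)
  ultimately show "2 * a11 g \<le> a11 h" unfolding gg a11.simps by linarith
  have "a * (x * y) \<le> a * (int A * int A)" "b * y \<le> a * int A"
    using ab xy by (intro mult_left_mono mult_mono; simp)+
  moreover have "0 \<le> a * int A" using ab by simp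
  ultimately show "a11 h \<le> (int A + 1)\<^sup>2 * a11 g"
    by (simp add: gg hh step_def power2_eq_square algebra_simps)
qed

text \<open>The alternative with 2^n records progress: after n rounds an unfinished word has top
  left entry at least 2^n, so none is unfinished once 2^n > L. The factor (A + 1)^2 is the possible
  overshoot of the last step.\<close>

definition tree_inv :: "nat \<Rightarrow> real \<Rightarrow> real \<Rightarrow> nat \<Rightarrow> mat2 set \<Rightarrow> bool" where
  "tree_inv A s L n T \<longleftrightarrow> finite T \<and> T \<subseteq> sg A \<and> disj_cones T \<and> 1 \<le> (\<Sum>g\<in>T. wt s g) \<and>
     (\<forall>g\<in>T. real_of_int (a11 g) \<le> (real A + 1)\<^sup>2 * L \<and> (L \<le> real_of_int (a11 g) \<or> 2 ^ n \<le> a11 g))"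

lemma tree_inv_grow:
  assumes T: "tree_inv A s L n T" and s: "0 < s" "s < 1"
    and A: "2 powr (1 - s) * (1 - 2 / (real A + 2)) \<ge> 1"
  shows "tree_inv A s L (Suc n) (grow A L T)"
proof -
  define F where "F = (\<lambda>g. if real_of_int (a11 g) < L then children A g else {g})"
  have G: "grow A L T = (\<Union>g\<in>T. F g)" by (simp add: grow_def F_def)
  have fin: "finite T" "\<And>g. finite (F g)" using T by (auto simp: tree_inv_def F_def children_def)
  have sgT: "g \<in> sg A" if "g \<in> T" for g using T that by (auto simp: tree_inv_def)
  have Fsg: "h \<in> sg A" if "g \<in> T" "h \<in> F g" for g h
    using that sgT[OF that(1)] by (auto simp: F_def children_def intro!: sg.step split: if_splits)
  have Fcone: "cone h \<subseteq> cone g" if "g \<in> T" "h \<in> F g" for g h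
  proof (cases "real_of_int (a11 g) < L")
    case True
    then have "h \<in> children A g" using that by (simp add: F_def)
    then show ?thesis by (rule childrenE) (use cone_mm_step in auto)
  next
    case False
    then show ?thesis using that by (simp add: F_def)
  qed
  have disjT: "cone g \<inter> cone h = {}" if "g \<in> T" "h \<in> T" "g \<noteq> h" for g h
    using T that by (auto simp: tree_inv_def disj_cones_def)
  have disjF: "F g \<inter> F h = {}" if "g \<in> T" "h \<in> T" "g \<noteq> h" for g h
  proof (rule ccontr)
    assume "F g \<inter> F h \<noteq> {}"
    then obtain k where k: "k \<in> F g" "k \<in> F h" by auto
    then have "cone k \<subseteq> cone g \<inter> cone h" using Fcone that by blast
    then show False using disjT[OF that] cone_nonempty[of k] by auto
  qed
  have "disj_cones (grow A L T)"
    unfolding disj_cones_def G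
  proof (intro ballI impI)
    fix k k' assume "k \<in> (\<Union>g\<in>T. F g)" "k' \<in> (\<Union>g\<in>T. F g)" and kk: "k \<noteq> k'"
    then obtain g g' where g: "g \<in> T" "k \<in> F g" "g' \<in> T" "k' \<in> F g'" by auto
    show "cone k \<inter> cone k' = {}"
    proof (cases "g = g'")
      case False
      then show ?thesis using disjT[OF g(1,3) False] Fcone[OF g(1,2)] Fcone[OF g(3,4)] by blast
    next
      case True
      then have "k \<in> children A g" "k' \<in> children A g"
        using g kk by (auto simp: F_def split: if_splits)
      then obtain x y x' y' where xy: "k = g \<odot> step x y" "k' = g \<odot> step x' y'"
        "x \<ge> 1" "y \<ge> 1" "x' \<ge> 1" "y' \<ge> 1" by (elim childrenE) blast
      have "x = x' \<and> y = y'" if "v \<in> cone k" "v \<in> cone k'" for v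
        using cone_step_disjoint[OF dt_sg[OF sgT[OF g(1)]], of x y x' y' v] that xy by simp
      then show ?thesis using kk xy by blast
    qed
  qed
  moreover have "(\<Sum>g\<in>T. wt s g) \<le> (\<Sum>g\<in>T. \<Sum>h\<in>F g. wt s h)"
    using wt_children[OF sgT s A] by (intro sum_mono) (auto simp: F_def)
  then have "1 \<le> (\<Sum>h\<in>grow A L T. wt s h)"
    using T unfolding G by (subst sum.UNION_disjoint) (use fin disjF in \<open>auto simp: tree_inv_def\<close>)
  moreover have "real_of_int (a11 h) \<le> (real A + 1)\<^sup>2 * L \<and> (L \<le> real_of_int (a11 h) \<or> 2 ^ Suc n \<le> a11 h)"
    if "g \<in> T" "h \<in> F g" for g h
  proof (cases "real_of_int (a11 g) < L")
    case False
    then show ?thesis using T that by (auto simp: F_def tree_inv_def)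
  next
    case True
    then have h: "h \<in> children A g" using that by (simp add: F_def)
    have "2 ^ n \<le> a11 g" using T that True by (auto simp: tree_inv_def)
    then have 1: "2 ^ Suc n \<le> a11 h" using children_a11(1)[OF sgT[OF that(1)] h] by simp
    have "real_of_int (a11 h) \<le> real_of_int ((int A + 1)\<^sup>2 * a11 g)"
      using children_a11(2)[OF sgT[OF that(1)] h] by (simp only: of_int_le_iff)
    also have "\<dots> = (real A + 1)\<^sup>2 * real_of_int (a11 g)" by simp
    also have "\<dots> \<le> (real A + 1)\<^sup>2 * L" using True by (intro mult_left_mono) auto
    finally show ?thesis using 1 by simp
  qed
  ultimately show ?thesis
    using fin Fsg unfolding tree_inv_def G by blast
qed

text \<open>The total weight never drops below 1, the weight of \<open>id2\<close>, while a stopped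
  word has weight at most L^(-2 s). So there must be at least L^(2 s) words.\<close>

lemma stopping_family:
  assumes s: "0 < s" "s < 1" and A: "2 powr (1 - s) * (1 - 2 / (real A + 2)) \<ge> 1" and "L \<ge> 1"
  obtains T where "finite T" "T \<subseteq> sg A" "disj_cones T"
    "\<And>g. g \<in> T \<Longrightarrow> L \<le> real_of_int (a11 g) \<and> real_of_int (a11 g) \<le> (real A + 1)\<^sup>2 * L"
    "real (card T) \<ge> L powr (2 * s)"
proof -
  have L1: "1 \<le> (real A + 1)\<^sup>2 * L"
    using \<open>L \<ge> 1\<close> mult_mono[of 1 "(real A + 1)\<^sup>2" 1 L] by (simp add: one_le_power)
  have inv: "tree_inv A s L n ((grow A L ^^ n) {id2})" for n
  proof (induction n)
    case 0
    then show ?case using L1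
      by (simp add: tree_inv_def sg.id2 disj_cones_def) (simp add: id2_def wt_def)
  next
    case (Suc n)
    then show ?case using tree_inv_grow[OF _ s A] by simp
  qed
  obtain n where n: "L < 2 ^ n" using real_arch_pow[of 2 L] by auto
  define T where "T = (grow A L ^^ n) {id2}"
  have T: "tree_inv A s L n T" using inv by (simp add: T_def)
  have a: "L \<le> real_of_int (a11 g)" if "g \<in> T" for g
  proof -
    have "L \<le> real_of_int (a11 g) \<or> 2 ^ n \<le> a11 g" using T that by (auto simp: tree_inv_def)
    moreover have "2 ^ n \<le> real_of_int (a11 g)" if "2 ^ n \<le> a11 g"
    proof -
      have "real_of_int (2 ^ n) \<le> real_of_int (a11 g)" using that by (simp only: of_int_le_iff)
      then show ?thesis by simp
    qed
    ultimately show ?thesis using n by linarith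
  qed
  have "wt s g \<le> L powr (- 2 * s)" if "g \<in> T" for g
  proof -
    obtain a b c d where g: "g = (a, b, c, d)" by (cases g)
    have "g \<in> sg A" using T that by (auto simp: tree_inv_def)
    note ab = sg_bounds[OF this[unfolded g]]
    have La: "L \<le> real_of_int a" using a[OF that] by (simp add: g)
    then have "L * L \<le> real_of_int a * (real_of_int a + real_of_int b)"
      using ab \<open>L \<ge> 1\<close> by (intro mult_mono) auto
    moreover have "L * L > 0" using \<open>L \<ge> 1\<close> by simp
    ultimately have "1 / (real_of_int a * (real_of_int a + real_of_int b)) \<le> 1 / (L * L)"
      by (intro divide_left_mono) auto
    then have "wt s g \<le> (1 / (L * L)) powr s"
      unfolding wt_def g using s ab by (auto intro!: powr_mono2)
    also have "\<dots> = L powr (- 2 * s)"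
      using \<open>L \<ge> 1\<close> by (simp add: powr_divide powr_mult powr_minus_divide flip: powr_add)
    finally show ?thesis .
  qed
  then have "(\<Sum>g\<in>T. wt s g) \<le> real (card T) * L powr (- 2 * s)"
    by (rule sum_bounded_above)
  then have "1 \<le> real (card T) * L powr (- 2 * s)" using T by (auto simp: tree_inv_def)
  then have "1 * L powr (2 * s) \<le> real (card T) * L powr (- 2 * s) * L powr (2 * s)"
    by (intro mult_right_mono) auto
  also have "\<dots> = real (card T)" using \<open>L \<ge> 1\<close> by (simp add: mult.assoc flip: powr_add)
  finally have "real (card T) \<ge> L powr (2 * s)" by simp
  then show ?thesis using that[of T] T a by (auto simp: tree_inv_def)
qed

lemma block_family:
  fixes \<eta> :: real
  assumes "0 < \<eta>" "\<eta> < 1"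
  obtains A :: nat and \<kappa> M0 :: real where "\<kappa> \<ge> 1" "M0 \<ge> 1"
    "\<And>M. M \<ge> M0 \<Longrightarrow> \<exists>T. finite T \<and> T \<subseteq> sg A \<and> disj_cones T \<and>
      (\<forall>g\<in>T. M / (2 * \<kappa>) \<le> real_of_int (a11 g) \<and> 2 * real_of_int (a11 g) \<le> M) \<and>
      real (card T) \<ge> M powr (2 - \<eta>)"
proof -
  \<comment> \<open>The family has at least L^(2 s) = L^(2 - \<eta>/2) elements; the spare
    M^(\<eta>/2) pays for the constant (2 \<kappa>)^(2 s), by the choice of \<open>M0\<close>
    below.\<close>
  define s where "s = 1 - \<eta> / 4"
  have s: "0 < s" "s < 1" using assms by (auto simp: s_def)
  define r :: real where "r = 2 powr (s - 1)"
  have r: "0 < r" "r < 1" using s by (auto simp: r_def powr_less_one)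
  \<comment> \<open>Makes the covered proportion 1 - 2/(A + 2) at least r = 2^(s - 1), so that the
    gain 2^(1 - s) compensates the loss.\<close>
  obtain A :: nat where A: "real A \<ge> 2 / (1 - r)" using real_arch_simple by blast
  have "2 / (real A + 2) \<le> 1 - r"
  proof -
    have "2 \<le> (1 - r) * real A" using A r by (simp add: field_simps)
    then have "2 \<le> (1 - r) * (real A + 2)" using r by (simp add: algebra_simps)
    then show ?thesis by (simp add: field_simps)
  qed
  then have "2 powr (1 - s) * r \<le> 2 powr (1 - s) * (1 - 2 / (real A + 2))"
    by (intro mult_left_mono) auto
  then have As: "2 powr (1 - s) * (1 - 2 / (real A + 2)) \<ge> 1"
    by (simp add: r_def flip: powr_add)
  define \<kappa> where "\<kappa> = (real A + 1)\<^sup>2"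
  have k1: "\<kappa> \<ge> 1" by (simp add: \<kappa>_def)
  define M0 where "M0 = (2 * \<kappa>) powr (4 / \<eta>)"
  have M0: "2 * \<kappa> \<le> M0"
    using powr_mono[of 1 "4 / \<eta>" "2 * \<kappa>"] k1 assms by (simp add: M0_def)
  show ?thesis
  proof (rule that[of \<kappa> M0 A])
    show "\<kappa> \<ge> 1" "M0 \<ge> 1" using k1 M0 by auto
    fix M assume M: "M \<ge> M0"
    define L where "L = M / (2 * \<kappa>)"
    have "L \<ge> 1" using M M0 k1 by (simp add: L_def)
    then obtain T where T: "finite T" "T \<subseteq> sg A" "disj_cones T"
      "\<And>g. g \<in> T \<Longrightarrow> L \<le> real_of_int (a11 g) \<and> real_of_int (a11 g) \<le> (real A + 1)\<^sup>2 * L"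
      "real (card T) \<ge> L powr (2 * s)"
      using stopping_family[OF s As] by blast
    have Mpos: "M > 0" using M M0 k1 by linarith
    have "(2 * \<kappa>) powr (2 * s) \<le> (2 * \<kappa>) powr 2" using k1 s by (intro powr_mono) auto
    also have "\<dots> = M0 powr (\<eta> / 2)" using assms by (simp add: M0_def powr_powr)
    also have "\<dots> \<le> M powr (\<eta> / 2)" using M M0 k1 assms by (intro powr_mono2) auto
    finally have "M powr (2 - \<eta>) * (2 * \<kappa>) powr (2 * s) \<le> M powr (2 - \<eta>) * M powr (\<eta> / 2)"
      by (intro mult_left_mono) auto
    also have "\<dots> = M powr (2 * s)" by (simp add: s_def flip: powr_add)
    finally have "M powr (2 - \<eta>) \<le> L powr (2 * s)"
      using k1 Mpos by (simp add: L_def powr_divide pos_le_divide_eq)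
    moreover have "\<kappa> * L = M / 2" using k1 by (simp add: L_def)
    ultimately show "\<exists>T. finite T \<and> T \<subseteq> sg A \<and> disj_cones T \<and>
      (\<forall>g\<in>T. M / (2 * \<kappa>) \<le> real_of_int (a11 g) \<and> 2 * real_of_int (a11 g) \<le> M) \<and>
      real (card T) \<ge> M powr (2 - \<eta>)"
      using T unfolding \<kappa>_def[symmetric] by (intro exI[of _ T]) (force simp: L_def[symmetric])
  qed
qed

section \<open>Quadratic congruences\<close>

lemma card_le_2I:
  assumes "\<And>x y z. x \<in> S \<Longrightarrow> y \<in> S \<Longrightarrow> z \<in> S \<Longrightarrow> x \<noteq> y \<Longrightarrow> x \<noteq> z \<Longrightarrow> y \<noteq> z \<Longrightarrow> False"
  shows "card S \<le> 2"
proof (rule ccontr)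
  assume "\<not> card S \<le> 2"
  then obtain T where T: "T \<subseteq> S" "card T = 3"
    by (metis not_less_eq_eq numeral_2_eq_2 numeral_3_eq_3 obtain_subset_with_card_n)
  then obtain x y z where "T = {x, y, z}" "x \<noteq> y" "x \<noteq> z" "y \<noteq> z"
    by (auto simp: card_3_iff)
  then show False using assms T by blast
qed

locale odd_prime =
  fixes p :: int
  assumes prime: "prime p" and odd: "2 < p"
begin

lemma not_dvd_2: "\<not> p dvd 2"
  using odd by (auto dest: zdvd_imp_le)

lemma dvd_2_iff: "p dvd 2 * x \<longleftrightarrow> p dvd x"
  using prime not_dvd_2 prime_dvd_mult_iff by blast

lemma dvd_4_iff: "p dvd 4 * x \<longleftrightarrow> p dvd x"
  using dvd_2_iff[of "2 * x"] dvd_2_iff[of x] by simp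

lemma eq_of_dvd_diff: "x \<in> {0..<q} \<Longrightarrow> y \<in> {0..<q} \<Longrightarrow> q dvd x - y \<Longrightarrow> x = y" for x y q :: int
  by (metis atLeastLessThan_iff mod_eq_dvd_iff mod_pos_pos_trivial)

lemma finite_residues: "finite {x \<in> {0..<n :: int}. P x}"
  by (rule finite_subset[of _ "{0..<n}"]) auto

lemma dvd_diff_root:
  fixes a b c x y :: int
  assumes "q dvd a * x\<^sup>2 + b * x + c" "q dvd a * y\<^sup>2 + b * y + c"
  shows "q dvd (x - y) * (a * (x + y) + b)"
proof -
  have "(x - y) * (a * (x + y) + b) = (a * x\<^sup>2 + b * x + c) - (a * y\<^sup>2 + b * y + c)"
    by (simp add: algebra_simps power2_eq_square)
  then show ?thesis using assms by (metis dvd_diff)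
qed

lemma quad_roots:
  assumes "\<not> (p dvd a \<and> p dvd b)"
  shows "card {x \<in> {0..<p}. p dvd a * x\<^sup>2 + b * x + c} \<le> 2"
proof (rule card_le_2I)
  have *: "p dvd a * (x + y) + b" if "x \<in> {x \<in> {0..<p}. p dvd a * x\<^sup>2 + b * x + c}"
    "y \<in> {x \<in> {0..<p}. p dvd a * x\<^sup>2 + b * x + c}" "x \<noteq> y" for x y
  proof -
    have "p dvd (x - y) * (a * (x + y) + b)" using that by (intro dvd_diff_root) auto
    moreover have "\<not> p dvd x - y" using eq_of_dvd_diff[of x p y] that by auto
    ultimately show ?thesis using prime prime_dvd_mult_iff by blast
  qed
  fix x y z assume xyz: "x \<in> {x \<in> {0..<p}. p dvd a * x\<^sup>2 + b * x + c}"
    "y \<in> {x \<in> {0..<p}. p dvd a * x\<^sup>2 + b * x + c}"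
    "z \<in> {x \<in> {0..<p}. p dvd a * x\<^sup>2 + b * x + c}" "x \<noteq> y" "x \<noteq> z" "y \<noteq> z"
  have "p dvd (a * (x + y) + b) - (a * (x + z) + b)" using * xyz by (meson dvd_diff)
  then have "p dvd a * (y - z)" by (simp add: algebra_simps)
  moreover have "\<not> p dvd y - z" using eq_of_dvd_diff[of y p z] xyz by auto
  ultimately have "p dvd a" using prime prime_dvd_mult_iff by blast
  moreover from this have "p dvd b" using *[OF xyz(1,2,4)] by (simp add: dvd_add_right_iff)
  ultimately show False using assms by blast
qed

lemma card_residues:
  assumes "card {x \<in> {0..<p}. P x} \<le> n" "\<And>x. P (x mod p) \<longleftrightarrow> P x"
  shows "card {x \<in> {0..<p\<^sup>2}. P x} \<le> n * nat p"
proof -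
  have "{x \<in> {0..<p\<^sup>2}. P x} \<subseteq> (\<lambda>(r, i). r + p * i) ` ({x \<in> {0..<p}. P x} \<times> {0..<p})"
  proof
    fix x assume x: "x \<in> {x \<in> {0..<p\<^sup>2}. P x}"
    have "p * (x div p) \<le> x" using odd
      by (metis add_increasing2 mult_div_mod_eq order_refl pos_mod_sign order_less_trans zero_less_numeral le_add_same_cancel1)
    also have "x < p * p" using x by (simp add: power2_eq_square)
    finally have "x div p < p" using odd by simp
    moreover have "0 \<le> x div p" "0 \<le> x mod p" "x mod p < p"
      using x odd by (simp_all add: pos_imp_zdiv_nonneg_iff)
    ultimately show "x \<in> (\<lambda>(r, i). r + p * i) ` ({x \<in> {0..<p}. P x} \<times> {0..<p})"
      using x assms(2)[of x] by (intro image_eqI[of _ _ "(x mod p, x div p)"]) auto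
  qed
  then have "card {x \<in> {0..<p\<^sup>2}. P x} \<le> card ({x \<in> {0..<p}. P x} \<times> {0..<p})"
    by (rule surj_card_le[rotated]) (intro finite_cartesian_product finite_residues, simp)
  also have "\<dots> \<le> n * nat p" using assms(1) by (simp add: card_cartesian_product)
  finally show ?thesis .
qed

lemma dvd_quad_mod: "p dvd a * (x mod p)\<^sup>2 + b * (x mod p) + c \<longleftrightarrow> p dvd a * x\<^sup>2 + b * x + c"
proof -
  have "[a * (x mod p)\<^sup>2 + b * (x mod p) + c = a * x\<^sup>2 + b * x + c] (mod p)"
    by (intro cong_add cong_mult cong_pow cong_refl) auto
  then show ?thesis by (rule cong_dvd_iff)
qed

text \<open>By completing the square, (2 a x + b)^2 is congruent to the discriminant modulo p at
  every root. If p does not divide it, the roots are simple and distinct modulo p; if it does, then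
  p does not divide a, the root is unique modulo p and has at most p lifts.\<close>

lemma quad_roots_sq:
  assumes "\<not> (p dvd a \<and> p dvd b)"
  shows "card {x \<in> {0..<p\<^sup>2}. p\<^sup>2 dvd a * x\<^sup>2 + b * x + c} \<le>
    (if p dvd b\<^sup>2 - 4 * a * c then nat p else 2)"
proof -
  let ?R = "{x \<in> {0..<p\<^sup>2}. p\<^sup>2 dvd a * x\<^sup>2 + b * x + c}"
  have pp: "p dvd y" if "p\<^sup>2 dvd y" for y
    using that by (meson dvd_power dvd_trans zero_less_numeral)
  have disc: "p dvd b\<^sup>2 - 4 * a * c \<longleftrightarrow> p dvd 2 * a * x + b" if "p\<^sup>2 dvd a * x\<^sup>2 + b * x + c" for x
  proof -
    have "(2 * a * x + b)\<^sup>2 = (b\<^sup>2 - 4 * a * c) + 4 * a * (a * x\<^sup>2 + b * x + c)"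
      by (simp add: algebra_simps power2_eq_square)
    moreover have "p dvd 4 * a * (a * x\<^sup>2 + b * x + c)" using pp[OF that] by simp
    ultimately have "p dvd b\<^sup>2 - 4 * a * c \<longleftrightarrow> p dvd (2 * a * x + b)\<^sup>2"
      by (simp add: dvd_add_left_iff)
    then show ?thesis using prime by (simp add: prime_dvd_power_iff)
  qed
  show ?thesis
  proof (cases "p dvd b\<^sup>2 - 4 * a * c")
    case False
    have "inj_on (\<lambda>x. x mod p) ?R"
    proof (rule inj_onI)
      fix x y assume x: "x \<in> ?R" and y: "y \<in> ?R" and "x mod p = y mod p"
      then have "p dvd y - x" by (metis mod_eq_dvd_iff)
      then have "p dvd a * (y - x)" by simp
      moreover have "a * (x + y) + b = (2 * a * x + b) + a * (y - x)" by (simp add: algebra_simps)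
      moreover have "\<not> p dvd 2 * a * x + b" using False disc x by blast
      ultimately have "\<not> p dvd a * (x + y) + b" by (metis dvd_add_left_iff)
      then have "coprime p (a * (x + y) + b)" by (intro prime_imp_coprime prime)
      then have "coprime (p\<^sup>2) (a * (x + y) + b)" by simp
      moreover have "p\<^sup>2 dvd (x - y) * (a * (x + y) + b)"
        using x y by (intro dvd_diff_root) auto
      ultimately have "p\<^sup>2 dvd x - y" by (simp add: coprime_dvd_mult_left_iff)
      then show "x = y" using x y by (intro eq_of_dvd_diff[of x "p\<^sup>2" y]) auto
    qed
    moreover have "(\<lambda>x. x mod p) ` ?R \<subseteq> {x \<in> {0..<p}. p dvd a * x\<^sup>2 + b * x + c}"
    proof (rule image_subsetI)
      fix x assume "x \<in> ?R"
      then have "p dvd a * x\<^sup>2 + b * x + c" using pp by blast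
      then show "x mod p \<in> {x \<in> {0..<p}. p dvd a * x\<^sup>2 + b * x + c}"
        using odd dvd_quad_mod[of a x b c] by simp
    qed
    ultimately have "card ?R \<le> card {x \<in> {0..<p}. p dvd a * x\<^sup>2 + b * x + c}"
      by (intro card_inj_on_le finite_residues)
    also have "\<dots> \<le> 2" by (rule quad_roots[OF assms])
    finally show ?thesis using False by simp
  next
    case True
    have a: "\<not> p dvd a"
    proof
      assume "p dvd a"
      then have "p dvd 4 * a * c" by simp
      then have "p dvd b\<^sup>2" using True by (metis diff_add_cancel dvd_add)
      then show False using \<open>p dvd a\<close> assms prime prime_dvd_power by blast
    qed
    have "card ?R \<le> card {x \<in> {0..<p\<^sup>2}. p dvd 0 * x\<^sup>2 + (2 * a) * x + b}"
      using disc True by (intro card_mono finite_residues) auto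
    also have "\<dots> \<le> 1 * nat p"
    proof (rule card_residues)
      show "card {x \<in> {0..<p}. p dvd 0 * x\<^sup>2 + (2 * a) * x + b} \<le> 1"
        unfolding One_nat_def card_le_Suc0_iff_eq[OF finite_residues]
      proof (intro ballI)
        fix x y assume x: "x \<in> {x \<in> {0..<p}. p dvd 0 * x\<^sup>2 + (2 * a) * x + b}"
          and y: "y \<in> {x \<in> {0..<p}. p dvd 0 * x\<^sup>2 + (2 * a) * x + b}"
        then have "p dvd (x - y) * (0 * (x + y) + 2 * a)" by (intro dvd_diff_root) auto
        then have "p dvd x - y" using a prime dvd_2_iff[of "(x - y) * a"]
          by (simp add: ac_simps prime_dvd_mult_iff)
        then show "x = y" using x y by (intro eq_of_dvd_diff[of x p y]) auto
      qed
    qed (rule dvd_quad_mod)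
    finally show ?thesis using True by simp
  qed
qed

text \<open>The fibre over a generic \<open>k\<close> has at most two points; the \<open>O(p)\<close> values of \<open>k\<close> at which
  the discriminant vanishes modulo \<open>p\<close> contribute \<open>O(p)\<close> points each.\<close>

lemma quad_family:
  assumes "\<And>k. \<not> (p dvd \<alpha> k \<and> p dvd \<beta> k)"
    and "\<And>k. p dvd (\<beta> k)\<^sup>2 - 4 * \<alpha> k * \<gamma> k \<Longrightarrow> p dvd a * k\<^sup>2 + b * k + c"
    and "\<not> (p dvd a \<and> p dvd b)"
  shows "card {(k, j). k \<in> {0..<p\<^sup>2} \<and> j \<in> {0..<p\<^sup>2} \<and> p\<^sup>2 dvd \<alpha> k * j\<^sup>2 + \<beta> k * j + \<gamma> k} \<le> 4 * (nat p)\<^sup>2"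
proof -
  define R where "R = (\<lambda>k. {j \<in> {0..<p\<^sup>2}. p\<^sup>2 dvd \<alpha> k * j\<^sup>2 + \<beta> k * j + \<gamma> k})"
  define Z where "Z = {k \<in> {0..<p\<^sup>2}. p dvd a * k\<^sup>2 + b * k + c}"
  have np: "nat (p\<^sup>2) = (nat p)\<^sup>2" using odd by (simp add: nat_power_eq)
  have "card Z \<le> 2 * nat p"
    unfolding Z_def by (intro card_residues quad_roots assms(3) dvd_quad_mod)
  then have Z: "card Z * nat p \<le> 2 * (nat p)\<^sup>2" by (simp add: power2_eq_square)
  have "{(k, j). k \<in> {0..<p\<^sup>2} \<and> j \<in> {0..<p\<^sup>2} \<and> p\<^sup>2 dvd \<alpha> k * j\<^sup>2 + \<beta> k * j + \<gamma> k} = (SIGMA k:{0..<p\<^sup>2}. R k)"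
    by (auto simp: R_def)
  moreover have "finite (R k)" for k
    unfolding R_def by (rule finite_subset[of _ "{0..<p\<^sup>2}"]) auto
  ultimately have "card {(k, j). k \<in> {0..<p\<^sup>2} \<and> j \<in> {0..<p\<^sup>2} \<and> p\<^sup>2 dvd \<alpha> k * j\<^sup>2 + \<beta> k * j + \<gamma> k} = (\<Sum>k\<in>{0..<p\<^sup>2}. card (R k))"
    by simp
  also have "\<dots> \<le> (\<Sum>k\<in>{0..<p\<^sup>2}. 2 + (if k \<in> Z then nat p else 0))"
  proof (rule sum_mono)
    fix k assume "k \<in> {0..<p\<^sup>2}"
    then show "card (R k) \<le> 2 + (if k \<in> Z then nat p else 0)"
      using quad_roots_sq[OF assms(1)[of k], of "\<gamma> k"] assms(2)[of k] unfolding R_def Z_def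
      by (auto split: if_splits)
  qed
  also have "\<dots> = 2 * (nat p)\<^sup>2 + card Z * nat p"
  proof -
    have "(\<Sum>k\<in>{0..<p\<^sup>2}. if k \<in> Z then nat p else 0) = card ({0..<p\<^sup>2} \<inter> Z) * nat p"
      by (simp add: sum.If_cases)
    moreover have "{0..<p\<^sup>2} \<inter> Z = Z" by (auto simp: Z_def)
    ultimately show ?thesis unfolding sum.distrib by (simp add: np)
  qed
  finally show ?thesis using Z by simp
qed

definition bad_residues :: "int \<Rightarrow> mat2 set" where
  "bad_residues \<sigma> = {g. g \<in> {0..<p\<^sup>2} \<times> {0..<p\<^sup>2} \<times> {0..<p\<^sup>2} \<times> {0..<p\<^sup>2} \<and>
     p\<^sup>2 dvd dt g - 1 \<and> p\<^sup>2 dvd tn g - 2 * \<sigma>}"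

text \<open>Since $t - 2\sigma = (a - \sigma d)^2 + (b + \sigma c)^2$ for determinant one, the first two
  coordinates below form a zero of a binary form, and given them the determinant is a
  quadratic polynomial in \<open>d\<close>.\<close>

lemma card_bad_residues:
  assumes \<sigma>: "\<sigma> = 1 \<or> \<sigma> = -1"
  shows "real (card (bad_residues \<sigma>)) \<le> 16 * real_of_int p ^ 4"
proof -
  define q where "q = p\<^sup>2"
  have q0: "q > 0" using odd by (simp add: q_def)
  have \<sigma>2: "\<sigma> * \<sigma> = 1" using \<sigma> by auto
  define UV where "UV = {(u, v). u \<in> {0..<q} \<and> v \<in> {0..<q} \<and> q dvd 1 * v\<^sup>2 + 0 * v + u\<^sup>2}"
  define f where "f = (\<lambda>(a, b, c, d). ((a - \<sigma> * d) mod q, (b + \<sigma> * c) mod q))"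
  have np: "real (nat p) = real_of_int p" using odd by simp
  have fin: "finite (bad_residues \<sigma>)"
    by (rule finite_subset[of _ "{0..<p\<^sup>2} \<times> {0..<p\<^sup>2} \<times> {0..<p\<^sup>2} \<times> {0..<p\<^sup>2}"]) (auto simp: bad_residues_def)
  have "real (card (bad_residues \<sigma>)) \<le> real (card UV) * (4 * real_of_int p ^ 2)"
  proof (rule card_le_fibres[where f = f, OF fin])
    show "finite UV" by (rule finite_subset[of _ "{0..<q} \<times> {0..<q}"]) (auto simp: UV_def)
    show "f ` bad_residues \<sigma> \<subseteq> UV"
    proof
      fix w assume "w \<in> f ` bad_residues \<sigma>"
      then obtain a b c d where w: "w = f (a, b, c, d)" and "(a, b, c, d) \<in> bad_residues \<sigma>" by auto
      then have *: "q dvd (a * d - b * c) - 1" "q dvd (a\<^sup>2 + b\<^sup>2 + c\<^sup>2 + d\<^sup>2) - 2 * \<sigma>"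
        by (auto simp: bad_residues_def q_def)
      have "(b + \<sigma> * c)\<^sup>2 + (a - \<sigma> * d)\<^sup>2 = (a\<^sup>2 + b\<^sup>2 + (\<sigma> * \<sigma>) * c\<^sup>2 + (\<sigma> * \<sigma>) * d\<^sup>2) - 2 * \<sigma> * (a * d - b * c)"
        by (simp add: power2_eq_square algebra_simps)
      also have "\<dots> = ((a\<^sup>2 + b\<^sup>2 + c\<^sup>2 + d\<^sup>2) - 2 * \<sigma>) - 2 * \<sigma> * ((a * d - b * c) - 1)"
        unfolding \<sigma>2 by (simp add: algebra_simps)
      finally have "q dvd (b + \<sigma> * c)\<^sup>2 + (a - \<sigma> * d)\<^sup>2" using * by (metis dvd_diff dvd_mult)
      moreover have "[((b + \<sigma> * c) mod q)\<^sup>2 + ((a - \<sigma> * d) mod q)\<^sup>2 = (b + \<sigma> * c)\<^sup>2 + (a - \<sigma> * d)\<^sup>2] (mod q)"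
        by (intro cong_add cong_pow) auto
      ultimately have "q dvd ((b + \<sigma> * c) mod q)\<^sup>2 + ((a - \<sigma> * d) mod q)\<^sup>2"
        using cong_dvd_iff by blast
      then show "w \<in> UV" using q0 by (simp add: UV_def w f_def)
    qed
    fix w assume "w \<in> UV"
    obtain u v where w: "w = (u, v)" by (cases w)
    define g where "g = (\<lambda>(a :: int, b :: int, c :: int, d :: int). (c, d))"
    let ?F = "{x \<in> bad_residues \<sigma>. f x = w}"
    \<comment> \<open>Inserting a = u + \<sigma> d and b = v - \<sigma> c into a d - b c = 1 gives
      this polynomial, with k = c and j = d. Its discriminant is quadratic in k with leading
      coefficient -4.\<close>
    let ?T = "{(k, j). k \<in> {0..<p\<^sup>2} \<and> j \<in> {0..<p\<^sup>2} \<and>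
      p\<^sup>2 dvd \<sigma> * j\<^sup>2 + u * j + (\<sigma> * k\<^sup>2 - v * k - 1)}"
    have "inj_on g ?F"
    proof (rule inj_onI)
      fix x y assume x: "x \<in> ?F" and y: "y \<in> ?F" and gxy: "g x = g y"
      obtain a b c d where xx: "x = (a, b, c, d)" by (cases x)
      obtain a' b' where yy: "y = (a', b', c, d)" using gxy by (cases y) (auto simp: g_def xx)
      have "(a - \<sigma> * d) mod q = (a' - \<sigma> * d) mod q" "(b + \<sigma> * c) mod q = (b' + \<sigma> * c) mod q"
        using x y by (auto simp: xx yy f_def w)
      then have "q dvd (a - \<sigma> * d) - (a' - \<sigma> * d)" "q dvd (b + \<sigma> * c) - (b' + \<sigma> * c)"
        by (simp_all only: mod_eq_dvd_iff)
      then have "q dvd a - a'" "q dvd b - b'" by simp_all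
      moreover have "a \<in> {0..<q}" "a' \<in> {0..<q}" "b \<in> {0..<q}" "b' \<in> {0..<q}"
        using x y by (auto simp: xx yy bad_residues_def q_def)
      ultimately show "x = y" using eq_of_dvd_diff xx yy by blast
    qed
    moreover have "g ` ?F \<subseteq> ?T"
    proof
      fix z assume "z \<in> g ` ?F"
      then obtain a b c d where z: "z = (c, d)" and x: "(a, b, c, d) \<in> bad_residues \<sigma>" "f (a, b, c, d) = w"
        by (auto simp: g_def)
      have "(a - \<sigma> * d) mod q = u" "(b + \<sigma> * c) mod q = v" using x(2) by (auto simp: f_def w)
      then have c: "[u = a - \<sigma> * d] (mod q)" "[v = b + \<sigma> * c] (mod q)" by auto
      have "[\<sigma> * d\<^sup>2 + u * d + (\<sigma> * c\<^sup>2 - v * c - 1) =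
        \<sigma> * d\<^sup>2 + (a - \<sigma> * d) * d + (\<sigma> * c\<^sup>2 - (b + \<sigma> * c) * c - 1)] (mod q)"
        by (intro cong_add cong_diff cong_mult cong_refl c)
      moreover have "\<sigma> * d\<^sup>2 + (a - \<sigma> * d) * d + (\<sigma> * c\<^sup>2 - (b + \<sigma> * c) * c - 1) = a * d - b * c - 1"
        by (simp add: algebra_simps power2_eq_square)
      moreover have "q dvd a * d - b * c - 1" using x(1) by (simp add: bad_residues_def q_def)
      ultimately have "q dvd \<sigma> * d\<^sup>2 + u * d + (\<sigma> * c\<^sup>2 - v * c - 1)" using cong_dvd_iff by metis
      then show "z \<in> ?T" using x(1) by (simp add: z bad_residues_def q_def)
    qed
    moreover have "finite ?T"
      by (rule finite_subset[of _ "{0..<p\<^sup>2} \<times> {0..<p\<^sup>2}"]) auto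
    ultimately have "card ?F \<le> card ?T" by (intro card_inj_on_le)
    also have "card ?T \<le> 4 * (nat p)\<^sup>2"
    proof (rule quad_family)
      have "\<not> p dvd \<sigma>" using \<sigma> odd by (auto dest: zdvd_imp_le)
      then show "\<not> (p dvd \<sigma> \<and> p dvd u)" by blast
      show "p dvd (-4) * k\<^sup>2 + (4 * \<sigma> * v) * k + (u\<^sup>2 + 4 * \<sigma>)"
        if "p dvd u\<^sup>2 - 4 * \<sigma> * (\<sigma> * k\<^sup>2 - v * k - 1)" for k
      proof -
        have eq: "u\<^sup>2 - 4 * \<sigma> * (\<sigma> * k\<^sup>2 - v * k - 1) = (-4) * k\<^sup>2 + (4 * \<sigma> * v) * k + (u\<^sup>2 + 4 * \<sigma>)"
          using \<sigma> by (auto simp: algebra_simps)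
        show ?thesis using that unfolding eq .
      qed
      show "\<not> (p dvd -4 \<and> p dvd 4 * \<sigma> * v)" using dvd_4_iff[of 1] prime by auto
    qed
    finally have "real (card ?F) \<le> real (4 * (nat p)\<^sup>2)" by (simp only: of_nat_le_iff)
    then show "real (card ?F) \<le> 4 * real_of_int p ^ 2" by (simp add: np)
  qed
  also have "real (card UV) \<le> 4 * real_of_int p ^ 2"
  proof -
    \<comment> \<open>As a polynomial in v, the form u^2 + v^2 has discriminant -4 u^2, which
      vanishes modulo p only if p divides u.\<close>
    have "card UV \<le> 4 * (nat p)\<^sup>2"
      unfolding UV_def q_def
    proof (rule quad_family)
      show "\<not> (p dvd 1 \<and> p dvd 0)" using prime by auto
      show "p dvd 0 * k\<^sup>2 + 1 * k + 0" if "p dvd 0\<^sup>2 - 4 * 1 * k\<^sup>2" for k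
        using that dvd_4_iff[of "k\<^sup>2"] prime prime_dvd_power by auto
      show "\<not> (p dvd 0 \<and> p dvd 1)" using prime by auto
    qed
    then have "real (card UV) \<le> real (4 * (nat p)\<^sup>2)" by (simp only: of_nat_le_iff)
    then show ?thesis by (simp add: np)
  qed
  finally show ?thesis by (simp add: mult_right_mono)
qed

text \<open>With $y = x_2 + k x_1$ and $n = |y|^2$, where $x_1, x_2$ are the columns of \<open>g\<close>, the discriminant
  of the polynomial in \<open>j\<close> is $-4 (n - \sigma)^2$ up to the factor $Q^2$.\<close>

lemma card_bad_steps:
  assumes \<sigma>: "\<sigma> = 1 \<or> \<sigma> = -1" and g: "dt g = 1" and Q: "\<not> p dvd Q"
  shows "card {(k, j). k \<in> {0..<p\<^sup>2} \<and> j \<in> {0..<p\<^sup>2} \<and> p\<^sup>2 dvd tn (g \<odot> step (Q * k) (Q * j)) - 2 * \<sigma>}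
    \<le> 4 * (nat p)\<^sup>2"
proof -
  obtain a b c d where gg: "g = (a, b, c, d)" by (cases g)
  define l where "l = a\<^sup>2 + c\<^sup>2"
  define m0 where "m0 = a * b + c * d"
  define n where "n = (\<lambda>k. (b + Q * k * a)\<^sup>2 + (d + Q * k * c)\<^sup>2)"
  define m where "m = (\<lambda>k. a * (b + Q * k * a) + c * (d + Q * k * c))"
  have \<sigma>2: "\<sigma> * \<sigma> = 1" using \<sigma> by auto
  have det: "a * d - b * c = 1" using g by (simp add: gg)
  \<comment> \<open>Lagrange's identity for x_1 and y, whose Gram matrix has the entries l, m, n. It
    keeps p from dividing both n and m, and it makes the discriminant below minus a square.\<close>
  have lag: "n k * l - (m k)\<^sup>2 = 1" for k
  proof -
    have "n k * l - (m k)\<^sup>2 = (a * (d + Q * k * c) - (b + Q * k * a) * c)\<^sup>2"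
      by (simp add: n_def l_def m_def power2_eq_square algebra_simps)
    also have "a * (d + Q * k * c) - (b + Q * k * a) * c = 1" using det by (simp add: algebra_simps)
    finally show ?thesis by simp
  qed
  have p1: "\<not> p dvd 1" using prime by auto
  have tn: "tn (g \<odot> step (Q * k) (Q * j)) - 2 * \<sigma> =
    (n k * Q\<^sup>2) * j\<^sup>2 + (2 * m k * Q) * j + (l + n k - 2 * \<sigma>)" for k j
    by (simp add: gg step_def n_def l_def m_def power2_eq_square algebra_simps)
  show ?thesis unfolding tn
  proof (rule quad_family)
    fix k
    show "\<not> (p dvd n k * Q\<^sup>2 \<and> p dvd 2 * m k * Q)"
    proof
      assume "p dvd n k * Q\<^sup>2 \<and> p dvd 2 * m k * Q"
      then have "p dvd n k" "p dvd m k"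
        using Q prime dvd_2_iff[of "m k * Q"] by (auto simp: prime_dvd_mult_iff mult.assoc prime_dvd_power_iff)
      then have "p dvd n k * l - (m k)\<^sup>2" by (simp add: power2_eq_square)
      then show False using lag p1 by simp
    qed
    assume "p dvd (2 * m k * Q)\<^sup>2 - 4 * (n k * Q\<^sup>2) * (l + n k - 2 * \<sigma>)"
    also have "(2 * m k * Q)\<^sup>2 - 4 * (n k * Q\<^sup>2) * (l + n k - 2 * \<sigma>) =
      4 * (Q\<^sup>2 * ((\<sigma> * \<sigma> - (n k * l - (m k)\<^sup>2)) - (n k - \<sigma>)\<^sup>2))"
      by (simp add: power2_eq_square algebra_simps)
    also have "\<dots> = 4 * (Q\<^sup>2 * - (n k - \<sigma>)\<^sup>2)" unfolding lag \<sigma>2 by simp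
    finally have "p dvd n k - \<sigma>"
      using Q prime unfolding dvd_4_iff by (auto simp: prime_dvd_mult_iff prime_dvd_power_iff)
    moreover have "n k - \<sigma> = (l * Q\<^sup>2) * k\<^sup>2 + (2 * m0 * Q) * k + (b\<^sup>2 + d\<^sup>2 - \<sigma>)"
      by (simp add: n_def l_def m0_def power2_eq_square algebra_simps)
    ultimately show "p dvd (l * Q\<^sup>2) * k\<^sup>2 + (2 * m0 * Q) * k + (b\<^sup>2 + d\<^sup>2 - \<sigma>)" by simp
  next
    show "\<not> (p dvd l * Q\<^sup>2 \<and> p dvd 2 * m0 * Q)"
    proof
      assume "p dvd l * Q\<^sup>2 \<and> p dvd 2 * m0 * Q"
      then have *: "p dvd l" "p dvd m0"
        using Q prime dvd_2_iff[of "m0 * Q"] by (auto simp: prime_dvd_mult_iff mult.assoc prime_dvd_power_iff)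
      have "m 0 = m0" by (simp add: m_def m0_def)
      then have "n 0 * l - m0\<^sup>2 = 1" using lag[of 0] by simp
      moreover have "p dvd n 0 * l - m0\<^sup>2" using * by (simp add: power2_eq_square)
      ultimately show False using p1 by simp
    qed
  qed
qed

end

section \<open>Congruent pairs of matrices\<close>

fun rd :: "int \<Rightarrow> mat2 \<Rightarrow> mat2" where
  "rd q (a, b, c, d) = (a mod q, b mod q, c mod q, d mod q)"

lemma rd_cong:
  assumes "rd q g = rd q g'" "rd q h = rd q h'"
  shows "rd q (g \<odot> h) = rd q (g' \<odot> h')"
  using assms
  by (cases g; cases g'; cases h; cases h') (auto intro!: mod_add_cong mod_mult_cong)

lemma rd_id2_iff: "rd q (x, y, z, w) = rd q id2 \<longleftrightarrow> q dvd x - 1 \<and> q dvd y \<and> q dvd z \<and> q dvd w - 1"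
  by (auto simp: id2_def mod_eq_dvd_iff)

text \<open>The determinant fixes b modulo a, and 0 <= b <= a leaves only the ambiguity between b =
  0 and b = a, which the last hypothesis resolves. Hence the flag b = a in the maps used for
  counting below.\<close>

lemma second_column_unique:
  assumes "(a, b, c, d) \<in> sg A" "(a, b', c, d') \<in> sg A" "(b = a) = (b' = a)"
  shows "b = b' \<and> d = d'"
proof -
  note 1 = sg_bounds[OF assms(1)] and 2 = sg_bounds[OF assms(2)]
  have "a * (d - d') = (b - b') * c" using 1(8) 2(8) by (simp add: algebra_simps)
  then have "a dvd (b - b') * c" by (metis dvd_triv_left)
  moreover have "coprime a c"
    by (rule coprimeI) (metis 1(8) dvd_diff dvd_mult dvd_mult2)
  ultimately have "a dvd b - b'" by (simp add: coprime_dvd_mult_left_iff)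
  then obtain k where k: "b - b' = a * k" by (elim dvdE)
  have "b = b'"
  proof (rule ccontr)
    assume "b \<noteq> b'"
    then have "k \<noteq> 0" using k by auto
    then have "\<bar>k\<bar> \<ge> 1" by linarith
    then have "a * 1 \<le> a * \<bar>k\<bar>" using 1(1) by (intro mult_left_mono) auto
    then have "a \<le> \<bar>b - b'\<bar>" using k 1(1) by (simp add: abs_mult)
    then show False using 1 2 assms(3) \<open>b \<noteq> b'\<close> by linarith
  qed
  moreover from this have "d = d'" using \<open>a * (d - d') = _\<close> 1(1) by simp
  ultimately show ?thesis by simp
qed

lemma card_int_interval:
  fixes r :: real
  assumes "r \<ge> 0"
  shows "real (card {-\<lfloor>r\<rfloor>..\<lfloor>r\<rfloor>}) \<le> 2 * r + 1"
proof -
  have "\<lfloor>r\<rfloor> \<ge> 0" using assms by simp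
  then have "real (card {-\<lfloor>r\<rfloor>..\<lfloor>r\<rfloor>}) = 2 * real_of_int \<lfloor>r\<rfloor> + 1" by simp
  also have "\<dots> \<le> 2 * r + 1" by simp
  finally show ?thesis .
qed

lemma mm_adj_eq_iff: "dt v = 1 \<Longrightarrow> u \<odot> adj v = h \<longleftrightarrow> u = h \<odot> v"
  by (metis adj_mm mm_assoc mm_id2(2))

lemma mat2_pair_cases:
  obtains r r' s s' a b c d where "(p :: mat2 \<times> mat2) = ((r, r', s, s'), (a, b, c, d))"
proof -
  obtain u v where "p = (u, v)" by (cases p)
  moreover obtain r r' s s' where "u = (r, r', s, s')" by (cases u)
  moreover obtain a b c d where "v = (a, b, c, d)" by (cases v)
  ultimately show ?thesis by (intro that) simp
qed

lemma abs_det_le: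
  fixes B :: real and i j k l :: int
  assumes "0 \<le> i" "real_of_int i \<le> B" "0 \<le> j" "real_of_int j \<le> B" "0 \<le> k" "real_of_int k \<le> B"
    "0 \<le> l" "real_of_int l \<le> B"
  shows "\<bar>real_of_int (i * j - k * l)\<bar> \<le> B\<^sup>2"
proof -
  have "0 \<le> real_of_int i * real_of_int j" "0 \<le> real_of_int k * real_of_int l"
    "real_of_int i * real_of_int j \<le> B * B" "real_of_int k * real_of_int l \<le> B * B"
    using assms by (auto intro!: mult_mono)
  then show ?thesis by (simp add: power2_eq_square abs_le_iff)
qed

text \<open>If $h v = u$ and $h v_0 = u_0$ with all four vectors in $[0,B]^2$, then every entry of \<open>h\<close>
  times $\det(v_0, v)$ is at most $B^2$ in absolute value.\<close>

lemma card_quotients: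
  fixes B \<kappa> :: real and T :: int
  assumes S: "finite S" "S \<subseteq> sg A" "\<And>g. g \<in> S \<Longrightarrow> B / \<kappa> \<le> real_of_int (a11 g) \<and> real_of_int (a11 g) \<le> B"
    and \<kappa>: "\<kappa> \<ge> 1" and T: "T \<ge> 1" "T \<le> \<bar>x\<bar> \<or> T \<le> \<bar>y\<bar> \<or> T \<le> \<bar>z\<bar> \<or> T \<le> \<bar>w\<bar>"
  shows "real (card {p \<in> S \<times> S. fst p \<odot> adj (snd p) = (x, y, z, w)}) \<le>
    (2 * (B\<^sup>2 / real_of_int T) + 1) * ((2 * \<kappa> + 1) * 2)"
proof (cases "{p \<in> S \<times> S. fst p \<odot> adj (snd p) = (x, y, z, w)} = {}")
  case True
  have "(2 * (B\<^sup>2 / real_of_int T) + 1) * ((2 * \<kappa> + 1) * 2) \<ge> 0"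
    using \<kappa> T by (intro mult_nonneg_nonneg add_nonneg_nonneg) auto
  then show ?thesis unfolding True by simp
next
  case False
  let ?P = "{p \<in> S \<times> S. fst p \<odot> adj (snd p) = (x, y, z, w)}"
  have key: "r = x * a + y * c \<and> s = z * a + w * c \<and>
      (r, r', s, s') \<in> S \<and> (a, b, c, d) \<in> S"
    if "((r, r', s, s'), (a, b, c, d)) \<in> ?P" for r r' s s' a b c d
  proof -
    have "(r, r', s, s') \<odot> adj (a, b, c, d) = (x, y, z, w)" using that by simp
    moreover have "dt (a, b, c, d) = 1" using that S(2) dt_sg by blast
    ultimately have "(r, r', s, s') = (x, y, z, w) \<odot> (a, b, c, d)"
      using mm_adj_eq_iff by blast
    then show ?thesis using that by simp
  qed
  have bounds: "1 \<le> a \<and> B / \<kappa> \<le> real_of_int a \<and> real_of_int a \<le> B \<and> 0 \<le> c \<and> c \<le> a"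
    if "(a, b, c, d) \<in> S" for a b c d
  proof -
    have "(a, b, c, d) \<in> sg A" using that S(2) by blast
    then show ?thesis using S(3)[OF that] sg_bounds(1,4,5)[of a b c d A] by simp
  qed
  from False obtain p0 where "p0 \<in> ?P" by blast
  moreover obtain r0 r0' s0 s0' a0 b0 c0 d0 where "p0 = ((r0, r0', s0, s0'), (a0, b0, c0, d0))"
    by (rule mat2_pair_cases)
  ultimately have P0: "((r0, r0', s0, s0'), (a0, b0, c0, d0)) \<in> ?P" by (simp only:)
  note k0 = key[OF P0]
  \<comment> \<open>The determinant of the first column of the second factor against that of the
    fixed pair \<open>p0\<close>; it takes at most 2 B^2 / T + 1 values.\<close>
  define f where "f = (\<lambda>(_ :: mat2, (a, b :: int, c, d :: int)). a0 * c - a * c0)"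
  let ?R = "{-\<lfloor>B\<^sup>2 / real_of_int T\<rfloor>..\<lfloor>B\<^sup>2 / real_of_int T\<rfloor>}"
  have BT: "B\<^sup>2 / real_of_int T \<ge> 0" using T by simp
  have fin: "finite ?P" by (rule finite_subset[OF _ finite_cartesian_product[OF S(1) S(1)]]) blast
  have cop: "coprime a c" if "(a, b, c, d) \<in> S" for a b c d
  proof (rule coprimeI)
    fix e assume "e dvd a" "e dvd c"
    moreover have "a * d - b * c = 1" using sg_bounds(8) that S(2) by blast
    ultimately show "is_unit e" by (metis dvd_diff dvd_mult dvd_mult2)
  qed
  have "real (card ?P) \<le> real (card ?R) * ((2 * \<kappa> + 1) * 2)"
  proof (rule card_le_fibres[where f = f, OF fin])
    show "f ` ?P \<subseteq> ?R"
    proof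
      fix D assume "D \<in> f ` ?P"
      then obtain p1 where "p1 \<in> ?P" "D = f p1" by blast
      moreover obtain r r' s s' a b c d where "p1 = ((r, r', s, s'), (a, b, c, d))"
        by (rule mat2_pair_cases)
      ultimately have P1: "((r, r', s, s'), (a, b, c, d)) \<in> ?P" and D: "D = a0 * c - a * c0"
        by (simp_all only: f_def prod.case)
      note k1 = key[OF P1]
      have det: "x * D = r0 * c - r * c0" "y * D = a0 * r - a * r0"
        "z * D = s0 * c - s * c0" "w * D = a0 * s - a * s0"
        unfolding D using k0 k1 by (simp_all add: algebra_simps)
      note b = bounds[OF k0[THEN conjunct2, THEN conjunct2, THEN conjunct1]]
        bounds[OF k0[THEN conjunct2, THEN conjunct2, THEN conjunct2]]
        bounds[OF k1[THEN conjunct2, THEN conjunct2, THEN conjunct1]]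
        bounds[OF k1[THEN conjunct2, THEN conjunct2, THEN conjunct2]]
      have le: "real_of_int m \<le> B" if "m \<le> n" "real_of_int n \<le> B" for m n
        using that by linarith
      have "\<bar>real_of_int (x * D)\<bar> \<le> B\<^sup>2" "\<bar>real_of_int (y * D)\<bar> \<le> B\<^sup>2"
        "\<bar>real_of_int (z * D)\<bar> \<le> B\<^sup>2" "\<bar>real_of_int (w * D)\<bar> \<le> B\<^sup>2"
        unfolding det using b by (intro abs_det_le; (linarith | (auto intro: le)))+
      then have "real_of_int \<bar>x\<bar> * real_of_int \<bar>D\<bar> \<le> B\<^sup>2" "real_of_int \<bar>y\<bar> * real_of_int \<bar>D\<bar> \<le> B\<^sup>2"
        "real_of_int \<bar>z\<bar> * real_of_int \<bar>D\<bar> \<le> B\<^sup>2" "real_of_int \<bar>w\<bar> * real_of_int \<bar>D\<bar> \<le> B\<^sup>2"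
        by (simp_all add: abs_mult)
      moreover have "real_of_int T * real_of_int \<bar>D\<bar> \<le> real_of_int m * real_of_int \<bar>D\<bar>" if "T \<le> m" for m
        using that by (intro mult_right_mono) auto
      ultimately have "real_of_int T * real_of_int \<bar>D\<bar> \<le> B\<^sup>2" using T(2) order_trans by blast
      then have "real_of_int \<bar>D\<bar> \<le> B\<^sup>2 / real_of_int T" using T(1) by (simp add: field_simps)
      then have "\<bar>D\<bar> \<le> \<lfloor>B\<^sup>2 / real_of_int T\<rfloor>" by (simp only: le_floor_iff)
      then show "D \<in> ?R" by auto
    qed
    fix D assume "D \<in> ?R"
    let ?F = "{p \<in> ?P. f p = D}"
    show "real (card ?F) \<le> (2 * \<kappa> + 1) * 2"
    proof (cases "?F = {}")
      case True
      show ?thesis unfolding True using \<kappa> by simp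
    next
      case False
      then obtain p1 where "p1 \<in> ?F" by blast
      moreover obtain r1 r1' s1 s1' a1 b1 c1 d1 where "p1 = ((r1, r1', s1, s1'), (a1, b1, c1, d1))"
        by (rule mat2_pair_cases)
      ultimately have P1: "((r1, r1', s1, s1'), (a1, b1, c1, d1)) \<in> ?F" by (simp only:)
      then have P1': "((r1, r1', s1, s1'), (a1, b1, c1, d1)) \<in> ?P" by simp
      note k1 = key[OF P1']
      \<comment> \<open>For fixed determinant the first columns lie on a line (a1, c1) + k (a0, c0),
        and a0 >= B / \<kappa> forces |k| <= \<kappa>. The flag b = a then fixes the second column,
        and the given quotient fixes the other matrix of the pair.\<close>
      define e where "e = (\<lambda>(_ :: mat2, (a, b :: int, c :: int, d :: int)). ((a - a1) div a0, b = a))"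
      have div: "\<exists>k. a - a1 = a0 * k \<and> c - c1 = c0 * k \<and> \<bar>real_of_int k\<bar> \<le> \<kappa>"
        if P2: "((r, r', s, s'), (a, b, c, d)) \<in> ?F" for r r' s s' a b c d
      proof -
        have P2': "((r, r', s, s'), (a, b, c, d)) \<in> ?P" using P2 by simp
        note k2 = key[OF P2']
        have "a0 * c - a * c0 = D" "a0 * c1 - a1 * c0 = D" using P1 P2 by (auto simp: f_def)
        then have eq: "a0 * (c - c1) = c0 * (a - a1)" by (simp add: algebra_simps)
        then have "a0 dvd c0 * (a - a1)" by (metis dvd_triv_left)
        then have "a0 dvd a - a1" using cop k0 by (metis coprime_dvd_mult_right_iff)
        then obtain k where k: "a - a1 = a0 * k" by (elim dvdE)
        have b: "1 \<le> a" "real_of_int a \<le> B" "1 \<le> a1" "real_of_int a1 \<le> B" "1 \<le> a0" "B / \<kappa> \<le> real_of_int a0"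
          using bounds k0 k1 k2 by blast+
        have "a0 * (c - c1) = a0 * (c0 * k)" using eq unfolding k by (simp add: algebra_simps)
        then have "c - c1 = c0 * k" using b by simp
        moreover have "\<bar>real_of_int k\<bar> \<le> \<kappa>"
        proof -
          have "B \<le> \<kappa> * real_of_int a0" using b \<kappa> by (simp add: field_simps)
          moreover have "real_of_int \<bar>a0 * k\<bar> \<le> B" unfolding k[symmetric] using b by linarith
          moreover have "real_of_int \<bar>a0 * k\<bar> = real_of_int a0 * \<bar>real_of_int k\<bar>"
            using b by (simp add: abs_mult)
          ultimately have "real_of_int a0 * \<bar>real_of_int k\<bar> \<le> real_of_int a0 * \<kappa>"
            by (simp only: mult.commute[of \<kappa>])
          then show ?thesis using b(5) by (simp add: mult_le_cancel_left_pos)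
        qed
        ultimately show ?thesis using k by blast
      qed
      have "inj_on e ?F"
      proof (rule inj_onI)
        fix p p' assume p: "p \<in> ?F" and p': "p' \<in> ?F" and ee: "e p = e p'"
        obtain r r' s s' a b c d where pp: "p = ((r, r', s, s'), (a, b, c, d))" by (rule mat2_pair_cases)
        obtain t t' u u' a' b' c' d' where pp': "p' = ((t, t', u, u'), (a', b', c', d'))" by (rule mat2_pair_cases)
        obtain k where k: "a - a1 = a0 * k" "c - c1 = c0 * k" using div p unfolding pp by blast
        obtain k' where k': "a' - a1 = a0 * k'" "c' - c1 = c0 * k'" using div p' unfolding pp' by blast
        have a0: "a0 \<noteq> 0" using bounds k0 by fastforce
        have "k = k'" "(b = a) = (b' = a')"
          using ee a0 by (auto simp: e_def pp pp' k k')
        then have ac: "a' = a" "c' = c" "(b = a) = (b' = a)" using k k' by auto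
        have "(a, b, c, d) \<in> sg A" "(a, b', c, d') \<in> sg A"
          using p p' S(2) unfolding pp pp' ac by auto
        then have "b = b' \<and> d = d'" using second_column_unique ac(3) by blast
        then have snd: "snd p = snd p'" using pp pp' ac by simp
        have "dt (snd p) = 1" using p S(2) dt_sg by auto
        have fst: "fst q = (x, y, z, w) \<odot> snd q" if "q \<in> ?P" for q
        proof -
          have "fst q \<odot> adj (snd q) = (x, y, z, w)" "dt (snd q) = 1" using that S(2) dt_sg by auto
          then show ?thesis using mm_adj_eq_iff by blast
        qed
        have "p \<in> ?P" "p' \<in> ?P" using p p' by blast+
        then have "fst p = fst p'" using fst[of p] fst[of p'] snd by (simp only:)
        then show "p = p'" using snd by (simp add: prod_eq_iff)
      qed
      moreover have "e ` ?F \<subseteq> {-\<lfloor>\<kappa>\<rfloor>..\<lfloor>\<kappa>\<rfloor>} \<times> UNIV"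
      proof
        fix v assume "v \<in> e ` ?F"
        then obtain p2 where "p2 \<in> ?F" "v = e p2" by blast
        moreover obtain r r' s s' a b c d where "p2 = ((r, r', s, s'), (a, b, c, d))"
          by (rule mat2_pair_cases)
        ultimately have P2: "((r, r', s, s'), (a, b, c, d)) \<in> ?F" and v: "v = ((a - a1) div a0, b = a)"
          by (simp_all only: e_def prod.case)
        obtain k where k: "a - a1 = a0 * k" "\<bar>real_of_int k\<bar> \<le> \<kappa>" using div[OF P2] by blast
        have "a0 \<noteq> 0" using bounds k0 by fastforce
        then have "fst v = k" using k v by simp
        moreover have "\<bar>k\<bar> \<le> \<lfloor>\<kappa>\<rfloor>" using k(2) by (simp add: le_floor_iff)
        ultimately show "v \<in> {-\<lfloor>\<kappa>\<rfloor>..\<lfloor>\<kappa>\<rfloor>} \<times> UNIV" by (cases v) auto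
      qed
      ultimately have "card ?F \<le> card ({-\<lfloor>\<kappa>\<rfloor>..\<lfloor>\<kappa>\<rfloor>} \<times> (UNIV :: bool set))"
        by (intro card_inj_on_le) auto
      then have "real (card ?F) \<le> real (card {-\<lfloor>\<kappa>\<rfloor>..\<lfloor>\<kappa>\<rfloor>} * 2)"
        by (simp only: card_cartesian_product card_UNIV_bool of_nat_le_iff)
      also have "\<dots> = real (card {-\<lfloor>\<kappa>\<rfloor>..\<lfloor>\<kappa>\<rfloor>}) * 2" by (simp only: of_nat_mult of_nat_numeral)
      also have "\<dots> \<le> (2 * \<kappa> + 1) * 2" using card_int_interval[of \<kappa>] \<kappa> by (intro mult_right_mono) auto
      finally show ?thesis .
    qed
  qed simp
  also have "\<dots> \<le> (2 * (B\<^sup>2 / real_of_int T) + 1) * ((2 * \<kappa> + 1) * 2)"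
    using card_int_interval[OF BT] \<kappa> by (intro mult_right_mono) auto
  finally show ?thesis .
qed

section \<open>The principal congruence subgroup in a box\<close>

lemma card_congruent:
  fixes q T r :: int
  assumes "q > 0" "T \<ge> 0"
  shows "real (card {x \<in> {-T..T}. q dvd x - r}) \<le> 2 * real_of_int T / real_of_int q + 1"
proof -
  let ?X = "{x \<in> {-T..T}. q dvd x - r}"
  have "inj_on (\<lambda>x. (x + T) div q) ?X"
  proof (rule inj_onI)
    fix x y assume x: "x \<in> ?X" and y: "y \<in> ?X" and eq: "(x + T) div q = (y + T) div q"
    have "q dvd x - r" "q dvd y - r" using x y by simp_all
    then have "q dvd (x - r) - (y - r)" by (rule dvd_diff)
    then have "q dvd (x + T) - (y + T)" by simp
    then have "(x + T) mod q = (y + T) mod q" by (simp only: mod_eq_dvd_iff)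
    then have "x + T = y + T" using eq by (metis div_mult_mod_eq)
    then show "x = y" by simp
  qed
  moreover have "(\<lambda>x. (x + T) div q) ` ?X \<subseteq> {0..(2 * T) div q}"
    using assms by (auto simp: pos_imp_zdiv_nonneg_iff intro!: zdiv_mono1)
  ultimately have "card ?X \<le> card {0..(2 * T) div q}" by (intro card_inj_on_le) auto
  then have "real (card ?X) \<le> real (card {0..(2 * T) div q})" by (simp only: of_nat_le_iff)
  also have "\<dots> = real_of_int ((2 * T) div q) + 1"
    using assms by (simp add: pos_imp_zdiv_nonneg_iff)
  also have "\<dots> \<le> real_of_int (2 * T) / real_of_int q + 1"
    using real_of_int_div4[of "2 * T" q] by simp
  finally show ?thesis by simp
qed

lemma divisor_pairs:
  fixes n :: int
  assumes "n \<noteq> 0"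
  shows "finite {(y, z). y * z = n}" "card {(y, z). y * z = n} \<le> 2 * card {d. d dvd nat \<bar>n\<bar>}"
proof -
  define f where "f = (\<lambda>(y :: int, z :: int). (nat \<bar>y\<bar>, y > 0))"
  have "inj_on f {(y, z). y * z = n}"
  proof (rule inj_onI)
    fix v v' assume "v \<in> {(y, z). y * z = n}" "v' \<in> {(y, z). y * z = n}" and eq: "f v = f v'"
    then obtain y z y' z' where v: "v = (y, z)" "v' = (y', z')" "y * z = n" "y' * z' = n" by auto
    have "\<bar>y\<bar> = \<bar>y'\<bar>" "(y > 0) = (y' > 0)" using eq v by (auto simp: f_def)
    moreover have "y \<noteq> 0" "y' \<noteq> 0" using v assms by auto
    ultimately have "y = y'" by linarith
    then show "v = v'" using v assms by auto
  qed
  moreover have "f ` {(y, z). y * z = n} \<subseteq> {d. d dvd nat \<bar>n\<bar>} \<times> UNIV"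
    by (auto simp: f_def abs_mult nat_mult_distrib)
  moreover have "finite ({d. d dvd nat \<bar>n\<bar>} \<times> (UNIV :: bool set))"
    using assms by (intro finite_cartesian_product finite_divisors_nat) simp_all
  ultimately have "finite {(y, z). y * z = n}"
    "card {(y, z). y * z = n} \<le> card ({d. d dvd nat \<bar>n\<bar>} \<times> (UNIV :: bool set))"
    by (metis inj_on_finite, metis card_inj_on_le)
  then show "finite {(y, z). y * z = n}" "card {(y, z). y * z = n} \<le> 2 * card {d. d dvd nat \<bar>n\<bar>}"
    by (simp_all add: card_cartesian_product)
qed

text \<open>The traces of these matrices are $2$ modulo $q^2$, which is what makes the count below sharp.\<close>

definition cong_subgroup :: "int \<Rightarrow> int \<Rightarrow> mat2 set" where
  "cong_subgroup q T = {h \<in> {-T..T} \<times> {-T..T} \<times> {-T..T} \<times> {-T..T}.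
     dt h = 1 \<and> rd q h = rd q id2 \<and> h \<noteq> id2}"

lemma card_cong_subgroup:
  fixes \<epsilon> C :: real and q T :: int
  assumes \<epsilon>: "0 < \<epsilon>" "\<epsilon> \<le> 1"
    and C: "C \<ge> 1" "\<And>n :: nat. n > 0 \<Longrightarrow> real (card {d. d dvd n}) \<le> C * real n powr \<epsilon>"
    and q: "q \<ge> 2" and T: "T \<ge> 1"
  shows "real (card (cong_subgroup q T)) \<le>
    (64 * C + 16) * real_of_int T powr (2 * \<epsilon>) * (real_of_int T ^ 2 / real_of_int q ^ 3 + real_of_int T / real_of_int q)"
proof (cases "cong_subgroup q T = {}")
  case True
  then show ?thesis using C T q by simp
next
  case False
  define t where "t = real_of_int T"
  define r where "r = real_of_int q"
  have t1: "t \<ge> 1" and r2: "r \<ge> 2" using q T by (auto simp: t_def r_def)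
  have fin: "finite (cong_subgroup q T)"
    by (rule finite_subset[of _ "{-T..T} \<times> {-T..T} \<times> {-T..T} \<times> {-T..T}"]) (auto simp: cong_subgroup_def)
  have mem: "x \<in> {-T..T} \<and> y \<in> {-T..T} \<and> z \<in> {-T..T} \<and> w \<in> {-T..T} \<and> x * w - y * z = 1 \<and>
      q dvd x - 1 \<and> q dvd y \<and> q dvd z \<and> q dvd w - 1"
    if "(x, y, z, w) \<in> cong_subgroup q T" for x y z w
    using that by (auto simp: cong_subgroup_def rd_id2_iff simp del: rd.simps)
  have trace: "q\<^sup>2 dvd x + w - 2" if "(x, y, z, w) \<in> cong_subgroup q T" for x y z w
  proof -
    note m = mem[OF that]
    \<comment> \<open>The determinant condition, rewritten so that both terms on the right are
      products of two multiples of q.\<close>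
    have "x + w - 2 = y * z - (x - 1) * (w - 1)" using m by (simp add: algebra_simps)
    moreover have "q\<^sup>2 dvd y * z" "q\<^sup>2 dvd (x - 1) * (w - 1)"
      using m by (auto simp: power2_eq_square intro: mult_dvd_mono)
    ultimately show ?thesis by simp
  qed
  \<comment> \<open>Otherwise the box contains only the identity, which is excluded. The bound q <=
    2 T lets the term 1 in 2 T / q + 1 be absorbed.\<close>
  have Tq: "q \<le> 2 * T"
  proof (rule ccontr)
    assume "\<not> q \<le> 2 * T"
    then have *: "T + 1 < q" using T by linarith
    have zero: "v = 0" if "q dvd v" "\<bar>v\<bar> \<le> T + 1" for v
      using that * by (metis dvd_imp_le_int less_le_trans not_less abs_of_nonneg order.trans q zero_le_numeral)
    obtain h where h: "h \<in> cong_subgroup q T" using False by blast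
    obtain x y z w where "h = (x, y, z, w)" by (cases h)
    note m = mem[OF h[unfolded this]]
    have "x - 1 = 0" "w - 1 = 0" "y = 0" "z = 0" by (rule zero; use m in auto)+
    then have "h = id2" using \<open>h = _\<close> by (simp add: id2_def)
    then show False using h by (simp add: cong_subgroup_def)
  qed
  have rt: "r \<le> 2 * t" using Tq unfolding r_def t_def by linarith
  then have tr: "2 * t / r + 1 \<le> 4 * t / r" using r2 by (simp add: field_simps)
  define H1 where "H1 = {(x, y, z, w) \<in> cong_subgroup q T. x * w \<noteq> 1}"
  define H2 where "H2 = {(x, y, z, w) \<in> cong_subgroup q T. x * w = 1}"
  have H: "cong_subgroup q T = H1 \<union> H2" by (auto simp: H1_def H2_def)
  define XW where "XW = {(x, w). x \<in> {-T..T} \<and> q dvd x - 1 \<and> w \<in> {-T..T} \<and> q\<^sup>2 dvd w - (2 - x)}"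
  have finXW: "finite XW"
    by (rule finite_subset[of _ "{-T..T} \<times> {-T..T}"]) (auto simp: XW_def)
  have XW: "real (card XW) \<le> (2 * t / r + 1) * (2 * t / r\<^sup>2 + 1)"
  proof -
    have "real (card XW) \<le> real (card {x \<in> {-T..T}. q dvd x - 1}) * (2 * t / r\<^sup>2 + 1)"
    proof (rule card_le_fibres[where f = fst, OF finXW])
      show "finite {x \<in> {-T..T}. q dvd x - 1}"
        by (rule finite_subset[of _ "{-T..T}"]) auto
      show "fst ` XW \<subseteq> {x \<in> {-T..T}. q dvd x - 1}" by (auto simp: XW_def)
      fix x
      have "{a \<in> XW. fst a = x} \<subseteq> Pair x ` {w \<in> {-T..T}. q\<^sup>2 dvd w - (2 - x)}" by (auto simp: XW_def)
      then have "card {a \<in> XW. fst a = x} \<le> card {w \<in> {-T..T}. q\<^sup>2 dvd w - (2 - x)}"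
        by (rule surj_card_le[rotated]) (rule finite_subset[of _ "{-T..T}"], auto)
      then have "real (card {a \<in> XW. fst a = x}) \<le> real (card {w \<in> {-T..T}. q\<^sup>2 dvd w - (2 - x)})"
        by (simp only: of_nat_le_iff)
      also have "\<dots> \<le> 2 * t / r\<^sup>2 + 1"
        using card_congruent[of "q\<^sup>2" T "2 - x"] q T by (simp add: t_def r_def)
      finally show "real (card {a \<in> XW. fst a = x}) \<le> 2 * t / r\<^sup>2 + 1" .
    qed
    also have "\<dots> \<le> (2 * t / r + 1) * (2 * t / r\<^sup>2 + 1)"
      using card_congruent[of q T 1] q T t1 r2 by (intro mult_right_mono) (auto simp: t_def r_def)
    finally show ?thesis .
  qed
  have "real (card H1) \<le> real (card XW) * (2 * (C * (2 * t powr (2 * \<epsilon>))))"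
  proof (rule card_le_fibres[where f = "\<lambda>(x, y, z, w). (x, w)"])
    show "finite H1" using fin H by simp
    show "finite XW" by (rule finXW)
    show "(\<lambda>(x, y, z, w). (x, w)) ` H1 \<subseteq> XW"
    proof
      fix v assume "v \<in> (\<lambda>(x, y, z, w). (x, w)) ` H1"
      then obtain a where a: "a \<in> H1" "v = (\<lambda>(x, y, z, w). (x, w)) a" by blast
      obtain x y z w where aa: "a = (x, y, z, w)" by (cases a)
      have h: "(x, y, z, w) \<in> cong_subgroup q T" using a(1) aa by (simp add: H1_def)
      have "w - (2 - x) = x + w - 2" by simp
      then have "q\<^sup>2 dvd w - (2 - x)" using trace[OF h] by (simp only:)
      then show "v \<in> XW" using mem[OF h] by (simp add: a(2) aa XW_def)
    qed
    fix v :: "int \<times> int"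
    obtain x w where v: "v = (x, w)" by (cases v)
    let ?F = "{a \<in> H1. (case a of (x, y, z, w) \<Rightarrow> (x, w)) = v}"
    show "real (card ?F) \<le> 2 * (C * (2 * t powr (2 * \<epsilon>)))"
    proof (cases "?F = {}")
      case True
      show ?thesis unfolding True using C by simp
    next
      case False
      define n where "n = x * w - 1"
      from False obtain y0 z0 where "(x, y0, z0, w) \<in> H1" unfolding v by auto
      then have h: "(x, y0, z0, w) \<in> cong_subgroup q T" "x * w \<noteq> 1" by (simp_all add: H1_def)
      then have n0: "n \<noteq> 0" and xw: "\<bar>x\<bar> \<le> T" "\<bar>w\<bar> \<le> T"
        using mem[OF h(1)] by (auto simp: n_def)
      have "?F \<subseteq> (\<lambda>(y, z). (x, y, z, w)) ` {(y, z). y * z = n}"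
      proof
        fix a assume a: "a \<in> ?F"
        obtain x' y z w' where aa: "a = (x', y, z, w')" by (cases a)
        have "x' = x" "w' = w" using a by (auto simp: aa v)
        moreover have "x' * w' - y * z = 1" using a mem unfolding H1_def aa by blast
        ultimately show "a \<in> (\<lambda>(y, z). (x, y, z, w)) ` {(y, z). y * z = n}"
          unfolding aa n_def by (intro image_eqI[of _ _ "(y, z)"]) auto
      qed
      then have "card ?F \<le> card {(y, z). y * z = n}"
        by (rule surj_card_le[OF divisor_pairs(1)[OF n0]])
      also have "\<dots> \<le> 2 * card {d. d dvd nat \<bar>n\<bar>}" by (rule divisor_pairs(2)[OF n0])
      finally have "real (card ?F) \<le> real (2 * card {d. d dvd nat \<bar>n\<bar>})" by (simp only: of_nat_le_iff)
      also have "\<dots> \<le> 2 * (C * real (nat \<bar>n\<bar>) powr \<epsilon>)" using C(2)[of "nat \<bar>n\<bar>"] n0 by simp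
      also have "real (nat \<bar>n\<bar>) powr \<epsilon> \<le> 2 * t powr (2 * \<epsilon>)"
      proof -
        have "\<bar>x * w\<bar> \<le> T * T" using xw T unfolding abs_mult by (intro mult_mono) auto
        then have "\<bar>n\<bar> \<le> 2 * (T * T)" using mult_mono[of 1 T 1 T] T unfolding n_def by linarith
        then have "real_of_int \<bar>n\<bar> \<le> real_of_int (2 * (T * T))" by (simp only: of_int_le_iff)
        then have "real (nat \<bar>n\<bar>) \<le> 2 * (t * t)" by (simp add: t_def)
        then have "real (nat \<bar>n\<bar>) powr \<epsilon> \<le> (2 * (t * t)) powr \<epsilon>" using \<epsilon> by (intro powr_mono2) auto
        also have "\<dots> = 2 powr \<epsilon> * t powr (2 * \<epsilon>)" using t1 by (simp add: powr_mult flip: powr_add)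
        also have "\<dots> \<le> 2 powr 1 * t powr (2 * \<epsilon>)" using \<epsilon> by (intro mult_right_mono powr_mono) auto
        finally show ?thesis by simp
      qed
      finally show ?thesis using C by simp
    qed
  qed
  also have "\<dots> \<le> ((4 * t / r) * (2 * t / r\<^sup>2 + 1)) * (2 * (C * (2 * t powr (2 * \<epsilon>))))"
    using XW tr t1 r2 C
    by (intro mult_right_mono order_trans[OF XW]) auto
  also have "\<dots> = (16 * C) * t powr (2 * \<epsilon>) * (2 * t ^ 2 / r ^ 3 + t / r)"
    using r2 by (simp add: field_simps power2_eq_square power3_eq_cube)
  also have "\<dots> \<le> (16 * C) * t powr (2 * \<epsilon>) * (4 * (t ^ 2 / r ^ 3 + t / r))"
  proof (intro mult_left_mono)
    have "t ^ 2 / r ^ 3 \<ge> 0" "t / r \<ge> 0" using t1 r2 by auto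
    moreover have "2 * t ^ 2 / r ^ 3 = 2 * (t ^ 2 / r ^ 3)" by simp
    moreover have "2 * P + Q \<le> 4 * (P + Q)" if "P \<ge> 0" "Q \<ge> 0" for P Q :: real
      using that by (simp add: distrib_left add_mono)
    ultimately show "2 * t ^ 2 / r ^ 3 + t / r \<le> 4 * (t ^ 2 / r ^ 3 + t / r)"
      by (simp only:)
  qed (use C in auto)
  finally have c1: "real (card H1) \<le> 64 * C * t powr (2 * \<epsilon>) * (t ^ 2 / r ^ 3 + t / r)"
    by (simp add: algebra_simps)
  define Y where "Y = {y \<in> {-T..T}. q dvd y - 0}"
  have finY: "finite Y" unfolding Y_def by (rule finite_subset[of _ "{-T..T}"]) auto
  have "H2 \<subseteq> (\<lambda>(x, b, y). if b then (x, y, 0, x) else (x, 0, y, x)) ` ({-1, 1} \<times> UNIV \<times> Y)"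
  proof
    fix a assume a: "a \<in> H2"
    obtain x y z w where aa: "a = (x, y, z, w)" by (cases a)
    have m: "(x, y, z, w) \<in> cong_subgroup q T" "x * w = 1" using a by (auto simp: H2_def aa)
    note mm = mem[OF m(1)]
    have xw: "x \<in> {-1, 1}" "w = x" using m(2) by (auto simp: zmult_eq_1_iff)
    have "y * z = 0" using mm m(2) by simp
    then consider "z = 0" | "y = 0" by auto
    then show "a \<in> (\<lambda>(x, b, y). if b then (x, y, 0, x) else (x, 0, y, x)) ` ({-1, 1} \<times> UNIV \<times> Y)"
    proof cases
      case 1
      then show ?thesis using mm xw unfolding aa by (intro image_eqI[of _ _ "(x, True, y)"]) (auto simp: Y_def)
    next
      case 2
      then show ?thesis using mm xw unfolding aa by (intro image_eqI[of _ _ "(x, False, z)"]) (auto simp: Y_def)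
    qed
  qed
  then have "card H2 \<le> card ({-1 :: int, 1} \<times> (UNIV :: bool set) \<times> Y)"
    by (rule surj_card_le[rotated]) (use finY in auto)
  also have "\<dots> = 4 * card Y" by (simp add: card_cartesian_product)
  finally have "real (card H2) \<le> 4 * real (card Y)" by (simp flip: of_nat_le_iff)
  also have "\<dots> \<le> 4 * (2 * t / r + 1)"
    unfolding Y_def t_def r_def using q T by (intro mult_left_mono card_congruent) auto
  also have "\<dots> \<le> 16 * (t / r)" using tr by simp
  also have "\<dots> \<le> 16 * 1 * (t ^ 2 / r ^ 3 + t / r)" using t1 r2 by simp
  also have "\<dots> \<le> 16 * t powr (2 * \<epsilon>) * (t ^ 2 / r ^ 3 + t / r)"
    using t1 r2 \<epsilon> by (intro mult_right_mono mult_left_mono ge_one_powr_ge_zero) auto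
  finally have c2: "real (card H2) \<le> 16 * t powr (2 * \<epsilon>) * (t ^ 2 / r ^ 3 + t / r)" .
  have "card (cong_subgroup q T) \<le> card H1 + card H2" unfolding H by (rule card_Un_le)
  then have "real (card (cong_subgroup q T)) \<le> real (card H1) + real (card H2)"
    by (metis of_nat_add of_nat_le_iff)
  also have "\<dots> \<le> 64 * C * t powr (2 * \<epsilon>) * (t ^ 2 / r ^ 3 + t / r) + 16 * t powr (2 * \<epsilon>) * (t ^ 2 / r ^ 3 + t / r)"
    using c1 c2 by linarith
  also have "\<dots> = (64 * C + 16) * t powr (2 * \<epsilon>) * (t ^ 2 / r ^ 3 + t / r)"
    by (simp add: algebra_simps)
  finally show ?thesis by (simp add: t_def r_def)
qed

definition collisions :: "int \<Rightarrow> mat2 set \<Rightarrow> (mat2 \<times> mat2) set" where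
  "collisions q S = {p \<in> S \<times> S. rd q (fst p) = rd q (snd p)}"

text \<open>An element is determined by its first column and the flag of
  \<open>second_column_unique\<close>.\<close>

lemma card_sg_bounded:
  fixes B :: real
  assumes S: "S \<subseteq> sg A" "\<And>g. g \<in> S \<Longrightarrow> real_of_int (a11 g) \<le> B" and B: "B \<ge> 1"
  shows "finite S" "real (card S) \<le> 6 * B\<^sup>2"
proof -
  define f where "f = (\<lambda>(a :: int, b :: int, c :: int, d :: int). (a, c, b = a))"
  let ?R = "{1..\<lfloor>B\<rfloor>} \<times> {0..\<lfloor>B\<rfloor>} \<times> (UNIV :: bool set)"
  have "inj_on f S"
  proof (rule inj_onI)
    fix g h assume g: "g \<in> S" and h: "h \<in> S" and eq: "f g = f h"
    obtain a b c d where gg: "g = (a, b, c, d)" by (cases g)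
    obtain a' b' c' d' where hh: "h = (a', b', c', d')" by (cases h)
    have *: "a' = a" "c' = c" "(b = a) = (b' = a')" using eq by (auto simp: f_def gg hh)
    have "(a, b, c, d) \<in> sg A" "(a, b', c, d') \<in> sg A"
      using g h S(1) unfolding gg hh *(1,2) by auto
    then have "b = b' \<and> d = d'" by (rule second_column_unique) (use * in simp)
    then show "g = h" using * by (simp add: gg hh)
  qed
  moreover have "f ` S \<subseteq> ?R"
  proof
    fix v assume "v \<in> f ` S"
    then obtain g where g: "g \<in> S" "v = f g" by blast
    obtain a b c d where gg: "g = (a, b, c, d)" by (cases g)
    have "(a, b, c, d) \<in> sg A" using g S(1) gg by blast
    note b = sg_bounds[OF this]
    have "a \<le> \<lfloor>B\<rfloor>" using S(2)[OF g(1)] by (simp add: gg le_floor_iff)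
    then show "v \<in> ?R" using b by (simp add: g(2) gg f_def)
  qed
  moreover have fin: "finite ?R" by (intro finite_cartesian_product finite_UNIV) auto
  ultimately show "finite S" by (metis inj_on_finite)
  have "card S \<le> card ?R" using \<open>inj_on f S\<close> \<open>f ` S \<subseteq> ?R\<close> fin by (rule card_inj_on_le)
  then have "real (card S) \<le> real (card ?R)" by (simp only: of_nat_le_iff)
  also have "\<dots> = real_of_int \<lfloor>B\<rfloor> * (real_of_int \<lfloor>B\<rfloor> + 1) * 2"
    using B by (simp add: card_cartesian_product)
  also have "\<dots> \<le> B * (B + 1) * 2" using B by (intro mult_right_mono mult_mono) auto
  also have "\<dots> \<le> B * (2 * B) * 2" using B by (intro mult_right_mono mult_left_mono) auto
  also have "\<dots> \<le> 6 * B\<^sup>2" by (simp add: power2_eq_square)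
  finally show "real (card S) \<le> 6 * B\<^sup>2" .
qed

text \<open>The number of pairs of \<open>S\<close> congruent modulo \<open>q\<close> is, up to \<open>B\<^sup>\<epsilon>\<close>, what equidistribution
  in the group of order about $q^3$ would give. The quotients of the pairs are sorted dyadically.\<close>

lemma card_collisions:
  fixes \<epsilon> \<kappa> :: real
  assumes \<epsilon>: "0 < \<epsilon>" "\<epsilon> \<le> 1" and \<kappa>: "\<kappa> \<ge> 1"
  obtains K where "K \<ge> 1" "\<And>A q B S. \<lbrakk>q \<ge> 2; B \<ge> 1; real_of_int q ^ 3 \<le> B\<^sup>2; S \<subseteq> sg A;
      \<And>g. g \<in> S \<Longrightarrow> B / \<kappa> \<le> real_of_int (a11 g) \<and> real_of_int (a11 g) \<le> B\<rbrakk>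
    \<Longrightarrow> real (card (collisions q S)) \<le> K * B powr (4 + 5 * \<epsilon>) / real_of_int q ^ 3"
proof -
  obtain C where C: "C \<ge> 1" "\<And>n :: nat. n > 0 \<Longrightarrow> real (card {d. d dvd n}) \<le> C * real n powr \<epsilon>"
    using divisor_bound[OF \<epsilon>(1)] by blast
  define C1 where "C1 = (64 * C + 16) * 4 * 4 * ((2 * \<kappa> + 1) * 2) * 3 * 2"
  define C2 where "C2 = 1 + 2 / (\<epsilon> * ln 2)"
  have C1: "C1 \<ge> 0" using C \<kappa> by (simp add: C1_def)
  have C2: "C2 \<ge> 1" using \<epsilon> by (simp add: C2_def)
  show ?thesis
  proof (rule that[of "6 + C2 * C1"])
    show "6 + C2 * C1 \<ge> 1" using C1 C2 by (simp add: add_increasing2)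
    fix A q B S
    assume q: "q \<ge> 2" and B: "B \<ge> 1" and qB: "real_of_int q ^ 3 \<le> B\<^sup>2" and S: "S \<subseteq> sg A"
      and SB: "\<And>g. g \<in> S \<Longrightarrow> B / \<kappa> \<le> real_of_int (a11 g) \<and> real_of_int (a11 g) \<le> B"
    define r where "r = real_of_int q"
    have r2: "r \<ge> 2" using q by (simp add: r_def)
    have finS: "finite S" and cardS: "real (card S) \<le> 6 * B\<^sup>2"
      using card_sg_bounded[of S A B] S SB B by auto
    have rB: "r \<le> B"
    proof (rule power2_le_imp_le)
      have "r\<^sup>2 \<le> r ^ 3" using r2 by (intro power_increasing) auto
      then show "r\<^sup>2 \<le> B\<^sup>2" using qB by (simp add: r_def)
    qed (use B in simp)
    define pr where "pr = (\<lambda>h. {p \<in> S \<times> S. fst p \<odot> adj (snd p) = h})"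
    have fin_pr: "finite (pr h)" for h
      unfolding pr_def by (rule finite_subset[OF _ finite_cartesian_product[OF finS finS]]) blast
    define big where "big = (\<lambda>i. {(x, y, z, w) \<in> cong_subgroup q (2 ^ Suc i).
      (2 :: int) ^ i \<le> \<bar>x\<bar> \<or> 2 ^ i \<le> \<bar>y\<bar> \<or> 2 ^ i \<le> \<bar>z\<bar> \<or> 2 ^ i \<le> \<bar>w\<bar>})"
    define X where "X = (\<lambda>i. {p \<in> S \<times> S. fst p \<odot> adj (snd p) \<in> big i})"
    have fin_cong: "finite (cong_subgroup q T)" for T
      by (rule finite_subset[of _ "{-T..T} \<times> {-T..T} \<times> {-T..T} \<times> {-T..T}"]) (auto simp: cong_subgroup_def)
    have fin_big: "finite (big i)" for i
      by (rule finite_subset[OF _ fin_cong[of "2 ^ Suc i"]]) (auto simp: big_def)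
    define main where "main = B powr (4 + 4 * \<epsilon>) / r ^ 3"
    \<comment> \<open>With t = 2^i there are about t^2/q^3 + t/q quotients in this class, each
      shared by about B^2/t pairs. The product B^2 (t/q^3 + 1/q) is at most 2 B^4/q^3, because t <=
      B^2 and q <= B.\<close>
    have X: "real (card (X i)) \<le> C1 * main" if i: "2 ^ i \<le> B\<^sup>2" for i
    proof -
      define t :: real where "t = 2 ^ i"
      have t1: "t \<ge> 1" by (simp add: t_def)
      have tB: "t \<le> B\<^sup>2" using i by (simp add: t_def)
      have "real (card (X i)) \<le> real (card (big i)) * ((2 * (B\<^sup>2 / t) + 1) * ((2 * \<kappa> + 1) * 2))"
      proof (rule card_le_fibres[where f = "\<lambda>p. fst p \<odot> adj (snd p)"])
        show "finite (X i)"
          unfolding X_def by (rule finite_subset[OF _ finite_cartesian_product[OF finS finS]]) blast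
        show "finite (big i)" by (rule fin_big)
        show "(\<lambda>p. fst p \<odot> adj (snd p)) ` X i \<subseteq> big i" by (auto simp: X_def)
        fix h assume h: "h \<in> big i"
        obtain x y z w where hh: "h = (x, y, z, w)" by (cases h)
        have "{p \<in> X i. fst p \<odot> adj (snd p) = h} \<subseteq> {p \<in> S \<times> S. fst p \<odot> adj (snd p) = (x, y, z, w)}"
          unfolding X_def hh by blast
        then have "card {p \<in> X i. fst p \<odot> adj (snd p) = h} \<le> card {p \<in> S \<times> S. fst p \<odot> adj (snd p) = (x, y, z, w)}"
          using fin_pr[of h] unfolding pr_def hh by (rule card_mono[rotated])
        then have "real (card {p \<in> X i. fst p \<odot> adj (snd p) = h}) \<le> real (card {p \<in> S \<times> S. fst p \<odot> adj (snd p) = (x, y, z, w)})"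
          by (simp only: of_nat_le_iff)
        also have "\<dots> \<le> (2 * (B\<^sup>2 / real_of_int (2 ^ i)) + 1) * ((2 * \<kappa> + 1) * 2)"
          using h by (intro card_quotients[OF finS S SB \<kappa>]) (auto simp: hh big_def)
        finally show "real (card {p \<in> X i. fst p \<odot> adj (snd p) = h}) \<le> (2 * (B\<^sup>2 / t) + 1) * ((2 * \<kappa> + 1) * 2)"
          by (simp add: t_def)
      qed
      also have "\<dots> \<le> ((64 * C + 16) * (4 * B powr (4 * \<epsilon>)) * (4 * (t ^ 2 / r ^ 3 + t / r))) * ((3 * (B\<^sup>2 / t)) * ((2 * \<kappa> + 1) * 2))"
      proof (intro mult_mono)
        have "real (card (big i)) \<le> real (card (cong_subgroup q (2 ^ Suc i)))"
          unfolding of_nat_le_iff by (intro card_mono fin_cong) (auto simp: big_def)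
        also have "\<dots> \<le> (64 * C + 16) * real_of_int (2 ^ Suc i) powr (2 * \<epsilon>) *
          (real_of_int (2 ^ Suc i) ^ 2 / real_of_int q ^ 3 + real_of_int (2 ^ Suc i) / real_of_int q)"
          by (intro card_cong_subgroup \<epsilon> C q one_le_power) simp_all
        also have "\<dots> = (64 * C + 16) * (2 * t) powr (2 * \<epsilon>) * ((2 * t) ^ 2 / r ^ 3 + (2 * t) / r)"
          by (simp add: t_def r_def)
        also have "\<dots> \<le> (64 * C + 16) * (4 * B powr (4 * \<epsilon>)) * (4 * (t ^ 2 / r ^ 3 + t / r))"
        proof (intro mult_mono)
          have "(2 * t) powr (2 * \<epsilon>) \<le> (2 * B\<^sup>2) powr (2 * \<epsilon>)" using tB t1 \<epsilon> by (intro powr_mono2) auto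
          also have "\<dots> = 2 powr (2 * \<epsilon>) * B powr (4 * \<epsilon>)"
            using B by (simp add: powr_mult power2_eq_square flip: powr_add)
          also have "\<dots> \<le> 2 powr 2 * B powr (4 * \<epsilon>)" using \<epsilon> by (intro mult_right_mono powr_mono) auto
          finally show "(2 * t) powr (2 * \<epsilon>) \<le> 4 * B powr (4 * \<epsilon>)" by simp
          have "t ^ 2 / r ^ 3 \<ge> 0" "t / r \<ge> 0" using t1 r2 by auto
          moreover have "4 * P + 2 * Q \<le> 4 * (P + Q)" if "P \<ge> 0" "Q \<ge> 0" for P Q :: real
            using that by (simp add: distrib_left)
          moreover have "(2 * t) ^ 2 / r ^ 3 = 4 * (t ^ 2 / r ^ 3)" "2 * t / r = 2 * (t / r)"
            by (simp_all add: power_mult_distrib)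
          ultimately show "(2 * t) ^ 2 / r ^ 3 + 2 * t / r \<le> 4 * (t ^ 2 / r ^ 3 + t / r)"
            by (simp only:)
        qed (use C t1 r2 in auto)
        finally show "real (card (big i)) \<le> (64 * C + 16) * (4 * B powr (4 * \<epsilon>)) * (4 * (t ^ 2 / r ^ 3 + t / r))" .
        have "2 * u + 1 \<le> 3 * u" if "1 \<le> u" for u :: real using that by simp
        moreover have "1 \<le> B\<^sup>2 / t" using tB t1 by simp
        ultimately show "2 * (B\<^sup>2 / t) + 1 \<le> 3 * (B\<^sup>2 / t)" by blast
      qed (use C t1 r2 \<kappa> in auto)
      also have "\<dots> = (64 * C + 16) * 4 * 4 * ((2 * \<kappa> + 1) * 2) * 3 * (B powr (4 * \<epsilon>) * (B\<^sup>2 * (t / r ^ 3 + 1 / r)))"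
        using t1 r2 by (simp add: field_simps power2_eq_square power3_eq_cube)
      also have "\<dots> \<le> (64 * C + 16) * 4 * 4 * ((2 * \<kappa> + 1) * 2) * 3 * (B powr (4 * \<epsilon>) * (B\<^sup>2 * (B\<^sup>2 / r ^ 3 + B\<^sup>2 / r ^ 3)))"
      proof (intro mult_left_mono add_mono)
        show "t / r ^ 3 \<le> B\<^sup>2 / r ^ 3" using tB r2 by (intro divide_right_mono) auto
        have "1 / r = r\<^sup>2 / r ^ 3" using r2 by (simp add: power2_eq_square power3_eq_cube)
        also have "\<dots> \<le> B\<^sup>2 / r ^ 3" using rB r2 by (intro divide_right_mono power_mono) auto
        finally show "1 / r \<le> B\<^sup>2 / r ^ 3" .
      qed (use C \<kappa> in auto)
      also have "\<dots> = (64 * C + 16) * 4 * 4 * ((2 * \<kappa> + 1) * 2) * 3 * (2 * main)"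
      proof -
        have "B powr (4 + 4 * \<epsilon>) = B powr (4 * \<epsilon>) * (B\<^sup>2 * B\<^sup>2)"
          using B by (simp add: powr_add powr_numeral power2_eq_square power4_eq_xxxx)
        then show ?thesis by (simp add: main_def)
      qed
      also have "\<dots> = C1 * main" unfolding C1_def by (simp only: mult.assoc)
      finally show ?thesis .
    qed
    \<comment> \<open>The number of dyadic classes; this logarithm raises the exponent from 4
      \<epsilon> to 5 \<epsilon>.\<close>
    define n where "n = Suc (nat \<lfloor>log 2 (B\<^sup>2)\<rfloor>)"
    have B2: "B\<^sup>2 \<ge> 1" using B by (simp add: one_le_power)
    then have log0: "log 2 (B\<^sup>2) \<ge> 0" using B by (subst zero_le_log_cancel_iff) auto
    have iB: "i < n \<longleftrightarrow> 2 ^ i \<le> B\<^sup>2" for i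
    proof -
      have "i < n \<longleftrightarrow> int i \<le> \<lfloor>log 2 (B\<^sup>2)\<rfloor>" using log0 unfolding n_def by (simp add: less_Suc_eq_le le_nat_iff)
      also have "\<dots> \<longleftrightarrow> real i \<le> log 2 (B\<^sup>2)" by (simp add: le_floor_iff)
      also have "\<dots> \<longleftrightarrow> 2 powr real i \<le> B\<^sup>2" by (subst le_log_iff) (use B in auto)
      finally show ?thesis by (simp add: powr_realpow)
    qed
    have "collisions q S \<subseteq> (\<lambda>g. (g, g)) ` S \<union> (\<Union>i<n. X i)"
    proof
      fix p assume p: "p \<in> collisions q S"
      then have pS: "p \<in> S \<times> S" and eq: "rd q (fst p) = rd q (snd p)" by (auto simp: collisions_def)
      have sgp: "fst p \<in> sg A" "snd p \<in> sg A" using pS S by auto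
      obtain a b c d a' b' c' d' where pp: "p = ((a, b, c, d), (a', b', c', d'))" by (rule mat2_pair_cases)
      show "p \<in> (\<lambda>g. (g, g)) ` S \<union> (\<Union>i<n. X i)"
      proof (cases "fst p = snd p")
        case True
        then show ?thesis using pS by (cases p) auto
      next
        case False
        obtain x y z w where h: "fst p \<odot> adj (snd p) = (x, y, z, w)"
          by (metis prod_cases4)
        have xyzw: "x = a * d' - b * c'" "y = b * a' - a * b'" "z = c * d' - d * c'" "w = d * a' - c * b'"
          using h by (auto simp: pp)
        have "rd q (fst p \<odot> adj (snd p)) = rd q (snd p \<odot> adj (snd p))"
          by (rule rd_cong) (use eq in simp_all)
        then have cong: "rd q (x, y, z, w) = rd q id2" using adj_mm(2)[of "snd p"] dt_sg[OF sgp(2)] h by metis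
        have det: "dt (x, y, z, w) = 1" unfolding h[symmetric] using dt_sg sgp by simp
        have "(x, y, z, w) \<noteq> id2"
          using False h mm_adj_eq_iff[of "snd p" "fst p" id2] dt_sg[OF sgp(2)] by auto
        define m where "m = max (max \<bar>x\<bar> \<bar>y\<bar>) (max \<bar>z\<bar> \<bar>w\<bar>)"
        have m: "\<bar>x\<bar> \<le> m" "\<bar>y\<bar> \<le> m" "\<bar>z\<bar> \<le> m" "\<bar>w\<bar> \<le> m" by (simp_all only: m_def le_max_iff_disj order_refl simp_thms)
        have m1: "m \<ge> 1"
        proof (rule ccontr)
          assume "\<not> m \<ge> 1"
          then have "x = 0" "y = 0" using m by linarith+
          then show False using det by simp
        qed
        have aB: "real_of_int a \<le> B" "real_of_int a' \<le> B" using SB pS by (auto simp: pp)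
        note bd = sg_bounds[OF sgp(1)[unfolded pp fst_conv]] sg_bounds[OF sgp(2)[unfolded pp snd_conv]]
        have ent: "0 \<le> a" "0 \<le> b" "0 \<le> c" "0 \<le> d" "0 \<le> a'" "0 \<le> b'" "0 \<le> c'" "0 \<le> d'"
          "real_of_int b \<le> B" "real_of_int c \<le> B" "real_of_int d \<le> B"
          "real_of_int b' \<le> B" "real_of_int c' \<le> B" "real_of_int d' \<le> B"
          using bd(1-7,9-15) aB by linarith+
        have "real_of_int \<bar>x\<bar> \<le> B\<^sup>2" "real_of_int \<bar>y\<bar> \<le> B\<^sup>2" "real_of_int \<bar>z\<bar> \<le> B\<^sup>2" "real_of_int \<bar>w\<bar> \<le> B\<^sup>2"
          unfolding xyzw of_int_abs by (intro abs_det_le ent aB)+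
        then have mB: "real_of_int m \<le> B\<^sup>2" by (simp add: m_def max_def)
        define i where "i = nat \<lfloor>log 2 (real_of_int m)\<rfloor>"
        have l0: "log 2 (real_of_int m) \<ge> 0" using m1 by simp
        have li: "real i \<le> log 2 (real_of_int m)" "log 2 (real_of_int m) < real i + 1"
          using l0 unfolding i_def by linarith+
        have "2 powr real i \<le> real_of_int m" "real_of_int m < 2 powr (real i + 1)"
          using li m1 by (simp_all add: le_log_iff log_less_iff)
        then have "2 ^ i \<le> real_of_int m" "real_of_int m < 2 ^ Suc i"
          by (simp_all add: powr_realpow powr_add mult.commute)
        then have "real_of_int (2 ^ i) \<le> real_of_int m" "real_of_int m < real_of_int (2 ^ Suc i)" by simp_all
        then have mi: "2 ^ i \<le> m" "m \<le> 2 ^ Suc i" by (simp_all only: of_int_le_iff of_int_less_iff less_imp_le)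
        have "2 ^ i \<le> B\<^sup>2" using \<open>2 ^ i \<le> real_of_int m\<close> mB by linarith
        then have "i < n" using iB by blast
        moreover have "(x, y, z, w) \<in> cong_subgroup q (2 ^ Suc i)"
          using m mi cong det \<open>_ \<noteq> id2\<close> unfolding cong_subgroup_def by (simp add: abs_le_iff del: rd.simps)
        then have "(x, y, z, w) \<in> big i" using mi(1) unfolding big_def m_def by (auto simp: le_max_iff_disj)
        then have "p \<in> X i" using pS h by (simp add: X_def)
        ultimately show ?thesis by blast
      qed
    qed
    moreover have finX: "finite (X i)" for i
      unfolding X_def by (rule finite_subset[OF _ finite_cartesian_product[OF finS finS]]) blast
    ultimately have "card (collisions q S) \<le> card ((\<lambda>g. (g, g)) ` S \<union> (\<Union>i<n. X i))"
      using finS by (intro card_mono) auto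
    also have "\<dots> \<le> card ((\<lambda>g. (g, g)) ` S) + card (\<Union>i<n. X i)" by (rule card_Un_le)
    also have "\<dots> \<le> card S + (\<Sum>i<n. card (X i))"
      by (intro add_mono card_image_le finS card_UN_le) auto
    finally have "real (card (collisions q S)) \<le> real (card S) + (\<Sum>i<n. real (card (X i)))"
      by (metis of_nat_add of_nat_le_iff of_nat_sum)
    also have "\<dots> \<le> 6 * B\<^sup>2 + real n * (C1 * main)"
    proof (intro add_mono cardS)
      have "(\<Sum>i<n. real (card (X i))) \<le> real (card {..<n}) * (C1 * main)"
        using X iB by (intro sum_bounded_above) auto
      then show "(\<Sum>i<n. real (card (X i))) \<le> real n * (C1 * main)" by simp
    qed
    also have "\<dots> \<le> 6 * (B powr (4 + 5 * \<epsilon>) / r ^ 3) + C2 * C1 * (B powr (4 + 5 * \<epsilon>) / r ^ 3)"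
    proof (intro add_mono)
      \<comment> \<open>The diagonal pairs fit into the bound because q^3 <= B^2.\<close>
      have "B\<^sup>2 * r ^ 3 \<le> B\<^sup>2 * B\<^sup>2" using qB by (intro mult_left_mono) (auto simp: r_def)
      also have "\<dots> = B powr 4" using B by (simp add: powr_numeral power2_eq_square power4_eq_xxxx)
      also have "\<dots> \<le> B powr (4 + 5 * \<epsilon>)" using B \<epsilon> by (intro powr_mono) auto
      finally show "6 * B\<^sup>2 \<le> 6 * (B powr (4 + 5 * \<epsilon>) / r ^ 3)" using r2 by (simp add: pos_le_divide_eq)
      have "real n \<le> 1 + log 2 (B\<^sup>2)" using log0 unfolding n_def by linarith
      also have "log 2 (B\<^sup>2) = 2 * (ln B / ln 2)" using B by (simp add: log_def ln_realpow)
      also have "\<dots> \<le> 2 * ((B powr \<epsilon> / \<epsilon>) / ln 2)"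
        using ln_powr_bound[OF B \<epsilon>(1)] by (intro mult_left_mono divide_right_mono) auto
      also have "1 + \<dots> \<le> B powr \<epsilon> + 2 * ((B powr \<epsilon> / \<epsilon>) / ln 2)"
        using B \<epsilon> by (intro add_right_mono ge_one_powr_ge_zero) auto
      also have "\<dots> = C2 * B powr \<epsilon>" by (simp add: C2_def algebra_simps)
      finally have n: "real n \<le> C2 * B powr \<epsilon>" by simp
      have "real n * (C1 * main) \<le> C2 * B powr \<epsilon> * (C1 * main)"
        using C1 r2 n by (intro mult_right_mono) (auto simp: main_def)
      also have "\<dots> = C2 * C1 * ((B powr \<epsilon> * B powr (4 + 4 * \<epsilon>)) / r ^ 3)" by (simp add: main_def)
      also have "B powr \<epsilon> * B powr (4 + 4 * \<epsilon>) = B powr (4 + 5 * \<epsilon>)" by (simp add: add.commute flip: powr_add)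
      finally show "real n * (C1 * main) \<le> C2 * C1 * (B powr (4 + 5 * \<epsilon>) / r ^ 3)" .
    qed
    also have "\<dots> = (6 + C2 * C1) * B powr (4 + 5 * \<epsilon>) / real_of_int q ^ 3"
      by (simp add: r_def algebra_simps add_divide_distrib)
    finally show "real (card (collisions q S)) \<le> (6 + C2 * C1) * B powr (4 + 5 * \<epsilon>) / real_of_int q ^ 3" .
  qed
qed

section \<open>Bad products and large square divisors\<close>

lemma rd_adj: "rd q g = rd q h \<Longrightarrow> rd q (adj g) = rd q (adj h)"
  by (cases g; cases h) (auto intro: mod_minus_cong)

lemma rd_cancel_left:
  assumes "rd q (x \<odot> x') = rd q (y \<odot> y')" "rd q x = rd q y" "dt x = 1" "dt y = 1"
  shows "rd q x' = rd q y'"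
proof -
  have "rd q (adj x \<odot> (x \<odot> x')) = rd q (adj y \<odot> (y \<odot> y'))"
    by (rule rd_cong[OF rd_adj[OF assms(2)] assms(1)])
  moreover have "adj x \<odot> (x \<odot> x') = x'" "adj y \<odot> (y \<odot> y') = y'"
    using assms(3,4) by (metis adj_mm(1) mm_assoc mm_id2(1))+
  ultimately show ?thesis by simp
qed

lemma rd_cancel_right:
  assumes "rd q (x \<odot> x') = rd q (y \<odot> y')" "rd q x' = rd q y'" "dt x' = 1" "dt y' = 1"
  shows "rd q x = rd q y"
proof -
  have "rd q ((x \<odot> x') \<odot> adj x') = rd q ((y \<odot> y') \<odot> adj y')"
    by (rule rd_cong[OF assms(1) rd_adj[OF assms(2)]])
  moreover have "(x \<odot> x') \<odot> adj x' = x" "(y \<odot> y') \<odot> adj y' = y"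
    using assms(3,4) by (metis adj_mm(2) mm_assoc mm_id2(2))+
  ultimately show ?thesis by simp
qed

text \<open>Cauchy--Schwarz in the form $\sum_h n(h)\, n(\varphi(h)) \le \sum_h n(h)^2$ for the injection
  \<open>\<phi>\<close> between residue classes given by \<open>E\<close>.\<close>

lemma card_matching_le_collisions:
  assumes S: "finite S" and E: "E \<subseteq> S \<times> S"
    and match: "\<And>x x' y y'. (x, x') \<in> E \<Longrightarrow> (y, y') \<in> E \<Longrightarrow> rd q x = rd q y \<longleftrightarrow> rd q x' = rd q y'"
  shows "card E \<le> card (collisions q S)"
proof -
  define H where "H = (\<lambda>p. rd q (fst p)) ` E"
  define C where "C = (\<lambda>h. {x \<in> S. rd q x = h})"
  \<comment> \<open>\<open>C h\<close> is the residue class h in S, and \<open>C' h\<close> the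
    class that E matches with it. The matching condition makes the sets of each family disjoint and
    contained in single classes, so both sums of squares count collisions.\<close>
  define C' where "C' = (\<lambda>h. {x' \<in> S. \<exists>p\<in>E. rd q (fst p) = h \<and> rd q x' = rd q (snd p)})"
  have finE: "finite E" by (rule finite_subset[OF E finite_cartesian_product[OF S S]])
  then have finH: "finite H" by (simp add: H_def)
  have fin: "finite (C h)" "finite (C' h)" for h using S by (auto simp: C_def C'_def)
  have finc: "finite (collisions q S)"
    unfolding collisions_def by (rule finite_subset[OF _ finite_cartesian_product[OF S S]]) blast
  have sq: "(\<Sum>h\<in>H. card (D h) * card (D h)) \<le> card (collisions q S)"
    if D: "\<And>h. D h \<subseteq> S" "\<And>h x y. x \<in> D h \<Longrightarrow> y \<in> D h \<Longrightarrow> h \<in> H \<Longrightarrow> rd q x = rd q y"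
      "\<And>h h' x. x \<in> D h \<Longrightarrow> x \<in> D h' \<Longrightarrow> h \<in> H \<Longrightarrow> h' \<in> H \<Longrightarrow> h = h'" for D
  proof -
    have finD: "finite (D h)" for h by (rule finite_subset[OF D(1) S])
    have "(\<Sum>h\<in>H. card (D h) * card (D h)) = (\<Sum>h\<in>H. card (D h \<times> D h))"
      by (simp add: card_cartesian_product)
    also have "\<dots> = card (\<Union>h\<in>H. D h \<times> D h)"
      by (subst card_UN_disjoint) (use finH finD D(3) in blast)+
    also have "\<dots> \<le> card (collisions q S)"
    proof (rule card_mono[OF finc])
      show "(\<Union>h\<in>H. D h \<times> D h) \<subseteq> collisions q S"
      proof
        fix v assume "v \<in> (\<Union>h\<in>H. D h \<times> D h)"
        then obtain h where h: "h \<in> H" "fst v \<in> D h" "snd v \<in> D h" by (auto simp: mem_Times_iff)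
        then have "fst v \<in> S" "snd v \<in> S" using D(1) by blast+
        moreover have "rd q (fst v) = rd q (snd v)" using D(2) h by blast
        ultimately show "v \<in> collisions q S" by (simp add: collisions_def mem_Times_iff)
      qed
    qed
    finally show ?thesis .
  qed
  have "E \<subseteq> (\<Union>h\<in>H. C h \<times> C' h)"
  proof
    fix p assume p: "p \<in> E"
    then have "p \<in> S \<times> S" using E by blast
    then have "fst p \<in> S" "snd p \<in> S" by (simp_all add: mem_Times_iff)
    then have "fst p \<in> C (rd q (fst p))" "snd p \<in> C' (rd q (fst p))"
      unfolding C_def C'_def using p by blast+
    then have "p \<in> C (rd q (fst p)) \<times> C' (rd q (fst p))" by (simp add: mem_Times_iff)
    then show "p \<in> (\<Union>h\<in>H. C h \<times> C' h)" using p unfolding H_def by blast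
  qed
  then have "card E \<le> card (\<Union>h\<in>H. C h \<times> C' h)"
    using fin finH by (intro card_mono) auto
  also have "\<dots> \<le> (\<Sum>h\<in>H. card (C h \<times> C' h))" by (rule card_UN_le[OF finH])
  also have "\<dots> = (\<Sum>h\<in>H. card (C h) * card (C' h))" by (simp add: card_cartesian_product)
  \<comment> \<open>Doubled so that 2 u v <= u^2 + v^2 can be used for natural numbers.\<close>
  finally have "2 * card E \<le> (\<Sum>h\<in>H. 2 * (card (C h) * card (C' h)))"
    by (simp add: sum_distrib_left[symmetric])
  also have "\<dots> \<le> (\<Sum>h\<in>H. card (C h) * card (C h) + card (C' h) * card (C' h))"
  proof (rule sum_mono)
    fix h
    have "2 * (real (card (C h)) * real (card (C' h))) \<le> real (card (C h)) * real (card (C h)) + real (card (C' h)) * real (card (C' h))"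
      using sum_squares_bound[of "real (card (C h))" "real (card (C' h))"] by (simp add: power2_eq_square)
    then have "real (2 * (card (C h) * card (C' h))) \<le> real (card (C h) * card (C h) + card (C' h) * card (C' h))"
      by simp
    then show "2 * (card (C h) * card (C' h)) \<le> card (C h) * card (C h) + card (C' h) * card (C' h)"
      by (simp only: of_nat_le_iff)
  qed
  also have "\<dots> = (\<Sum>h\<in>H. card (C h) * card (C h)) + (\<Sum>h\<in>H. card (C' h) * card (C' h))"
    by (rule sum.distrib)
  also have "(\<Sum>h\<in>H. card (C h) * card (C h)) \<le> card (collisions q S)"
    by (rule sq) (auto simp: C_def)
  also have "(\<Sum>h\<in>H. card (C' h) * card (C' h)) \<le> card (collisions q S)"
  proof (rule sq)
    show "C' h \<subseteq> S" for h by (auto simp: C'_def)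
    show "rd q x = rd q y" if "x \<in> C' h" "y \<in> C' h" for h x y
    proof -
      obtain u v where uv: "u \<in> E" "rd q (fst u) = h" "rd q x = rd q (snd u)"
        "v \<in> E" "rd q (fst v) = h" "rd q y = rd q (snd v)"
        using \<open>x \<in> C' h\<close> \<open>y \<in> C' h\<close> unfolding C'_def by blast
      then show ?thesis using match[of "fst u" "snd u" "fst v" "snd v"] by simp
    qed
    show "h = h'" if "x \<in> C' h" "x \<in> C' h'" for h h' x
    proof -
      obtain u v where uv: "u \<in> E" "rd q (fst u) = h" "rd q x = rd q (snd u)"
        "v \<in> E" "rd q (fst v) = h'" "rd q x = rd q (snd v)"
        using \<open>x \<in> C' h\<close> \<open>x \<in> C' h'\<close> unfolding C'_def by blast
      then show ?thesis using match[of "fst u" "snd u" "fst v" "snd v"] by simp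
    qed
  qed
  finally show ?thesis by simp
qed

lemma dt_rd: "[dt (rd q g) = dt g] (mod q)"
  by (cases g) (auto intro!: cong_diff cong_mult)

lemma tn_rd: "[tn (rd q g) = tn g] (mod q)"
  by (cases g) (auto intro!: cong_add cong_pow)

text \<open>Once the residue of the whole product is fixed, the residues of the two factors
  determine each other, whatever \<open>Y\<close> and \<open>Z\<close> are. So each bad residue
  class costs at most the number of collisions.\<close>

lemma (in odd_prime) card_bad_pairs:
  assumes \<sigma>: "\<sigma> = 1 \<or> \<sigma> = -1" and S: "finite S" "S \<subseteq> sg A" and YZ: "dt Y = 1" "dt Z = 1"
  shows "real (card {v \<in> S \<times> S. p\<^sup>2 dvd tn (Y \<odot> (fst v \<odot> snd v) \<odot> Z) - 2 * \<sigma>}) \<le>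
    16 * real_of_int p ^ 4 * real (card (collisions (p\<^sup>2) S))"
proof -
  let ?P = "{v \<in> S \<times> S. p\<^sup>2 dvd tn (Y \<odot> (fst v \<odot> snd v) \<odot> Z) - 2 * \<sigma>}"
  define f where "f = (\<lambda>v. rd (p\<^sup>2) (Y \<odot> (fst v \<odot> snd v) \<odot> Z))"
  have finP: "finite ?P"
    by (rule finite_subset[OF _ finite_cartesian_product[OF S(1) S(1)]]) blast
  have "real (card ?P) \<le> real (card (bad_residues \<sigma>)) * real (card (collisions (p\<^sup>2) S))"
  proof (rule card_le_fibres[where f = f, OF finP])
    show "finite (bad_residues \<sigma>)"
      by (rule finite_subset[of _ "{0..<p\<^sup>2} \<times> {0..<p\<^sup>2} \<times> {0..<p\<^sup>2} \<times> {0..<p\<^sup>2}"]) (auto simp: bad_residues_def)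
    show "f ` ?P \<subseteq> bad_residues \<sigma>"
    proof
      fix w assume "w \<in> f ` ?P"
      then obtain v where v: "v \<in> ?P" "w = f v" by blast
      define g where "g = Y \<odot> (fst v \<odot> snd v) \<odot> Z"
      have w: "w = rd (p\<^sup>2) g" using v by (simp add: f_def g_def)
      have "fst v \<in> sg A" "snd v \<in> sg A" using v(1) S(2) by auto
      then have "dt g = 1" using YZ dt_sg by (simp add: g_def)
      then have "[dt w = 1] (mod p\<^sup>2)" using dt_rd[of "p\<^sup>2" g] w by simp
      moreover have "[tn w = 2 * \<sigma>] (mod p\<^sup>2)"
      proof -
        have "[tn g = 2 * \<sigma>] (mod p\<^sup>2)" using v(1) by (simp add: g_def cong_iff_dvd_diff)
        then show ?thesis using tn_rd[of "p\<^sup>2" g] w cong_trans by blast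
      qed
      moreover have "w \<in> {0..<p\<^sup>2} \<times> {0..<p\<^sup>2} \<times> {0..<p\<^sup>2} \<times> {0..<p\<^sup>2}"
        unfolding w using odd by (cases g) simp
      ultimately show "w \<in> bad_residues \<sigma>" by (simp add: bad_residues_def cong_iff_dvd_diff)
    qed
    fix r assume "r \<in> bad_residues \<sigma>"
    show "real (card {v \<in> ?P. f v = r}) \<le> real (card (collisions (p\<^sup>2) S))"
      unfolding of_nat_le_iff
    proof (rule card_matching_le_collisions[OF S(1)])
      show "{v \<in> ?P. f v = r} \<subseteq> S \<times> S" by blast
      fix x x' y y' assume xy: "(x, x') \<in> {v \<in> ?P. f v = r}" "(y, y') \<in> {v \<in> ?P. f v = r}"
      have dts: "dt x = 1" "dt x' = 1" "dt y = 1" "dt y' = 1"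
        using xy S(2) dt_sg by blast+
      have "rd (p\<^sup>2) (Y \<odot> (x \<odot> x') \<odot> Z) = rd (p\<^sup>2) (Y \<odot> (y \<odot> y') \<odot> Z)"
        using xy by (simp add: f_def)
      then have "rd (p\<^sup>2) (Y \<odot> (x \<odot> x')) = rd (p\<^sup>2) (Y \<odot> (y \<odot> y'))"
        by (rule rd_cancel_right) (use YZ in auto)
      then have "rd (p\<^sup>2) (x \<odot> x') = rd (p\<^sup>2) (y \<odot> y')"
        by (rule rd_cancel_left) (use YZ in auto)
      then show "rd (p\<^sup>2) x = rd (p\<^sup>2) y \<longleftrightarrow> rd (p\<^sup>2) x' = rd (p\<^sup>2) y'"
        using rd_cancel_left rd_cancel_right dts by blast
    qed
  qed
  also have "\<dots> \<le> 16 * real_of_int p ^ 4 * real (card (collisions (p\<^sup>2) S))"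
    using card_bad_residues[OF \<sigma>] by (intro mult_right_mono) auto
  finally show ?thesis .
qed

section \<open>Large square divisors\<close>

lemma sum_inverse_squares:
  "z \<ge> 1 \<Longrightarrow> (\<Sum>m\<in>{z<..n}. 1 / (real m)\<^sup>2) \<le> 1 / real z"
proof -
  assume z: "z \<ge> 1"
  have "(\<Sum>m\<in>{z<..z+k}. 1 / (real m)\<^sup>2) \<le> 1 / real z - 1 / real (z + k)" for k
  proof (induction k)
    case (Suc k)
    have "{z<..z + Suc k} = insert (z + Suc k) {z<..z + k}" by auto
    then have "(\<Sum>m\<in>{z<..z + Suc k}. 1 / (real m)\<^sup>2) = 1 / (real (z + Suc k))\<^sup>2 + (\<Sum>m\<in>{z<..z+k}. 1 / (real m)\<^sup>2)"
      by simp
    also have "1 / (real (z + Suc k))\<^sup>2 \<le> 1 / (real (z + k) * real (z + Suc k))"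
      using z by (intro divide_left_mono) (auto simp: power2_eq_square intro!: mult_right_mono)
    also have "\<dots> = 1 / real (z + k) - 1 / real (z + Suc k)"
      using z by (subst diff_frac_eq) auto
    finally show ?case using Suc by simp
  qed simp
  note le = this
  show ?thesis
  proof (cases "n \<ge> z")
    case True
    then obtain k where "n = z + k" using le_Suc_ex by blast
    then show ?thesis using le[of k] by (smt (verit) of_nat_0_le_iff divide_nonneg_nonneg)
  qed (use z in simp)
qed

text \<open>The vectors (a - d, b + c) and (a + d, b - c) have squared lengths t - 2 and t + 2 and
  determine the matrix; t > 2 keeps both numbers positive.\<close>

lemma card_norm_level:
  fixes t :: int
  assumes \<epsilon>: "\<epsilon> > 0" and C: "C \<ge> 1" "\<And>n :: int. n > 0 \<Longrightarrow> real (card {(x, y :: int). x\<^sup>2 + y\<^sup>2 = n}) \<le> C * real_of_int n powr \<epsilon>"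
    and t: "t > 2"
  shows "finite {g. dt g = 1 \<and> tn g = t}"
    "real (card {g. dt g = 1 \<and> tn g = t}) \<le> C\<^sup>2 * real_of_int (t + 2) powr (2 * \<epsilon>)"
proof -
  let ?G = "{g. dt g = 1 \<and> tn g = t}"
  let ?r = "\<lambda>n :: int. {(x, y :: int). x\<^sup>2 + y\<^sup>2 = n}"
  define f where "f = (\<lambda>(a :: int, b :: int, c :: int, d :: int). ((a - d, b + c), (a + d, b - c)))"
  have inj: "inj_on f ?G"
  proof (rule inj_onI)
    fix g h assume eq: "f g = f h"
    obtain a b c d where g: "g = (a, b, c, d)" by (cases g)
    obtain a' b' c' d' where h: "h = (a', b', c', d')" by (cases h)
    have "a - d = a' - d'" "b + c = b' + c'" "a + d = a' + d'" "b - c = b' - c'"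
      using eq by (simp_all add: f_def g h)
    then have "a = a'" "b = b'" "c = c'" "d = d'" by linarith+
    then show "g = h" by (simp add: g h)
  qed
  have img: "f ` ?G \<subseteq> ?r (t - 2) \<times> ?r (t + 2)"
  proof
    fix v assume "v \<in> f ` ?G"
    then obtain g where g: "dt g = 1" "tn g = t" "v = f g" by blast
    obtain a b c d where gg: "g = (a, b, c, d)" by (cases g)
    have "(a - d)\<^sup>2 + (b + c)\<^sup>2 = tn g - 2 * dt g" "(a + d)\<^sup>2 + (b - c)\<^sup>2 = tn g + 2 * dt g"
      by (simp_all add: gg power2_eq_square algebra_simps)
    then show "v \<in> ?r (t - 2) \<times> ?r (t + 2)" using g by (simp add: f_def gg)
  qed
  have fin: "finite (?r (t - 2) \<times> ?r (t + 2))" by (intro finite_cartesian_product finite_two_squares)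
  show "finite ?G" by (rule inj_on_finite[OF inj img fin])
  have "card ?G \<le> card (?r (t - 2) \<times> ?r (t + 2))" by (rule card_inj_on_le[OF inj img fin])
  also have "\<dots> = card (?r (t - 2)) * card (?r (t + 2))" by (rule card_cartesian_product)
  finally have "real (card ?G) \<le> real (card (?r (t - 2)) * card (?r (t + 2)))"
    by (simp only: of_nat_le_iff)
  also have "\<dots> = real (card (?r (t - 2))) * real (card (?r (t + 2)))" by (rule of_nat_mult)
  also have "\<dots> \<le> (C * real_of_int (t - 2) powr \<epsilon>) * (C * real_of_int (t + 2) powr \<epsilon>)"
    using t C by (intro mult_mono C(2)) auto
  also have "\<dots> \<le> (C * real_of_int (t + 2) powr \<epsilon>) * (C * real_of_int (t + 2) powr \<epsilon>)"
    using t C \<epsilon> by (intro mult_right_mono mult_left_mono powr_mono2) auto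
  also have "\<dots> = C\<^sup>2 * real_of_int (t + 2) powr (2 * \<epsilon>)"
    by (simp add: power2_eq_square flip: powr_add)
  finally show "real (card ?G) \<le> C\<^sup>2 * real_of_int (t + 2) powr (2 * \<epsilon>)" .
qed

lemma card_multiples:
  fixes r :: int and X :: real
  assumes "r > 0" "X \<ge> 0"
  shows "finite {u. 0 < u \<and> real_of_int u \<le> X \<and> r dvd u}"
    "real (card {u. 0 < u \<and> real_of_int u \<le> X \<and> r dvd u}) \<le> X / real_of_int r"
proof -
  let ?U = "{u. 0 < u \<and> real_of_int u \<le> X \<and> r dvd u}"
  have sub: "?U \<subseteq> (\<lambda>k. r * k) ` {1..\<lfloor>X / real_of_int r\<rfloor>}"
  proof
    fix u assume u: "u \<in> ?U"
    then obtain k where k: "u = r * k" by (auto elim!: dvdE)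
    have "k \<ge> 1" using u assms(1) unfolding k by (simp add: zero_less_mult_iff)
    moreover have "real_of_int k \<le> X / real_of_int r" using u assms(1) unfolding k by (simp add: field_simps)
    ultimately show "u \<in> (\<lambda>k. r * k) ` {1..\<lfloor>X / real_of_int r\<rfloor>}"
      unfolding k by (intro imageI) (simp add: le_floor_iff)
  qed
  then show "finite ?U" by (rule finite_subset) simp
  have "card ?U \<le> card {1..\<lfloor>X / real_of_int r\<rfloor>}" using sub by (rule surj_card_le[rotated]) simp
  then have "real (card ?U) \<le> real (card {1..\<lfloor>X / real_of_int r\<rfloor>})" by (simp only: of_nat_le_iff)
  also have "\<dots> \<le> X / real_of_int r" using assms by simp
  finally show "real (card ?U) \<le> X / real_of_int r" .
qed

text \<open>For each m and each sign at most (X + 2)/m^2 values of t make m^2 divide t - 2 \<sigma>.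
  Summing over m > z leaves about X/z values of t, and each of them belongs to few matrices.\<close>

lemma card_large_square_divisors:
  fixes \<epsilon> :: real
  assumes \<epsilon>: "0 < \<epsilon>" "\<epsilon> \<le> 1"
  obtains C where "C \<ge> 1"
    "\<And>X z. X \<ge> 1 \<Longrightarrow> z \<ge> 1 \<Longrightarrow>
      real (card {g. dt g = 1 \<and> 2 < tn g \<and> real_of_int (tn g) \<le> X \<and>
        (\<exists>\<sigma>\<in>{1, -1}. \<exists>m > z. (int m)\<^sup>2 dvd tn g - 2 * \<sigma>)}) \<le> C * X powr (1 + \<epsilon>) / real z"
proof -
  obtain C where C: "C \<ge> 1" "\<And>n :: int. n > 0 \<Longrightarrow> real (card {(x, y :: int). x\<^sup>2 + y\<^sup>2 = n}) \<le> C * real_of_int n powr (\<epsilon> / 2)"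
    using two_squares_bound[of "\<epsilon> / 2"] \<epsilon> by auto
  show ?thesis
  proof (rule that[of "18 * C\<^sup>2"])
    show "18 * C\<^sup>2 \<ge> 1" using one_le_power[OF C(1), of 2] by linarith
    fix X :: real and z :: nat assume X: "X \<ge> 1" and z: "z \<ge> 1"
    let ?G = "{g. dt g = 1 \<and> 2 < tn g \<and> real_of_int (tn g) \<le> X \<and>
        (\<exists>\<sigma>\<in>{1, -1}. \<exists>m > z. (int m)\<^sup>2 dvd tn g - 2 * \<sigma>)}"
    \<comment> \<open>The inequalities m <= m^2 <= t - 2 \<sigma> <= X + 2 bound the m that
      occur.\<close>
    define n where "n = nat \<lfloor>X + 2\<rfloor>"
    define U where "U = (\<lambda>m. {u. 0 < u \<and> real_of_int u \<le> X + 2 \<and> (int m)\<^sup>2 dvd u})"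
    define V where "V = (\<Union>m\<in>{z<..n}. U m)"
    define R where "R = (\<lambda>u. u + 2) ` V \<union> (\<lambda>u. u - 2) ` V"
    have finU: "finite (U m)" if "m > z" for m
      unfolding U_def using that X by (intro card_multiples) auto
    then have finV: "finite V" by (auto simp: V_def)
    then have finR: "finite R" by (simp add: R_def)
    have sub: "tn g \<in> R \<inter> {t. 2 < t \<and> real_of_int t \<le> X}" if g: "g \<in> ?G" for g
    proof -
      obtain \<sigma> m where \<sigma>: "\<sigma> \<in> {1, -1}" and m: "m > z" "(int m)\<^sup>2 dvd tn g - 2 * \<sigma>" using g by blast
      define u where "u = tn g - 2 * \<sigma>"
      have u: "0 < u" "real_of_int u \<le> X + 2" using g \<sigma> by (auto simp: u_def)
      have "(int m)\<^sup>2 \<le> u" using m(2) u(1) unfolding u_def by (rule zdvd_imp_le)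
      moreover have "int m * 1 \<le> int m * int m" using m by (intro mult_left_mono) auto
      ultimately have "int m \<le> u" by (simp add: power2_eq_square)
      then have "m \<le> n" using u(2) unfolding n_def by linarith
      then have "u \<in> V" using m u unfolding V_def U_def by (auto simp: u_def)
      moreover have "tn g = u + 2 \<or> tn g = u - 2" using \<sigma> by (auto simp: u_def)
      ultimately have "tn g \<in> R" unfolding R_def by force
      then show ?thesis using g by simp
    qed
    have finG: "finite ?G"
    proof (rule finite_subset)
      show "?G \<subseteq> (\<Union>t\<in>R \<inter> {t. 2 < t \<and> real_of_int t \<le> X}. {g. dt g = 1 \<and> tn g = t})"
        using sub by blast
      show "finite (\<Union>t\<in>R \<inter> {t. 2 < t \<and> real_of_int t \<le> X}. {g. dt g = 1 \<and> tn g = t})"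
        using finR card_norm_level(1)[OF _ C] \<epsilon> by (intro finite_UN_I) auto
    qed
    have "real (card ?G) \<le> real (card (R \<inter> {t. 2 < t \<and> real_of_int t \<le> X})) * (3 * C\<^sup>2 * X powr \<epsilon>)"
    proof (rule card_le_fibres[where f = tn, OF finG])
      show "finite (R \<inter> {t. 2 < t \<and> real_of_int t \<le> X})" using finR by simp
      show "tn ` ?G \<subseteq> R \<inter> {t. 2 < t \<and> real_of_int t \<le> X}" using sub by blast
      fix t assume t: "t \<in> R \<inter> {t. 2 < t \<and> real_of_int t \<le> X}"
      have "card {g \<in> ?G. tn g = t} \<le> card {g. dt g = 1 \<and> tn g = t}"
        using card_norm_level(1)[OF _ C, of t] \<epsilon> t by (intro card_mono) auto
      then have "real (card {g \<in> ?G. tn g = t}) \<le> real (card {g. dt g = 1 \<and> tn g = t})"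
        by (simp only: of_nat_le_iff)
      also have "\<dots> \<le> C\<^sup>2 * real_of_int (t + 2) powr (2 * (\<epsilon> / 2))"
        using card_norm_level(2)[OF _ C, of t] \<epsilon> t by simp
      also have "\<dots> \<le> C\<^sup>2 * (3 * X) powr \<epsilon>"
        using t X \<epsilon> by (intro mult_left_mono) (auto intro!: powr_mono2)
      also have "(3 * X) powr \<epsilon> = 3 powr \<epsilon> * X powr \<epsilon>" using X by (simp add: powr_mult)
      also have "C\<^sup>2 * \<dots> \<le> C\<^sup>2 * (3 powr 1 * X powr \<epsilon>)"
        using \<epsilon> by (intro mult_left_mono mult_right_mono powr_mono) auto
      finally show "real (card {g \<in> ?G. tn g = t}) \<le> 3 * C\<^sup>2 * X powr \<epsilon>" by simp
    qed
    also have "\<dots> \<le> (6 * X / real z) * (3 * C\<^sup>2 * X powr \<epsilon>)"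
    proof (intro mult_right_mono)
      have "card (R \<inter> {t. 2 < t \<and> real_of_int t \<le> X}) \<le> card R" using finR by (intro card_mono) auto
      also have "\<dots> \<le> card ((\<lambda>u. u + 2) ` V) + card ((\<lambda>u. u - 2) ` V)" unfolding R_def by (rule card_Un_le)
      also have "\<dots> \<le> card V + card V" by (intro add_mono card_image_le finV)
      also have "card V \<le> (\<Sum>m\<in>{z<..n}. card (U m))" unfolding V_def by (rule card_UN_le) simp
      finally have "real (card (R \<inter> {t. 2 < t \<and> real_of_int t \<le> X})) \<le> 2 * (\<Sum>m\<in>{z<..n}. real (card (U m)))"
        by (simp flip: of_nat_sum)
      also have "\<dots> \<le> 2 * (\<Sum>m\<in>{z<..n}. (X + 2) * (1 / (real m)\<^sup>2))"
      proof (intro mult_left_mono sum_mono)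
        fix m assume "m \<in> {z<..n}"
        then show "real (card (U m)) \<le> (X + 2) * (1 / (real m)\<^sup>2)"
          using card_multiples(2)[of "(int m)\<^sup>2" "X + 2"] X by (simp add: U_def)
      qed simp
      also have "\<dots> = 2 * (X + 2) * (\<Sum>m\<in>{z<..n}. 1 / (real m)\<^sup>2)"
        by (simp add: sum_distrib_left mult.assoc)
      also have "\<dots> \<le> 2 * (X + 2) * (1 / real z)"
        using X by (intro mult_left_mono sum_inverse_squares z) auto
      also have "\<dots> \<le> 2 * (3 * X) * (1 / real z)" using X by (intro mult_right_mono) auto
      finally show "real (card (R \<inter> {t. 2 < t \<and> real_of_int t \<le> X})) \<le> 6 * X / real z" by simp
    qed (use C in auto)
    also have "\<dots> = 18 * C\<^sup>2 * X powr (1 + \<epsilon>) / real z" using X by (simp add: powr_add)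
    finally show "real (card ?G) \<le> 18 * C\<^sup>2 * X powr (1 + \<epsilon>) / real z" .
  qed
qed

section \<open>The multiscale family\<close>

text \<open>The two counts combine to 16 p^4 times M^(4 + 1/32) / p^6 bad pairs, up to a constant.
  Since 1/32 + 2 \<eta> <= 1/16 and M <= p^8, the excess over M^(2 (2 - \<eta>)) is at most p^(1/2),
  which leaves p^(-3/2). The lower bound p^4 <= M secures q^3 <= B^2 for q = p^2 and B =
  M/2.\<close>

lemma card_bad_block_pairs:
  fixes \<eta> \<kappa> :: real
  assumes \<eta>: "0 < \<eta>" "\<eta> \<le> 1/64" and \<kappa>: "\<kappa> \<ge> 1"
  obtains K where "K \<ge> 1" "\<And>p M S A Y Z \<sigma>. \<lbrakk>prime p; p > 2; real_of_int p ^ 4 \<le> M; M \<le> real_of_int p ^ 8;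
      finite S; S \<subseteq> sg A; \<And>g. g \<in> S \<Longrightarrow> M / (2 * \<kappa>) \<le> real_of_int (a11 g) \<and> 2 * real_of_int (a11 g) \<le> M;
      real (card S) \<ge> M powr (2 - \<eta>); \<sigma> = 1 \<or> \<sigma> = -1; dt Y = 1; dt Z = 1\<rbrakk>
    \<Longrightarrow> real (card {v \<in> S \<times> S. p\<^sup>2 dvd tn (Y \<odot> (fst v \<odot> snd v) \<odot> Z) - 2 * \<sigma>})
      \<le> K * real_of_int p powr (-3/2) * real (card S) ^ 2"
proof -
  \<comment> \<open>Gives 5 \<epsilon> = 1/32 in \<open>card_collisions\<close>.\<close>
  have e: "0 < (1/160 :: real)" "(1/160 :: real) \<le> 1" by simp_all
  obtain K where K: "K \<ge> 1" "\<And>A q B S. \<lbrakk>q \<ge> 2; B \<ge> 1; real_of_int q ^ 3 \<le> B\<^sup>2; S \<subseteq> sg A;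
      \<And>g. g \<in> S \<Longrightarrow> B / \<kappa> \<le> real_of_int (a11 g) \<and> real_of_int (a11 g) \<le> B\<rbrakk>
    \<Longrightarrow> real (card (collisions q S)) \<le> K * B powr (4 + 5 * (1/160)) / real_of_int q ^ 3"
    using card_collisions[OF e \<kappa>] by blast
  show ?thesis
  proof (rule that[of "16 * K"])
    show "16 * K \<ge> 1" using K by simp
    fix p :: int and M :: real and S A Y Z and \<sigma> :: int
    assume p: "prime p" "p > 2" and M: "real_of_int p ^ 4 \<le> M" "M \<le> real_of_int p ^ 8"
      and S: "finite S" "S \<subseteq> sg A"
      and SM: "\<And>g. g \<in> S \<Longrightarrow> M / (2 * \<kappa>) \<le> real_of_int (a11 g) \<and> 2 * real_of_int (a11 g) \<le> M"
      and cS: "real (card S) \<ge> M powr (2 - \<eta>)" and \<sigma>: "\<sigma> = 1 \<or> \<sigma> = -1" and YZ: "dt Y = 1" "dt Z = 1"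
    interpret odd_prime p using p by unfold_locales
    define P where "P = real_of_int p"
    have P: "P \<ge> 3" using p(2) by (simp add: P_def)
    define B where "B = M / 2"
    have P4: "P ^ 4 \<le> M" "M \<le> P ^ 8" using M by (simp_all add: P_def)
    have "P ^ 4 \<ge> 3 ^ 4" using P by (intro power_mono) auto
    then have M1: "M \<ge> 2" using P4 by simp
    have coll: "real (card (collisions (p\<^sup>2) S)) \<le> K * B powr (4 + 5 * (1/160)) / real_of_int (p\<^sup>2) ^ 3"
    proof (rule K(2))
      show "2 \<le> p\<^sup>2" using p(2) self_le_power[of p 2] by linarith
      show "1 \<le> B" using M1 by (simp add: B_def)
      have "4 * P ^ 6 \<le> P ^ 2 * P ^ 6"
        using P power_mono[of 3 P 2] by (intro mult_right_mono) auto
      also have "\<dots> = P ^ 4 * P ^ 4" by (simp flip: power_add)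
      also have "\<dots> \<le> M * M" using P4 P M1 by (intro mult_mono) auto
      finally have "4 * P ^ 6 \<le> M * M" .
      moreover have "real_of_int (p\<^sup>2) ^ 3 = P ^ 6" by (simp add: P_def flip: power_mult)
      moreover have "B\<^sup>2 = M * M / 4" by (simp add: B_def power2_eq_square)
      ultimately show "real_of_int (p\<^sup>2) ^ 3 \<le> B\<^sup>2" by linarith
      show "S \<subseteq> sg A" by (rule S(2))
      show "B / \<kappa> \<le> real_of_int (a11 g) \<and> real_of_int (a11 g) \<le> B" if "g \<in> S" for g
        using SM[OF that] by (simp add: B_def)
    qed
    have "real (card {v \<in> S \<times> S. p\<^sup>2 dvd tn (Y \<odot> (fst v \<odot> snd v) \<odot> Z) - 2 * \<sigma>})
      \<le> 16 * P ^ 4 * real (card (collisions (p\<^sup>2) S))"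
      unfolding P_def by (rule card_bad_pairs[OF \<sigma> S YZ])
    also have "\<dots> \<le> 16 * P ^ 4 * (K * M powr (4 + 1/32) / P ^ 6)"
    proof (rule mult_left_mono)
      have "B powr (4 + 5 * (1/160)) \<le> M powr (4 + 1/32)"
        using M1 powr_mono2[of "4 + 1/32" B M] by (simp add: B_def)
      then have "K * B powr (4 + 5 * (1/160)) / P ^ 6 \<le> K * M powr (4 + 1/32) / P ^ 6"
        using K P by (intro divide_right_mono mult_left_mono) auto
      then show "real (card (collisions (p\<^sup>2) S)) \<le> K * M powr (4 + 1/32) / P ^ 6"
        using coll by (simp add: P_def flip: power_mult)
    qed (use P in simp)
    also have "\<dots> = 16 * K * (M powr (4 + 1/32) / P ^ 2)"
      using P by (simp add: field_simps flip: power_add)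
    also have "\<dots> \<le> 16 * K * (P powr (-3/2) * M powr (2 * (2 - \<eta>)))"
    proof (rule mult_left_mono)
      have "M powr (4 + 1/32) = M powr (1/32 + 2 * \<eta>) * M powr (2 * (2 - \<eta>))"
        by (simp flip: powr_add)
      also have "M powr (1/32 + 2 * \<eta>) \<le> M powr (1/16)"
        using M1 \<eta> by (intro powr_mono) auto
      also have "\<dots> \<le> (P ^ 8) powr (1/16)" using P4 M1 by (intro powr_mono2) auto
      also have "\<dots> = P powr (1/2)"
      proof -
        have "P ^ 8 = P powr 8" using P by simp
        then show ?thesis by (simp only: powr_powr) simp
      qed
      finally have "M powr (4 + 1/32) \<le> P powr (1/2) * M powr (2 * (2 - \<eta>))"
        by (simp add: mult_right_mono)
      then have "M powr (4 + 1/32) / P ^ 2 \<le> P powr (1/2) * M powr (2 * (2 - \<eta>)) / P ^ 2"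
        using P by (intro divide_right_mono) auto
      also have "P powr (1/2) * M powr (2 * (2 - \<eta>)) / P ^ 2 = (P powr (1/2) / P powr 2) * M powr (2 * (2 - \<eta>))"
        using P by simp
      also have "P powr (1/2) / P powr 2 = P powr (-3/2)" by (simp flip: powr_diff)
      finally show "M powr (4 + 1/32) / P ^ 2 \<le> P powr (-3/2) * M powr (2 * (2 - \<eta>))" .
    qed (use K in simp)
    also have "M powr (2 * (2 - \<eta>)) = (M powr (2 - \<eta>)) ^ 2"
      by (simp add: power2_eq_square flip: powr_add)
    also have "16 * K * (P powr (-3/2) * (M powr (2 - \<eta>)) ^ 2) \<le> 16 * K * (P powr (-3/2) * real (card S) ^ 2)"
      using K cS by (intro mult_left_mono power_mono) auto
    finally show "real (card {v \<in> S \<times> S. p\<^sup>2 dvd tn (Y \<odot> (fst v \<odot> snd v) \<odot> Z) - 2 * \<sigma>})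
      \<le> 16 * K * real_of_int p powr (-3/2) * real (card S) ^ 2" by (simp add: P_def mult.assoc)
  qed
qed

text \<open>Uniform in the outer factors, so that the property passes to products in which T is one
  factor and survives multiplication by a factor chosen later.\<close>

definition sparse_at :: "real \<Rightarrow> int \<Rightarrow> mat2 set \<Rightarrow> bool" where
  "sparse_at K p T \<longleftrightarrow> (\<forall>\<sigma>\<in>{1, -1}. \<forall>Y Z. dt Y = 1 \<longrightarrow> dt Z = 1 \<longrightarrow>
     real (card {g \<in> T. p\<^sup>2 dvd tn (Y \<odot> g \<odot> Z) - 2 * \<sigma>}) \<le> K * real_of_int p powr (-3/2) * real (card T))"

lemma card_product_filter_right:
  fixes m :: real
  assumes "finite X" "finite Y" "\<And>x. x \<in> X \<Longrightarrow> real (card {y \<in> Y. Q x y}) \<le> m"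
  shows "real (card {v \<in> X \<times> Y. Q (fst v) (snd v)}) \<le> real (card X) * m"
proof (rule card_le_fibres[where f = fst])
  show "finite {v \<in> X \<times> Y. Q (fst v) (snd v)}"
    by (rule finite_subset[OF _ finite_cartesian_product[OF assms(1,2)]]) blast
  show "finite X" by fact
  show "fst ` {v \<in> X \<times> Y. Q (fst v) (snd v)} \<subseteq> X" by auto
  fix x assume x: "x \<in> X"
  have "{a \<in> {v \<in> X \<times> Y. Q (fst v) (snd v)}. fst a = x} = Pair x ` {y \<in> Y. Q x y}"
    using x by (auto simp: image_iff)
  then have "card {a \<in> {v \<in> X \<times> Y. Q (fst v) (snd v)}. fst a = x} = card {y \<in> Y. Q x y}"
    by (simp add: card_image inj_on_def)
  then show "real (card {a \<in> {v \<in> X \<times> Y. Q (fst v) (snd v)}. fst a = x}) \<le> m"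
    using assms(3)[OF x] by simp
qed

lemma card_product_filter_left:
  fixes m :: real
  assumes "finite X" "finite Y" "\<And>y. y \<in> Y \<Longrightarrow> real (card {x \<in> X. Q x y}) \<le> m"
  shows "real (card {v \<in> X \<times> Y. Q (fst v) (snd v)}) \<le> real (card Y) * m"
proof -
  have "{v \<in> X \<times> Y. Q (fst v) (snd v)} = prod.swap ` {v \<in> Y \<times> X. Q (snd v) (fst v)}"
    by (auto simp: image_iff prod.swap_def)
  then have "card {v \<in> X \<times> Y. Q (fst v) (snd v)} = card {v \<in> Y \<times> X. Q (snd v) (fst v)}"
    by (simp add: card_image)
  then show ?thesis using card_product_filter_right[OF assms(2,1), of "\<lambda>y x. Q x y" m] assms(3) by simp
qed

text \<open>The set at scale \<open>R\<close> is $S \cdot S \cdot T$ with \<open>S\<close> a block at scale $R^{1/4}$ and \<open>T\<close> the set at scale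
  $R^{1/2}$: the factor \<open>T\<close> handles the primes up to $R^{1/32}$, the factor $S \cdot S$ those between
  $R^{1/32}$ and $R^{1/16}$.\<close>

lemma sparse_family:
  fixes \<eta> :: real
  assumes \<eta>: "0 < \<eta>" "\<eta> \<le> 1/64"
  obtains A :: nat and K R0 :: real where "K \<ge> 1" "R0 \<ge> 2"
    "\<And>R. R \<ge> R0 \<Longrightarrow> \<exists>T. finite T \<and> T \<subseteq> sg A \<and> (\<forall>g\<in>T. 2 * real_of_int (a11 g) \<le> R) \<and>
      real (card T) \<ge> R powr (2 - \<eta>) \<and>
      (\<forall>p. prime p \<longrightarrow> R0 < real_of_int p \<longrightarrow> real_of_int p \<le> R powr (1/16) \<longrightarrow> sparse_at K p T)"
proof -
  have \<eta>1: "\<eta> < 1" using \<eta> by simp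
  obtain A :: nat and \<kappa> M0 :: real where \<kappa>: "\<kappa> \<ge> 1" and M0: "M0 \<ge> 1" and
    block: "\<And>M. M \<ge> M0 \<Longrightarrow> \<exists>T. finite T \<and> T \<subseteq> sg A \<and> disj_cones T \<and>
      (\<forall>g\<in>T. M / (2 * \<kappa>) \<le> real_of_int (a11 g) \<and> 2 * real_of_int (a11 g) \<le> M) \<and>
      real (card T) \<ge> M powr (2 - \<eta>)"
  proof (rule block_family[OF \<eta>(1) \<eta>1])
    fix A :: nat and \<kappa> M0 :: real
    assume *: "\<kappa> \<ge> 1" "M0 \<ge> 1" "\<And>M. M \<ge> M0 \<Longrightarrow> \<exists>T. finite T \<and> T \<subseteq> sg A \<and> disj_cones T \<and>
      (\<forall>g\<in>T. M / (2 * \<kappa>) \<le> real_of_int (a11 g) \<and> 2 * real_of_int (a11 g) \<le> M) \<and>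
      real (card T) \<ge> M powr (2 - \<eta>)"
    show thesis by (rule that[OF *])
  qed
  obtain K where K: "K \<ge> 1" "\<And>p M S A Y Z \<sigma>. \<lbrakk>prime p; p > 2; real_of_int p ^ 4 \<le> M; M \<le> real_of_int p ^ 8;
      finite S; S \<subseteq> sg A; \<And>g. g \<in> S \<Longrightarrow> M / (2 * \<kappa>) \<le> real_of_int (a11 g) \<and> 2 * real_of_int (a11 g) \<le> M;
      real (card S) \<ge> M powr (2 - \<eta>); \<sigma> = 1 \<or> \<sigma> = -1; dt Y = 1; dt Z = 1\<rbrakk>
    \<Longrightarrow> real (card {v \<in> S \<times> S. p\<^sup>2 dvd tn (Y \<odot> (fst v \<odot> snd v) \<odot> Z) - 2 * \<sigma>})
      \<le> K * real_of_int p powr (-3/2) * real (card S) ^ 2"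
    using card_bad_block_pairs[OF \<eta> \<kappa>] by blast
  \<comment> \<open>In the induction the block scale is sqrt R' with R' >= R0, so sqrt R0 >= M0
    makes blocks available.\<close>
  define R0 where "R0 = (M0 + 1)\<^sup>2"
  have "sqrt R0 = M0 + 1" using M0 by (simp add: R0_def)
  then have R0: "R0 \<ge> 2" "M0 \<le> R0" "sqrt R0 \<ge> M0"
    using M0 power_mono[of 2 "M0 + 1" 2] by (auto simp: R0_def power2_eq_square algebra_simps)
  define good where "good = (\<lambda>R T. finite T \<and> T \<subseteq> sg A \<and> (\<forall>g\<in>T. 2 * real_of_int (a11 g) \<le> R) \<and>
      real (card T) \<ge> R powr (2 - \<eta>) \<and>
      (\<forall>p. prime p \<longrightarrow> R0 < real_of_int p \<longrightarrow> real_of_int p \<le> R powr (1/16) \<longrightarrow> sparse_at K p T))"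
  \<comment> \<open>Passing from R to sqrt R halves the exponent 2^n. For R <= R0^2 a single block
    suffices, since R^(1/16) <= R0 leaves no prime to consider.\<close>
  have main: "\<exists>T. good R T" if "R \<ge> R0" "R \<le> R0 ^ (2 ^ n)" for n R
    using that
  proof (induction n arbitrary: R)
    case 0
    then have R: "R = R0" by simp
    obtain T where T: "finite T" "T \<subseteq> sg A" "\<forall>g\<in>T. 2 * real_of_int (a11 g) \<le> R" "real (card T) \<ge> R powr (2 - \<eta>)"
      using block[of R] R R0 by auto
    have "R powr (1/16) \<le> R powr 1" using R R0 by (intro powr_mono) auto
    then have "R powr (1/16) \<le> R0" using R R0 by simp
    then have "good R T" using T unfolding good_def by force
    then show ?case by blast
  next
    case (Suc n)
    show ?case
    proof (cases "R \<le> R0\<^sup>2")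
      case True
      obtain T where T: "finite T" "T \<subseteq> sg A" "\<forall>g\<in>T. 2 * real_of_int (a11 g) \<le> R" "real (card T) \<ge> R powr (2 - \<eta>)"
        using block[of R] Suc.prems R0 by auto
      have "R powr (1/16) \<le> (R0\<^sup>2) powr (1/16)" using True Suc.prems R0 by (intro powr_mono2) auto
      also have "\<dots> = R0 powr (1/8)"
      proof -
        have "R0\<^sup>2 = R0 powr 2" using R0 by simp
        then show ?thesis by (simp only: powr_powr) simp
      qed
      also have "\<dots> \<le> R0 powr 1" using R0 by (intro powr_mono) auto
      finally have "R powr (1/16) \<le> R0" using R0 by simp
      then have "good R T" using T unfolding good_def by force
      then show ?thesis by blast
    next
      case False
      define R' where "R' = sqrt R"
      have R'2: "R'\<^sup>2 = R" "R' \<ge> 0" using Suc.prems R0 by (auto simp: R'_def)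
      have "R0\<^sup>2 \<le> R'\<^sup>2" using False R'2 by simp
      then have R'0: "R0 \<le> R'" using R'2(2) by (rule power2_le_imp_le)
      have "(R0 ^ (2 ^ n))\<^sup>2 = R0 ^ (2 ^ Suc n)" by (simp only: power_mult[symmetric] power_Suc mult.commute)
      then have "R'\<^sup>2 \<le> (R0 ^ (2 ^ n))\<^sup>2" using Suc.prems(2) R'2(1) by (simp only:)
      moreover have "0 \<le> R0 ^ (2 ^ n)" using R0(1) by (intro zero_le_power) linarith
      ultimately have "R' \<le> R0 ^ (2 ^ n)" by (rule power2_le_imp_le)
      then obtain T where T: "good R' T" using Suc.IH[OF R'0] by blast
      then have finT: "finite T" and Tsg: "T \<subseteq> sg A" and Ta: "\<And>g. g \<in> T \<Longrightarrow> 2 * real_of_int (a11 g) \<le> R'"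
        and cT: "real (card T) \<ge> R' powr (2 - \<eta>)"
        and Tp: "\<And>p. prime p \<Longrightarrow> R0 < real_of_int p \<Longrightarrow> real_of_int p \<le> R' powr (1/16) \<Longrightarrow> sparse_at K p T"
        by (auto simp: good_def)
      define M where "M = sqrt R'"
      have M2: "M\<^sup>2 = R'" "M \<ge> 0" using R'2 by (auto simp: M_def)
      have "sqrt R0 \<le> M" unfolding M_def using R'0 by simp
      then have MM0: "M \<ge> M0" using R0 by linarith
      have M1: "M \<ge> 1" using MM0 M0 by linarith
      obtain S where S: "finite S" "S \<subseteq> sg A" "disj_cones S"
        and SM: "\<And>g. g \<in> S \<Longrightarrow> M / (2 * \<kappa>) \<le> real_of_int (a11 g) \<and> 2 * real_of_int (a11 g) \<le> M"
        and cS: "real (card S) \<ge> M powr (2 - \<eta>)"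
        using block[OF MM0] by blast
      define f where "f = (\<lambda>v. (fst (fst v) \<odot> snd (fst v)) \<odot> snd v)"
      define D where "D = (S \<times> S) \<times> T"
      have finD: "finite D" unfolding D_def using S finT by (intro finite_cartesian_product)
      \<comment> \<open>The first block factor is read off from the cone of the product, then the
        second; what remains is the element of T.\<close>
      have inj: "inj_on f D"
      proof (rule inj_onI)
        fix v w assume v: "v \<in> D" and w: "w \<in> D" and eq: "f v = f w"
        obtain x y g where vv: "v = ((x, y), g)" by (metis surj_pair)
        obtain x' y' g' where ww: "w = ((x', y'), g')" by (metis surj_pair)
        have mem: "x \<in> S" "y \<in> S" "g \<in> T" "x' \<in> S" "y' \<in> S" "g' \<in> T" using v w by (auto simp: vv ww D_def)
        then have sgs: "x \<in> sg A" "y \<in> sg A" "g \<in> sg A" "x' \<in> sg A" "y' \<in> sg A" "g' \<in> sg A"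
          using S(2) Tsg by blast+
        have "x \<odot> (y \<odot> g) = x' \<odot> (y' \<odot> g')" using eq by (simp add: f_def vv ww mm_assoc)
        then have "x = x' \<and> y \<odot> g = y' \<odot> g'"
          using disj_cones_mm_inj[OF S(3) mem(1,4) dt_sg[OF sgs(1)] sg_mm[OF sgs(3,2)] sg_mm[OF sgs(6,5)]] by blast
        moreover from this have "y = y' \<and> g = g'"
          using disj_cones_mm_inj[OF S(3) mem(2,5) dt_sg[OF sgs(2)] sgs(3,6)] by blast
        ultimately show "v = w" by (simp add: vv ww)
      qed
      define T' where "T' = f ` D"
      have cT': "real (card T') = real (card S) ^ 2 * real (card T)"
      proof -
        have "card T' = card D" unfolding T'_def by (rule card_image[OF inj])
        also have "\<dots> = card S * card S * card T" unfolding D_def by (simp only: card_cartesian_product)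
        finally show ?thesis by (simp add: power2_eq_square)
      qed
      have filt: "card {g \<in> T'. Q g} = card {v \<in> D. Q (f v)}" for Q
      proof -
        have "{g \<in> T'. Q g} = f ` {v \<in> D. Q (f v)}" by (auto simp: T'_def)
        moreover have "inj_on f {v \<in> D. Q (f v)}" by (rule inj_on_subset[OF inj]) blast
        ultimately show ?thesis by (simp add: card_image)
      qed
      have "good R T'"
        unfolding good_def
      proof (intro conjI ballI allI impI)
        show "finite T'" using finD by (simp add: T'_def)
        show "T' \<subseteq> sg A"
        proof
          fix h assume "h \<in> T'"
          then obtain v where v: "v \<in> D" "h = f v" unfolding T'_def by blast
          have "fst (fst v) \<in> sg A" "snd (fst v) \<in> sg A" "snd v \<in> sg A"
            using v(1) S(2) Tsg unfolding D_def mem_Times_iff by blast+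
          then show "h \<in> sg A" unfolding v(2) f_def by (intro sg_mm)
        qed
        show "2 * real_of_int (a11 h) \<le> R" if hT: "h \<in> T'" for h
        proof -
          obtain v where v: "v \<in> D" "h = f v" using hT unfolding T'_def by blast
          define x where "x = fst (fst v)"
          define y where "y = snd (fst v)"
          define g where "g = snd v"
          have mem: "x \<in> S" "y \<in> S" "g \<in> T" using v(1) unfolding D_def mem_Times_iff x_def y_def g_def by blast+
          then have sgs: "x \<in> sg A" "y \<in> sg A" "g \<in> sg A" using S(2) Tsg by blast+
          have h: "h = (x \<odot> y) \<odot> g" by (simp add: v(2) f_def x_def y_def g_def)
          have pos: "a11 x \<ge> 1" "a11 y \<ge> 1" "a11 g \<ge> 1" using sgs a11_pos by blast+
          have "a11 h \<le> 2 * a11 (x \<odot> y) * a11 g" unfolding h using sgs by (intro a11_mm_le sg_mm)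
          also have "\<dots> \<le> 2 * (2 * a11 x * a11 y) * a11 g"
            using pos sgs by (intro mult_right_mono mult_left_mono a11_mm_le) auto
          finally have "2 * a11 h \<le> (2 * a11 x) * (2 * a11 y) * (2 * a11 g)" by (simp add: mult_ac)
          then have "real_of_int (2 * a11 h) \<le> real_of_int ((2 * a11 x) * (2 * a11 y) * (2 * a11 g))"
            by (simp only: of_int_le_iff)
          also have "\<dots> = (2 * real_of_int (a11 x)) * (2 * real_of_int (a11 y)) * (2 * real_of_int (a11 g))" by simp
          also have "\<dots> \<le> M * M * R'"
            using SM[OF mem(1)] SM[OF mem(2)] Ta[OF mem(3)] pos M1 by (intro mult_mono) auto
          also have "\<dots> = R" using M2 R'2 by (simp add: power2_eq_square)
          finally show ?thesis by simp
        qed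
        show "R powr (2 - \<eta>) \<le> real (card T')"
        proof -
          have "R = M * M * R'" using M2 R'2 by (simp add: power2_eq_square)
          then have "R powr (2 - \<eta>) = (M * M * R') powr (2 - \<eta>)" by (simp only:)
          also have "\<dots> = (M powr (2 - \<eta>))\<^sup>2 * R' powr (2 - \<eta>)"
            using M2(2) R'2(2) by (simp add: powr_mult power2_eq_square)
          also have "\<dots> \<le> (real (card S))\<^sup>2 * real (card T)"
            using cS cT by (intro mult_mono power_mono) auto
          finally show ?thesis by (simp add: cT')
        qed
        fix p :: int assume p: "prime p" "R0 < real_of_int p" "real_of_int p \<le> R powr (1/16)"
        define P where "P = real_of_int p"
        have p2: "p > 2" using p(2) R0 by linarith
        have P2: "P > 2" using p2 by (simp add: P_def)
        show "sparse_at K p T'"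
          unfolding sparse_at_def
        proof (intro ballI allI impI)
          fix \<sigma> :: int and Y Z assume \<sigma>: "\<sigma> \<in> {1, -1}" and YZ: "dt Y = 1" "dt Z = 1"
          have eq: "card {g \<in> T'. p\<^sup>2 dvd tn (Y \<odot> g \<odot> Z) - 2 * \<sigma>} =
            card {v \<in> D. p\<^sup>2 dvd tn (Y \<odot> f v \<odot> Z) - 2 * \<sigma>}" by (rule filt)
          show "real (card {g \<in> T'. p\<^sup>2 dvd tn (Y \<odot> g \<odot> Z) - 2 * \<sigma>}) \<le> K * real_of_int p powr (-3/2) * real (card T')"
          \<comment> \<open>R'^(1/16) = M^(1/8) and R^(1/16) = M^(1/4), so in the second case p^4 <=
            M <= p^8, the window of \<open>card_bad_block_pairs\<close>.\<close>
          proof (cases "P \<le> R' powr (1/16)")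
            case True
            then have sp: "sparse_at K p T" using Tp p by (simp add: P_def)
            have "real (card {v \<in> (S \<times> S) \<times> T. p\<^sup>2 dvd tn (Y \<odot> ((fst (fst v) \<odot> snd (fst v)) \<odot> snd v) \<odot> Z) - 2 * \<sigma>})
              \<le> real (card (S \<times> S)) * (K * real_of_int p powr (-3/2) * real (card T))"
            proof (rule card_product_filter_right[where Q = "\<lambda>u g. p\<^sup>2 dvd tn (Y \<odot> ((fst u \<odot> snd u) \<odot> g) \<odot> Z) - 2 * \<sigma>"])
              fix u assume "u \<in> S \<times> S"
              then have "fst u \<in> sg A" "snd u \<in> sg A" using S(2) unfolding mem_Times_iff by blast+
              then have "dt (Y \<odot> (fst u \<odot> snd u)) = 1" by (simp add: YZ dt_sg)
              then show "real (card {g \<in> T. p\<^sup>2 dvd tn (Y \<odot> ((fst u \<odot> snd u) \<odot> g) \<odot> Z) - 2 * \<sigma>}) \<le> K * real_of_int p powr (-3/2) * real (card T)"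
                using sp \<sigma> YZ(2) unfolding sparse_at_def mm_assoc[of Y "fst u \<odot> snd u", symmetric] by blast
            qed (use S finT in auto)
            then show ?thesis unfolding eq D_def f_def cT'
              by (simp add: card_cartesian_product power2_eq_square mult_ac)
          next
            case False
            have PM8: "M \<le> P ^ 8"
            proof -
              have "R' = M powr 2" using M2 M1 by simp
              then have "M powr (1/8) = R' powr (1/16)" by (simp only: powr_powr) simp
              then have "M powr (1/8) \<le> P" using False by simp
              then have "(M powr (1/8)) ^ 8 \<le> P ^ 8" by (intro power_mono) auto
              then show ?thesis using M1 by (simp add: powr_power)
            qed
            have PM4: "P ^ 4 \<le> M"
            proof -
              have "P ^ 4 \<le> (R powr (1/16)) ^ 4" using p(3) P2 unfolding P_def by (intro power_mono) auto
              also have "\<dots> = R powr (1/4)" using Suc.prems R0 by (simp add: powr_power)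
              also have "\<dots> = M"
              proof -
                have "(M\<^sup>2)\<^sup>2 = R" by (simp only: M2(1) R'2(1))
                then have "R = M ^ 4" by (simp flip: power_mult)
                then have "R = M powr 4" using M1 by simp
                then show ?thesis using M1 by (simp only: powr_powr) simp
              qed
              finally show ?thesis .
            qed
            have "real (card {v \<in> (S \<times> S) \<times> T. p\<^sup>2 dvd tn (Y \<odot> ((fst (fst v) \<odot> snd (fst v)) \<odot> snd v) \<odot> Z) - 2 * \<sigma>})
              \<le> real (card T) * (K * real_of_int p powr (-3/2) * real (card S) ^ 2)"
            proof (rule card_product_filter_left[where Q = "\<lambda>u g. p\<^sup>2 dvd tn (Y \<odot> ((fst u \<odot> snd u) \<odot> g) \<odot> Z) - 2 * \<sigma>"])
              fix g assume "g \<in> T"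
              then have "g \<in> sg A" using Tsg by blast
              then have "dt (g \<odot> Z) = 1" by (simp add: YZ dt_sg)
              then have "real (card {u \<in> S \<times> S. p\<^sup>2 dvd tn (Y \<odot> (fst u \<odot> snd u) \<odot> (g \<odot> Z)) - 2 * \<sigma>}) \<le> K * real_of_int p powr (-3/2) * real (card S) ^ 2"
                using K(2)[OF p(1) p2 PM4[unfolded P_def] PM8[unfolded P_def] S(1,2) SM cS _ YZ(1)] \<sigma> by blast
              then show "real (card {u \<in> S \<times> S. p\<^sup>2 dvd tn (Y \<odot> ((fst u \<odot> snd u) \<odot> g) \<odot> Z) - 2 * \<sigma>}) \<le> K * real_of_int p powr (-3/2) * real (card S) ^ 2"
                by (simp only: mm_assoc)
            qed (use S finT in auto)
            then show ?thesis unfolding eq D_def f_def cT' by (simp add: mult_ac)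
          qed
        qed
      qed
      then show ?thesis by blast
    qed
  qed
  show ?thesis
  proof (rule that[of K R0 A])
    show "K \<ge> 1" "R0 \<ge> 2" using K R0 by auto
    fix R assume R: "R \<ge> R0"
    obtain n where "R < R0 ^ n" using real_arch_pow[of R0 R] R0 by auto
    also have "R0 ^ n \<le> R0 ^ (2 ^ n)" using R0 by (intro power_increasing) auto
    finally obtain T where "good R T" using main[OF R, of n] by auto
    then show "\<exists>T. finite T \<and> T \<subseteq> sg A \<and> (\<forall>g\<in>T. 2 * real_of_int (a11 g) \<le> R) \<and>
      real (card T) \<ge> R powr (2 - \<eta>) \<and>
      (\<forall>p. prime p \<longrightarrow> R0 < real_of_int p \<longrightarrow> real_of_int p \<le> R powr (1/16) \<longrightarrow> sparse_at K p T)"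
      unfolding good_def by blast
  qed
qed

section \<open>Bounded primes\<close>

lemma exists_large_fibre:
  assumes "finite A" "finite R" "R \<noteq> {}" "f ` A \<subseteq> R"
  shows "\<exists>r\<in>R. real (card A) \<le> real (card R) * real (card {a \<in> A. f a = r})"
proof -
  define g where "g = (\<lambda>r. card {a \<in> A. f a = r})"
  have "Max (g ` R) \<in> g ` R" using assms by (intro Max_in) auto
  then obtain r where r: "r \<in> R" "Max (g ` R) = g r" by blast
  have "g r' \<le> g r" if "r' \<in> R" for r'
    unfolding r(2)[symmetric] using assms that by (intro Max_ge) auto
  then have "real (card A) \<le> real (card R) * real (g r)"
    using assms by (intro card_le_fibres[of A R f]) (auto simp: g_def)
  then show ?thesis using r by (auto simp: g_def)
qed

text \<open>Double counting of the bad pairs. It turns a bound on the bad last quotients for each g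
  into one choice of last quotients that is good for most g.\<close>

lemma exists_sparse_slice:
  fixes \<delta> :: real
  assumes "finite X" "X \<noteq> {}" "finite Y" "\<And>y. y \<in> Y \<Longrightarrow> real (card {x \<in> X. Q x y}) \<le> \<delta> * real (card X)"
  shows "\<exists>x\<in>X. real (card {y \<in> Y. Q x y}) \<le> \<delta> * real (card Y)"
proof (rule ccontr)
  assume "\<not> ?thesis"
  then have *: "\<delta> * real (card Y) < real (card {y \<in> Y. Q x y})" if "x \<in> X" for x
    using that by force
  have "real (card X) * (\<delta> * real (card Y)) = (\<Sum>x\<in>X. \<delta> * real (card Y))" by simp
  also have "\<dots> < (\<Sum>x\<in>X. real (card {y \<in> Y. Q x y}))"
    using assms * by (intro sum_strict_mono) auto
  also have "\<dots> = (\<Sum>x\<in>X. \<Sum>y\<in>{y \<in> Y. Q x y}. 1)" by simp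
  also have "\<dots> = (\<Sum>y\<in>Y. \<Sum>x\<in>{x \<in> X. Q x y}. 1)" by (rule sum.swap_restrict) (use assms in auto)
  also have "\<dots> = (\<Sum>y\<in>Y. real (card {x \<in> X. Q x y}))" by simp
  also have "\<dots> \<le> real (card Y) * (\<delta> * real (card X))"
    using assms(4) by (intro sum_bounded_above) auto
  finally show False by (simp add: mult_ac)
qed

section \<open>Correction of residues\<close>

fun mpow :: "mat2 \<Rightarrow> nat \<Rightarrow> mat2" where
  "mpow g 0 = id2"
| "mpow g (Suc n) = g \<odot> mpow g n"

lemma mpow_add: "mpow g (m + n) = mpow g m \<odot> mpow g n"
  by (induction m) (simp_all add: mm_assoc)

lemma mpow_sg: "g \<in> sg A \<Longrightarrow> mpow g n \<in> sg A"
  by (induction n) (auto intro: sg.id2 sg_mm)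

definition residues4 :: "int \<Rightarrow> mat2 set" where
  "residues4 q = {0..<q} \<times> {0..<q} \<times> {0..<q} \<times> {0..<q}"

lemma rd_in_residues4: "q > 0 \<Longrightarrow> rd q g \<in> residues4 q"
  by (cases g) (simp add: residues4_def)

lemma finite_residues4: "finite (residues4 q)"
  by (simp add: residues4_def)

lemma exists_right_inverse_mod:
  assumes q: "q > 0" and g: "g \<in> sg A"
  shows "\<exists>h\<in>sg A. rd q (g \<odot> h) = rd q id2"
proof -
  have "\<not> inj (\<lambda>n. rd q (mpow g n))"
  proof
    assume "inj (\<lambda>n. rd q (mpow g n))"
    then have "infinite (range (\<lambda>n. rd q (mpow g n)))" by (rule range_inj_infinite)
    moreover have "range (\<lambda>n. rd q (mpow g n)) \<subseteq> residues4 q" using rd_in_residues4[OF q] by blast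
    ultimately show False using finite_residues4 finite_subset by blast
  qed
  then obtain i j where ij: "rd q (mpow g i) = rd q (mpow g j)" "i \<noteq> j" by (auto simp: inj_def)
  have main: ?thesis if "rd q (mpow g i) = rd q (mpow g j)" "i < j" for i j
  proof -
    obtain k where k: "j = i + Suc k" using \<open>i < j\<close> less_iff_Suc_add by auto
    have "rd q (mpow g i \<odot> id2) = rd q (mpow g i \<odot> mpow g (Suc k))"
      using that(1) unfolding k mpow_add by simp
    then have "rd q id2 = rd q (mpow g (Suc k))"
      by (rule rd_cancel_left) (use dt_sg[OF mpow_sg[OF g]] in auto)
    then show ?thesis using mpow_sg[OF g, of k] by auto
  qed
  show ?thesis using main[of i j] main[of j i] ij by (cases "i < j") auto
qed

text \<open>The correcting factor depends on the residue of g alone, so only finitely many occur and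
  one bound \<open>c\<close> for their size holds for all g.\<close>

lemma correction_mod:
  assumes q: "q > 0" and w0: "w0 \<in> sg A"
  obtains wf c where "\<And>g. g \<in> sg A \<Longrightarrow> wf (rd q g) \<in> sg A \<and> rd q (g \<odot> wf (rd q g)) = rd q w0"
    "\<And>g. g \<in> sg A \<Longrightarrow> a11 (wf (rd q g)) \<le> c"
proof -
  define wf where "wf = (\<lambda>r. SOME h. h \<in> sg A \<and> (\<forall>g\<in>sg A. rd q g = r \<longrightarrow> rd q (g \<odot> h) = rd q w0))"
  have ex: "\<exists>h. h \<in> sg A \<and> (\<forall>g'\<in>sg A. rd q g' = rd q g \<longrightarrow> rd q (g' \<odot> h) = rd q w0)" if g: "g \<in> sg A" for g
  proof -
    obtain h where h: "h \<in> sg A" "rd q (g \<odot> h) = rd q id2" using exists_right_inverse_mod[OF q g] by blast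
    have "rd q (g' \<odot> (h \<odot> w0)) = rd q w0" if "rd q g' = rd q g" for g'
    proof -
      have "rd q ((g' \<odot> h) \<odot> w0) = rd q ((g \<odot> h) \<odot> w0)" by (intro rd_cong that refl)
      also have "\<dots> = rd q (id2 \<odot> w0)" by (intro rd_cong h(2) refl)
      finally show ?thesis by (simp add: mm_assoc)
    qed
    then show ?thesis using h(1) w0 sg_mm by blast
  qed
  have wf: "wf (rd q g) \<in> sg A \<and> (\<forall>g'\<in>sg A. rd q g' = rd q g \<longrightarrow> rd q (g' \<odot> wf (rd q g)) = rd q w0)"
    if "g \<in> sg A" for g
    unfolding wf_def by (rule someI_ex[OF ex[OF that]])
  define c where "c = Max ((\<lambda>r. a11 (wf r)) ` residues4 q)"
  have "a11 (wf (rd q g)) \<le> c" for g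
    unfolding c_def using finite_residues4 rd_in_residues4[OF q] by (intro Max_ge) auto
  then show ?thesis using wf by (intro that[of wf c]) blast+
qed

lemma card_interval_mod:
  fixes n q :: nat and r :: int
  assumes "q > 0" "q dvd n"
  shows "card {k \<in> {1..int n}. k mod int q = r} \<le> n div q"
proof -
  have "inj_on (\<lambda>k. (k - 1) div int q) {k \<in> {1..int n}. k mod int q = r}"
  proof (rule inj_onI)
    fix x y assume x: "x \<in> {k \<in> {1..int n}. k mod int q = r}" and y: "y \<in> {k \<in> {1..int n}. k mod int q = r}"
      and eq: "(x - 1) div int q = (y - 1) div int q"
    have "(x - 1) mod int q = (y - 1) mod int q" using x y by (intro mod_diff_cong) auto
    then have "x - 1 = y - 1" using eq by (metis div_mult_mod_eq)
    then show "x = y" by simp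
  qed
  moreover have "(\<lambda>k. (k - 1) div int q) ` {k \<in> {1..int n}. k mod int q = r} \<subseteq> {0..<int (n div q)}"
  proof (rule image_subsetI)
    fix k assume "k \<in> {k \<in> {1..int n}. k mod int q = r}"
    then have k: "0 \<le> k - 1" "k - 1 < int n" by auto
    obtain m where m: "n = q * m" using assms(2) by (elim dvdE)
    have "int q * ((k - 1) div int q) \<le> k - 1"
      using assms(1) by (metis add_increasing2 le_add_same_cancel1 mult_div_mod_eq of_nat_0_less_iff order_refl pos_mod_sign)
    also have "\<dots> < int q * int m" using k m by simp
    finally have "(k - 1) div int q < int m" using assms(1) by (simp add: mult_less_cancel_left)
    then show "(k - 1) div int q \<in> {0..<int (n div q)}"
      using k assms(1) m by (simp add: pos_imp_zdiv_nonneg_iff)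
  qed
  ultimately have "card {k \<in> {1..int n}. k mod int q = r} \<le> card {0..<int (n div q)}"
    by (intro card_inj_on_le) auto
  then show ?thesis by simp
qed

lemma tn_cong: "rd q g = rd q h \<Longrightarrow> [tn g = tn h] (mod q)"
  using tn_rd[of q g] tn_rd[of q h] by (simp add: cong_def)

text \<open>The condition has period p^2 in both variables, so the proportion of bad pairs is that
  of \<open>card_bad_steps\<close>: at most 4 p^2 of the p^4 classes.\<close>

lemma (in odd_prime) card_bad_steps_interval:
  fixes n :: nat
  assumes \<sigma>: "\<sigma> = 1 \<or> \<sigma> = -1" and g: "dt g = 1" and Q: "\<not> p dvd Q" and n: "p\<^sup>2 dvd int n"
  shows "real (card {v \<in> {1..int n} \<times> {1..int n}. p\<^sup>2 dvd tn (g \<odot> step (Q * fst v) (Q * snd v)) - 2 * \<sigma>})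
    \<le> 4 / (real_of_int p)\<^sup>2 * (real n)\<^sup>2"
proof -
  define q where "q = (nat p)\<^sup>2"
  have q: "int q = p\<^sup>2" "q > 0" using odd by (simp_all add: q_def)
  have qn: "q dvd n" using n q(1) by (metis int_dvd_int_iff)
  let ?V = "{v \<in> {1..int n} \<times> {1..int n}. p\<^sup>2 dvd tn (g \<odot> step (Q * fst v) (Q * snd v)) - 2 * \<sigma>}"
  let ?R = "{(k, j). k \<in> {0..<p\<^sup>2} \<and> j \<in> {0..<p\<^sup>2} \<and> p\<^sup>2 dvd tn (g \<odot> step (Q * k) (Q * j)) - 2 * \<sigma>}"
  define f where "f = (\<lambda>v. (fst v mod p\<^sup>2, snd v mod p\<^sup>2))"
  have finV: "finite ?V" by (rule finite_subset[of _ "{1..int n} \<times> {1..int n}"]) auto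
  have finR: "finite ?R" by (rule finite_subset[of _ "{0..<p\<^sup>2} \<times> {0..<p\<^sup>2}"]) auto
  have "real (card ?V) \<le> real (card ?R) * (real (n div q))\<^sup>2"
  proof (rule card_le_fibres[where f = f, OF finV finR])
    show "f ` ?V \<subseteq> ?R"
    proof
      fix w assume "w \<in> f ` ?V"
      then obtain v where v: "v \<in> ?V" "w = f v" by blast
      have "rd (p\<^sup>2) (step (Q * (fst v mod p\<^sup>2)) (Q * (snd v mod p\<^sup>2))) = rd (p\<^sup>2) (step (Q * fst v) (Q * snd v))"
        by (simp add: step_def) (auto simp: mod_simps intro!: mod_add_cong mod_mult_cong)
      then have "rd (p\<^sup>2) (g \<odot> step (Q * (fst v mod p\<^sup>2)) (Q * (snd v mod p\<^sup>2))) = rd (p\<^sup>2) (g \<odot> step (Q * fst v) (Q * snd v))"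
        by (intro rd_cong refl)
      then have "[tn (g \<odot> step (Q * (fst v mod p\<^sup>2)) (Q * (snd v mod p\<^sup>2))) = tn (g \<odot> step (Q * fst v) (Q * snd v))] (mod p\<^sup>2)"
        by (rule tn_cong)
      moreover have "[tn (g \<odot> step (Q * fst v) (Q * snd v)) = 2 * \<sigma>] (mod p\<^sup>2)"
        using v(1) by (simp add: cong_iff_dvd_diff)
      ultimately have "[tn (g \<odot> step (Q * (fst v mod p\<^sup>2)) (Q * (snd v mod p\<^sup>2))) = 2 * \<sigma>] (mod p\<^sup>2)"
        by (rule cong_trans)
      then show "w \<in> ?R" using odd by (simp add: v(2) f_def cong_iff_dvd_diff)
    qed
    fix w :: "int \<times> int"
    obtain k j where w: "w = (k, j)" by (cases w)
    have "{v \<in> ?V. f v = w} \<subseteq> {x \<in> {1..int n}. x mod int q = k} \<times> {x \<in> {1..int n}. x mod int q = j}"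
      by (auto simp: f_def w q(1))
    then have "card {v \<in> ?V. f v = w} \<le> card ({x \<in> {1..int n}. x mod int q = k} \<times> {x \<in> {1..int n}. x mod int q = j})"
      by (rule card_mono[rotated]) (intro finite_cartesian_product; rule finite_subset[of _ "{1..int n}"]; auto)
    also have "\<dots> \<le> (n div q) * (n div q)"
      unfolding card_cartesian_product by (intro mult_mono card_interval_mod q qn) auto
    finally have "real (card {v \<in> ?V. f v = w}) \<le> real ((n div q) * (n div q))" by (simp only: of_nat_le_iff)
    then show "real (card {v \<in> ?V. f v = w}) \<le> (real (n div q))\<^sup>2" by (simp add: power2_eq_square)
  qed
  also have "\<dots> \<le> real (4 * (nat p)\<^sup>2) * (real n / real q)\<^sup>2"
  proof (intro mult_mono power_mono)
    show "real (card ?R) \<le> real (4 * (nat p)\<^sup>2)"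
      using card_bad_steps[OF \<sigma> g Q] by (simp only: of_nat_le_iff)
    show "real (n div q) \<le> real n / real q" 
      using real_of_int_div4[of "int n" "int q"] by (simp flip: zdiv_int)
  qed auto
  also have "\<dots> = 4 / (real_of_int p)\<^sup>2 * (real n)\<^sup>2"
    using odd by (simp add: q_def power2_eq_square)
  finally show ?thesis .
qed

lemma not_square_dvd_221:
  fixes p :: int
  assumes "p > 1"
  shows "\<not> p\<^sup>2 dvd 221"
proof
  assume dvd: "p\<^sup>2 dvd 221"
  have "p < 15"
  proof (rule ccontr)
    assume "\<not> p < 15"
    then have "15\<^sup>2 \<le> p\<^sup>2" by (intro power_mono) auto
    then show False using zdvd_imp_le[OF dvd] by simp
  qed
  then have "p = 2 \<or> p = 3 \<or> p = 4 \<or> p = 5 \<or> p = 6 \<or> p = 7 \<or> p = 8 \<or> p = 9 \<or>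
    p = 10 \<or> p = 11 \<or> p = 12 \<or> p = 13 \<or> p = 14" using assms by presburger
  then show False using dvd by auto
qed

text \<open>The value $221 = 15^2 - 4$ belongs to the matrix \<open>step 1 2\<close> with $t = 15$.\<close>

lemma squarefree_criterion:
  fixes t :: int
  assumes small: "\<And>p. prime p \<Longrightarrow> p \<le> 32 \<Longrightarrow> [t = 15] (mod p\<^sup>2)"
    and large: "\<And>p \<sigma>. prime p \<Longrightarrow> p > 32 \<Longrightarrow> \<sigma> = 1 \<or> \<sigma> = -1 \<Longrightarrow> \<not> p\<^sup>2 dvd t - 2 * \<sigma>"
  shows "squarefree (t\<^sup>2 - 4)"
proof (rule ccontr)
  assume nsq: "\<not> squarefree (t\<^sup>2 - 4)"
  \<comment> \<open>Modulo 4 this excludes t = 2 and t = -2, where t^2 - 4 would vanish.\<close>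
  have "[t = 15] (mod 2\<^sup>2)" by (rule small) auto
  then have "t mod 4 = 3" by (simp add: cong_def)
  then have "t \<noteq> 2" "t \<noteq> -2" by auto
  then have "t\<^sup>2 - 4 \<noteq> 0" using power2_eq_iff[of t 2] by auto
  then obtain p where p: "prime p" "p\<^sup>2 dvd t\<^sup>2 - 4"
    using nsq squarefree_factorial_semiring[of "t\<^sup>2 - 4"] by auto
  have fact: "t\<^sup>2 - 4 = (t - 2 * 1) * (t - 2 * (-1))" by (simp add: power2_eq_square algebra_simps)
  show False
  proof (cases "p \<le> 32")
    case True
    have "[t\<^sup>2 - 4 = 15\<^sup>2 - 4] (mod p\<^sup>2)" using small[OF p(1) True] by (intro cong_diff cong_pow cong_refl)
    then have "p\<^sup>2 dvd 15\<^sup>2 - 4" using p(2) cong_dvd_iff by blast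
    then show False using not_square_dvd_221[of p] prime_gt_1_int[OF p(1)] by simp
  next
    case False
    \<comment> \<open>As t + 2 and t - 2 differ by 4, p cannot divide both, so p^2 divides one of
      them.\<close>
    have "\<not> p dvd 4" using False by (auto dest: zdvd_imp_le)
    have "\<not> (p dvd t - 2 * 1 \<and> p dvd t - 2 * (-1))"
    proof
      assume "p dvd t - 2 * 1 \<and> p dvd t - 2 * (-1)"
      then have "p dvd (t - 2 * (-1)) - (t - 2 * 1)" by (metis dvd_diff)
      then show False using \<open>\<not> p dvd 4\<close> by simp
    qed
    then have "coprime (p\<^sup>2) (t - 2 * 1) \<or> coprime (p\<^sup>2) (t - 2 * (-1))"
      using prime_imp_coprime[OF p(1)] by auto
    then have "p\<^sup>2 dvd t - 2 * 1 \<or> p\<^sup>2 dvd t - 2 * (-1)"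
      using p(2) unfolding fact by (metis coprime_dvd_mult_left_iff coprime_dvd_mult_right_iff)
    then show False using large[of p 1] large[of p "-1"] p(1) False by auto
  qed
qed

lemma tail_powr_sum:
  fixes e :: real
  assumes "e > 0"
  obtains n0 where "\<And>n. (\<Sum>m\<in>{n0<..n}. real m powr (-3/2)) \<le> e"
proof -
  have "summable (\<lambda>n. real n powr (-3/2))" by (subst summable_real_powr_iff) simp
  then obtain n0 where n0: "\<And>m n. m \<ge> n0 \<Longrightarrow> norm (sum (\<lambda>n. real n powr (-3/2)) {m..<n}) < e"
    using assms unfolding summable_Cauchy by blast
  have "(\<Sum>m\<in>{n0<..n}. real m powr (-3/2)) \<le> e" for n
  proof -
    have "{n0<..n} = {Suc n0..<Suc n}" by auto
    moreover have "norm (sum (\<lambda>n. real n powr (-3/2)) {Suc n0..<Suc n}) < e" by (rule n0) simp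
    ultimately show ?thesis by (simp only: real_norm_def)
  qed
  then show ?thesis by (rule that)
qed

text \<open>Serves as two moduli: with bounds 0 and 32 for the prescribed residue class, with 32 and
  \<open>n2\<close> for a common period of the conditions on the last two quotients.\<close>

definition prime_squares :: "nat \<Rightarrow> nat \<Rightarrow> nat" where
  "prime_squares m n = (\<Prod>p | prime p \<and> m < p \<and> p \<le> n. p\<^sup>2)"

lemma finite_primes: "finite {p :: nat. prime p \<and> m < p \<and> p \<le> n}"
  by (rule finite_subset[of _ "{..n}"]) auto

lemma prime_squares_pos: "prime_squares m n > 0"
  unfolding prime_squares_def by (intro prod_pos) (auto dest: prime_gt_0_nat)

lemma dvd_prime_squares:
  assumes "prime p" "m < p" "p \<le> n"
  shows "p\<^sup>2 dvd prime_squares m n"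
  unfolding prime_squares_def using assms finite_primes by (intro dvd_prodI) auto

lemma not_dvd_prime_squares:
  assumes "prime p" "n < p"
  shows "\<not> p dvd prime_squares m n"
proof
  assume "p dvd prime_squares m n"
  then obtain p' where p': "prime p'" "p' \<le> n" "p dvd p'\<^sup>2"
    unfolding prime_squares_def prime_dvd_prod_iff[OF finite_primes assms(1)] by blast
  then have "p dvd p'" using assms(1) prime_dvd_power by blast
  then have "p = p'" using assms(1) p'(1) primes_dvd_imp_eq by blast
  then show False using assms p' by simp
qed

lemma card_UN_bound:
  fixes b :: "'i \<Rightarrow> real"
  assumes "finite I" "\<And>i. i \<in> I \<Longrightarrow> real (card (X i)) \<le> b i"
  shows "real (card (\<Union>i\<in>I. X i)) \<le> sum b I"
proof -
  have "real (card (\<Union>i\<in>I. X i)) \<le> real (\<Sum>i\<in>I. card (X i))"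
    using card_UN_le[OF assms(1), of X] by (simp only: of_nat_le_iff)
  also have "\<dots> \<le> sum b I" unfolding of_nat_sum by (intro sum_mono assms(2))
  finally show ?thesis .
qed

text \<open>Each p contributes a proportion 4/p^2 for each of the two signs, and the sum of 8/p^2
  over p > 32 is at most 8/32 = 1/4. This is the origin of the threshold 32.\<close>

lemma card_bad_middle:
  fixes n2 :: nat
  assumes g: "dt g = 1" and n2: "n2 \<ge> 32"
  defines "Q1 \<equiv> int (prime_squares 0 32)" and "Q2 \<equiv> prime_squares 32 n2"
  shows "real (card {v \<in> {1..int Q2} \<times> {1..int Q2}. \<exists>p\<in>{p :: nat. prime p \<and> 32 < p \<and> p \<le> n2}. \<exists>\<sigma>\<in>{1, -1}.
      (int p)\<^sup>2 dvd tn (g \<odot> step (Q1 * fst v) (Q1 * snd v)) - 2 * \<sigma>})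
    \<le> 1/4 * real (card ({1..int Q2} \<times> {1..int Q2}))"
proof -
  define I where "I = {p :: nat. prime p \<and> 32 < p \<and> p \<le> n2}"
  have finI: "finite I" unfolding I_def by (rule finite_primes)
  define X where "X = (\<lambda>p \<sigma>. {v \<in> {1..int Q2} \<times> {1..int Q2}.
    (int p)\<^sup>2 dvd tn (g \<odot> step (Q1 * fst v) (Q1 * snd v)) - 2 * \<sigma>})"
  have X: "real (card (X p \<sigma>)) \<le> 4 / (real p)\<^sup>2 * (real Q2)\<^sup>2" if p: "p \<in> I" and \<sigma>: "\<sigma> = 1 \<or> \<sigma> = -1" for p \<sigma>
  proof -
    have pp: "prime p" "32 < p" "p \<le> n2" using p by (auto simp: I_def)
    interpret odd_prime "int p" by unfold_locales (use pp in auto)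
    have "\<not> int p dvd Q1" unfolding Q1_def int_dvd_int_iff using pp by (intro not_dvd_prime_squares) auto
    moreover have "(int p)\<^sup>2 dvd int Q2"
      unfolding Q2_def of_nat_power[symmetric] int_dvd_int_iff using pp by (intro dvd_prime_squares) auto
    ultimately show ?thesis unfolding X_def using card_bad_steps_interval[OF \<sigma> g, of Q1 Q2] by simp
  qed
  have "{v \<in> {1..int Q2} \<times> {1..int Q2}. \<exists>p\<in>{p :: nat. prime p \<and> 32 < p \<and> p \<le> n2}. \<exists>\<sigma>\<in>{1, -1}.
      (int p)\<^sup>2 dvd tn (g \<odot> step (Q1 * fst v) (Q1 * snd v)) - 2 * \<sigma>} = (\<Union>p\<in>I. X p 1 \<union> X p (-1))"
    unfolding I_def X_def by blast
  also have "real (card \<dots>) \<le> (\<Sum>p\<in>I. 8 * (real Q2)\<^sup>2 * (1 / (real p)\<^sup>2))"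
  proof (rule card_UN_bound[OF finI])
    fix p assume p: "p \<in> I"
    have "real (card (X p 1 \<union> X p (-1))) \<le> real (card (X p 1) + card (X p (-1)))"
      unfolding of_nat_le_iff by (rule card_Un_le)
    also have "\<dots> \<le> 4 / (real p)\<^sup>2 * (real Q2)\<^sup>2 + 4 / (real p)\<^sup>2 * (real Q2)\<^sup>2"
      using X[OF p] unfolding of_nat_add by (intro add_mono) auto
    also have "\<dots> = 8 * (real Q2)\<^sup>2 * (1 / (real p)\<^sup>2)" by simp
    finally show "real (card (X p 1 \<union> X p (-1))) \<le> 8 * (real Q2)\<^sup>2 * (1 / (real p)\<^sup>2)" .
  qed
  also have "\<dots> = 8 * (real Q2)\<^sup>2 * (\<Sum>p\<in>I. 1 / (real p)\<^sup>2)" by (simp add: sum_distrib_left)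
  also have "\<dots> \<le> 8 * (real Q2)\<^sup>2 * (\<Sum>p\<in>{32<..n2}. 1 / (real p)\<^sup>2)"
    by (intro mult_left_mono sum_mono2) (auto simp: I_def)
  also have "\<dots> \<le> 8 * (real Q2)\<^sup>2 * (1 / real 32)"
    by (intro mult_left_mono sum_inverse_squares) auto
  also have "\<dots> = 1/4 * real (card ({1..int Q2} \<times> {1..int Q2}))"
    by (simp add: card_cartesian_product power2_eq_square)
  finally show ?thesis .
qed

text \<open>The order of choices avoids a circle: \<open>A0\<close>, \<open>K\<close> and
  \<open>R0\<close> come from \<open>sparse_family\<close>, then come the thresholds
  \<open>n0\<close> and \<open>n2\<close>, and only then the larger bound \<open>A\<close>, needed
  for the factor \<open>Z\<close> at the end of each product. Three ranges of primes spoil at most a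
  quarter of the matrices each, so a quarter is left.\<close>

lemma many_squarefree:
  fixes \<eta> :: real
  assumes \<eta>: "0 < \<eta>" "\<eta> \<le> 1/64"
  obtains A :: nat and c :: real where "A \<ge> 1" "c > 0"
    "eventually (\<lambda>N. \<exists>G. finite G \<and>
      (\<forall>h\<in>G. (\<exists>g\<in>sg A. \<exists>x\<in>{1..int A}. \<exists>y\<in>{1..int A}. h = g \<odot> step x y) \<and>
        real_of_int (tn h) < N\<^sup>2 \<and> squarefree ((tn h)\<^sup>2 - 4)) \<and>
      real (card G) \<ge> c * N powr (2 - \<eta>)) at_top"
proof -
  obtain A0 :: nat and K R0 :: real where K: "K \<ge> 1" and R0: "R0 \<ge> 2" and
    family: "\<forall>R\<ge>R0. \<exists>T. finite T \<and> T \<subseteq> sg A0 \<and> (\<forall>g\<in>T. 2 * real_of_int (a11 g) \<le> R) \<and>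
      real (card T) \<ge> R powr (2 - \<eta>) \<and>
      (\<forall>p. prime p \<longrightarrow> R0 < real_of_int p \<longrightarrow> real_of_int p \<le> R powr (1/16) \<longrightarrow> sparse_at K p T)"
    by (rule sparse_family[OF \<eta>]) blast
  have e: "0 < (1/128 :: real)" "(1/128 :: real) \<le> 1" by simp_all
  obtain C :: real where C: "C \<ge> 1" and
    large: "\<forall>X\<ge>1. \<forall>z\<ge>1. real (card {g. dt g = 1 \<and> 2 < tn g \<and> real_of_int (tn g) \<le> X \<and>
        (\<exists>\<sigma>\<in>{1, -1}. \<exists>m > z. (int m)\<^sup>2 dvd tn g - 2 * \<sigma>)}) \<le> C * X powr (1 + 1/128) / real z"
    by (rule card_large_square_divisors[OF e]) blast
  define Q1 where "Q1 = int (prime_squares 0 32)"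
  have Q1: "Q1 > 0" using prime_squares_pos by (simp add: Q1_def)
  define k1 where "k1 = real (card (residues4 Q1))"
  have "residues4 Q1 \<noteq> {}" using rd_in_residues4[OF Q1] by blast
  then have k1: "k1 \<ge> 1" using finite_residues4[of Q1] by (simp add: k1_def Suc_le_eq card_gt_0_iff)
  \<comment> \<open>In 1 / (8 K k1) a factor 2 accounts for the two signs, \<open>k1\<close> for the
    loss in passing from T to one residue class, and the remaining 4 for the quarter that may be
    spoiled.\<close>
  obtain n0 where n0: "\<And>n. (\<Sum>m\<in>{n0<..n}. real m powr (-3/2)) \<le> 1 / (8 * K * k1)"
    using tail_powr_sum[of "1 / (8 * K * k1)"] K k1 by (metis mult_pos_pos less_le_trans zero_less_one zero_less_divide_1_iff zero_less_numeral)
  define n2 where "n2 = max (max n0 32) (nat \<lceil>R0\<rceil>)"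
  have n2: "n2 \<ge> 32" "n2 \<ge> n0" "real n2 \<ge> R0" unfolding n2_def by (simp, simp, linarith)
  define Q2 where "Q2 = prime_squares 32 n2"
  have Q2: "Q2 > 0" by (simp add: Q2_def prime_squares_pos)
  \<comment> \<open>Room for the quotients of T, for \<open>step 1 2\<close>, and for the last two
    quotients, which are at most Q1 Q2.\<close>
  define A where "A = max (max A0 2) (nat Q1 * Q2)"
  have A: "A0 \<le> A" "2 \<le> A" "Q1 * int Q2 \<le> int A"
    using Q1 by (simp_all add: A_def nat_le_iff of_nat_max)
  have w0: "step 1 2 \<in> sg A" using sg.step[OF sg.id2, of 1 A 2] A by simp
  obtain wf cw where wf: "\<And>g. g \<in> sg A \<Longrightarrow> wf (rd Q1 g) \<in> sg A \<and> rd Q1 (g \<odot> wf (rd Q1 g)) = rd Q1 (step 1 2)"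
    and cw: "\<And>g. g \<in> sg A \<Longrightarrow> a11 (wf (rd Q1 g)) \<le> cw"
  proof (rule correction_mod[OF Q1 w0])
    fix wf c
    assume *: "\<And>g. g \<in> sg A \<Longrightarrow> wf (rd Q1 g) \<in> sg A \<and> rd Q1 (g \<odot> wf (rd Q1 g)) = rd Q1 (step 1 2)"
      "\<And>g. g \<in> sg A \<Longrightarrow> a11 (wf (rd Q1 g)) \<le> c"
    show thesis by (rule that[OF *])
  qed
  have "a11 (wf (rd Q1 id2)) \<ge> 1" using wf[OF sg.id2] a11_pos by blast
  then have cw1: "cw \<ge> 1" using cw[OF sg.id2] by linarith
  define c1 where "c1 = 2 * cw * ((Q1 * int Q2)\<^sup>2 + 1)"
  have c1: "c1 \<ge> 1"
  proof -
    have "1 * 1 \<le> cw * ((Q1 * int Q2)\<^sup>2 + 1)" using cw1 by (intro mult_mono) auto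
    then show ?thesis unfolding c1_def by linarith
  qed
  \<comment> \<open>Chosen so that \<open>2 * a11\<close> of a full product is at most c0 R / 2 = N
    / 2.\<close>
  define c0 where "c0 = 4 * real_of_int c1"
  have c0: "c0 \<ge> 4" using c1 by (simp add: c0_def)
  define c where "c = 1 / (4 * k1 * c0 powr (2 - \<eta>))"
  have cpos: "c > 0" using k1 c0 by (simp add: c_def)
  define good where "good = (\<lambda>N G. finite G \<and>
      (\<forall>h\<in>G. (\<exists>g\<in>sg A. \<exists>x\<in>{1..int A}. \<exists>y\<in>{1..int A}. h = g \<odot> step x y) \<and>
        real_of_int (tn h) < N\<^sup>2 \<and> squarefree ((tn h)\<^sup>2 - 4)) \<and>
      real (card G) \<ge> c * N powr (2 - \<eta>))"
  have main: "\<exists>G. good N G" if N1: "N \<ge> c0 * R0" and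
    Nbig: "2 * C * (N\<^sup>2) powr (1 + 1/128) / (N / c0) powr (1/16) \<le> (N / c0) powr (2 - \<eta>) / (4 * k1)" for N
  proof -
    define R where "R = N / c0"
    have R: "R \<ge> R0" using N1 c0 by (simp add: R_def field_simps)
    have "c0 * R0 > 0" using c0 R0 by simp
    then have N0: "N > 0" using N1 by linarith
    have NR: "N = c0 * R" using c0 by (simp add: R_def)
    obtain T where finT: "finite T" and Tsg: "T \<subseteq> sg A0" and Ta: "\<forall>g\<in>T. 2 * real_of_int (a11 g) \<le> R"
      and cT: "real (card T) \<ge> R powr (2 - \<eta>)"
      and Tp: "\<forall>p. prime p \<longrightarrow> R0 < real_of_int p \<longrightarrow> real_of_int p \<le> R powr (1/16) \<longrightarrow> sparse_at K p T"
      using family[THEN spec, THEN mp, OF R] by (elim exE conjE) (rule that)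
    have TsgA: "g \<in> sg A" if "g \<in> T" for g using that Tsg sg_mono A(1) by blast
    obtain r where r: "r \<in> residues4 Q1" "real (card T) \<le> k1 * real (card {g \<in> T. rd Q1 g = r})"
      using exists_large_fibre[OF finT finite_residues4 \<open>residues4 Q1 \<noteq> {}\<close>, of "rd Q1"] rd_in_residues4[OF Q1]
      unfolding k1_def by blast
    define T' where "T' = {g \<in> T. rd Q1 g = r}"
    have T': "finite T'" "T' \<subseteq> T" "real (card T) \<le> k1 * real (card T')" using finT r by (auto simp: T'_def)
    have "R powr (2 - \<eta>) > 0" using R R0 by simp
    then have cTpos: "real (card T) > 0" using cT by linarith
    have "T' \<noteq> {}" using T'(3) cTpos by auto
    define w where "w = wf r"
    have w: "w \<in> sg A" "\<And>g. g \<in> T' \<Longrightarrow> rd Q1 (g \<odot> w) = rd Q1 (step 1 2)" "a11 w \<le> cw"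
    proof -
      obtain g where g: "g \<in> T'" using \<open>T' \<noteq> {}\<close> by blast
      then have "g \<in> sg A" "rd Q1 g = r" using TsgA by (auto simp: T'_def)
      then show "w \<in> sg A" "a11 w \<le> cw" using wf cw unfolding w_def by blast+
      show "rd Q1 (g' \<odot> w) = rd Q1 (step 1 2)" if "g' \<in> T'" for g'
      proof -
        have "g' \<in> sg A" "rd Q1 g' = r" using TsgA that by (auto simp: T'_def)
        then show ?thesis using wf unfolding w_def by blast
      qed
    qed
    define Q where "Q = (\<lambda>v g. \<exists>p\<in>{p :: nat. prime p \<and> 32 < p \<and> p \<le> n2}. \<exists>\<sigma>\<in>{1, -1}.
      (int p)\<^sup>2 dvd tn ((g \<odot> w) \<odot> step (Q1 * fst v) (Q1 * snd v)) - 2 * \<sigma>)"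
    have "\<exists>v\<in>{1..int Q2} \<times> {1..int Q2}. real (card {g \<in> T'. Q v g}) \<le> 1/4 * real (card T')"
    proof (rule exists_sparse_slice[OF _ _ T'(1)])
      show "{1..int Q2} \<times> {1..int Q2} \<noteq> {}" using Q2 by simp
      fix g assume "g \<in> T'"
      then have "g \<in> sg A" using TsgA T'(2) by blast
      then have "dt (g \<odot> w) = 1" using w(1) by (simp add: dt_sg)
      then show "real (card {v \<in> {1..int Q2} \<times> {1..int Q2}. Q v g}) \<le> 1/4 * real (card ({1..int Q2} \<times> {1..int Q2}))"
        using card_bad_middle[OF _ n2(1)] unfolding Q_def Q1_def Q2_def by blast
    qed simp
    then obtain v where v: "v \<in> {1..int Q2} \<times> {1..int Q2}" and mid: "real (card {g \<in> T'. Q v g}) \<le> 1/4 * real (card T')"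
      by blast
    \<comment> \<open>Multiples of Q1, so that \<open>step x y\<close> is the identity modulo Q1 and
      leaves the residue class produced by \<open>w\<close> unchanged.\<close>
    define x where "x = Q1 * fst v"
    define y where "y = Q1 * snd v"
    have vb: "1 \<le> fst v" "fst v \<le> int Q2" "1 \<le> snd v" "snd v \<le> int Q2" using v by (auto simp: mem_Times_iff)
    have xy: "1 \<le> x" "x \<le> Q1 * int Q2" "1 \<le> y" "y \<le> Q1 * int Q2"
      using vb Q1 mult_mono[of 1 Q1 1 "fst v"] mult_mono[of 1 Q1 1 "snd v"] by (auto simp: x_def y_def)
    then have xyA: "x \<in> {1..int A}" "y \<in> {1..int A}" using A(3) by auto
    define Z where "Z = w \<odot> step x y"
    have Zsg: "Z \<in> sg A" unfolding Z_def by (rule sg.step[OF w(1) xyA])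
    then have dtZ: "dt Z = 1" by (rule dt_sg)
    have inj: "inj_on (\<lambda>g. g \<odot> Z) X" for X
    proof (rule inj_onI)
      fix g h assume "g \<odot> Z = h \<odot> Z"
      then have "g \<odot> Z \<odot> adj Z = h \<odot> Z \<odot> adj Z" by simp
      then show "g = h" using adj_mm(2)[OF dtZ] by (simp add: mm_assoc)
    qed
    have Za: "a11 Z \<le> c1"
    proof -
      have st: "step x y \<in> sg A" using sg.step[OF sg.id2 xyA] by simp
      have "x * y \<le> (Q1 * int Q2) * (Q1 * int Q2)" using xy by (intro mult_mono) auto
      then have "a11 (step x y) \<le> (Q1 * int Q2)\<^sup>2 + 1" by (simp add: step_def power2_eq_square)
      moreover have "a11 Z \<le> 2 * a11 w * a11 (step x y)" unfolding Z_def by (rule a11_mm_le[OF w(1) st])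
      moreover have "2 * a11 w * a11 (step x y) \<le> 2 * cw * ((Q1 * int Q2)\<^sup>2 + 1)"
        using calculation(1) w(3) a11_pos[OF w(1)] a11_pos[OF st] by (intro mult_mono) auto
      ultimately show ?thesis unfolding c1_def by linarith
    qed
    have tnN: "real_of_int (tn (g \<odot> Z)) < N\<^sup>2" if g: "g \<in> T" for g
    proof -
      have gsg: "g \<in> sg A" using TsgA g by blast
      have gZ: "g \<odot> Z \<in> sg A" using sg_mm[OF Zsg gsg] .
      have "a11 (g \<odot> Z) \<le> 2 * a11 g * a11 Z" by (rule a11_mm_le[OF gsg Zsg])
      also have "\<dots> \<le> 2 * a11 g * c1" using Za a11_pos[OF gsg] by (intro mult_left_mono) auto
      finally have "real_of_int (2 * a11 (g \<odot> Z)) \<le> real_of_int (2 * (2 * a11 g * c1))"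
        by (simp only: of_int_le_iff)
      also have "\<dots> = (2 * real_of_int (a11 g)) * (2 * real_of_int c1)" by simp
      also have "\<dots> \<le> R * (2 * real_of_int c1)" using Ta g c1 by (intro mult_right_mono) auto
      also have "\<dots> = N / 2" by (simp add: NR c0_def)
      finally have le: "real_of_int (2 * a11 (g \<odot> Z)) \<le> N / 2" .
      have "real_of_int (tn (g \<odot> Z)) \<le> real_of_int ((2 * a11 (g \<odot> Z))\<^sup>2)"
        using tn_le[OF gZ] by (simp only: of_int_le_iff)
      also have "\<dots> = (real_of_int (2 * a11 (g \<odot> Z)))\<^sup>2" by (rule of_int_power)
      also have "\<dots> \<le> (N / 2)\<^sup>2" using le a11_pos[OF gZ] by (intro power_mono) auto
      also have "\<dots> < N\<^sup>2" using N0 by (simp add: power_divide)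
      finally show ?thesis .
    qed
    have tn15: "[tn (g \<odot> Z) = 15] (mod (int p)\<^sup>2)" if g: "g \<in> T'" and p: "prime p" "p \<le> 32" for g and p :: nat
    proof -
      have "(int p)\<^sup>2 dvd Q1"
        unfolding Q1_def of_nat_power[symmetric] int_dvd_int_iff using p prime_gt_0_nat by (intro dvd_prime_squares) auto
      moreover have "rd Q1 (step x y) = rd Q1 id2"
        by (simp add: step_def rd_id2_iff x_def y_def mult.assoc del: rd.simps)
      then have "rd Q1 ((g \<odot> w) \<odot> step x y) = rd Q1 (step 1 2 \<odot> id2)"
        using w(2)[OF g] by (intro rd_cong) auto
      then have "rd Q1 (g \<odot> Z) = rd Q1 (step 1 2)" by (simp add: Z_def mm_assoc)
      then have "[tn (g \<odot> Z) = tn (step 1 2)] (mod Q1)" by (rule tn_cong)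
      moreover have "tn (step 1 2) = 15" by (simp add: step_def)
      ultimately show ?thesis using cong_dvd_modulus by metis
    qed
    \<comment> \<open>The value 2, to which the count by norms does not apply, is excluded by the
      residue 3 modulo 4.\<close>
    have tn2: "2 < tn (g \<odot> Z)" if g: "g \<in> T'" for g
    proof -
      have "g \<in> sg A" using TsgA T'(2) g by blast
      then have "dt (g \<odot> Z) = 1" using dtZ by (simp add: dt_sg)
      have "tn h \<ge> 2 * dt h" for h
      proof (cases h)
        case (fields a b c d)
        have "tn h - 2 * dt h = (a - d)\<^sup>2 + (b + c)\<^sup>2"
          by (simp add: fields power2_eq_square algebra_simps)
        then show ?thesis using zero_le_power2[of "a - d"] zero_le_power2[of "b + c"] by linarith
      qed
      from this[of "g \<odot> Z"] have "tn (g \<odot> Z) \<ge> 2" using \<open>dt (g \<odot> Z) = 1\<close> by simp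
      moreover have "[tn (g \<odot> Z) = 15] (mod (int 2)\<^sup>2)" by (rule tn15[OF g]) auto
      then have "tn (g \<odot> Z) mod 4 = 3" by (simp add: cong_def)
      then have "tn (g \<odot> Z) \<noteq> 2" by auto
      ultimately show ?thesis by linarith
    qed
    define z where "z = nat \<lfloor>R powr (1/16)\<rfloor>"
    have R1: "R powr (1/16) \<ge> 1" using R R0 by (intro ge_one_powr_ge_zero) auto
    have z: "z \<ge> 1" "real z \<le> R powr (1/16)" "R powr (1/16) \<le> 2 * real z"
    proof -
      have zr: "real z = real_of_int \<lfloor>R powr (1/16)\<rfloor>" using R1 by (simp add: z_def)
      have fl: "real_of_int \<lfloor>R powr (1/16)\<rfloor> \<ge> 1" using R1 by simp
      then show "z \<ge> 1" using zr by linarith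
      show "real z \<le> R powr (1/16)" unfolding zr by (rule of_int_floor_le)
      show "R powr (1/16) \<le> 2 * real z"
        using fl floor_correct[of "R powr (1/16)"] unfolding zr by linarith
    qed
    define B1 where "B1 = {g \<in> T'. Q v g}"
    \<comment> \<open>Counted in the whole of T, because \<open>sparse_at\<close> gives no
      information on the subset T'; the loss \<open>k1\<close> is covered by the choice of
      \<open>n0\<close>.\<close>
    define B2 where "B2 = (\<Union>p\<in>{p :: nat. prime p \<and> n2 < p \<and> p \<le> z}.
      {g \<in> T. (int p)\<^sup>2 dvd tn (g \<odot> Z) - 2 * 1} \<union> {g \<in> T. (int p)\<^sup>2 dvd tn (g \<odot> Z) - 2 * (-1)})"
    define B3 where "B3 = {g \<in> T'. \<exists>\<sigma>\<in>{1, -1}. \<exists>m > z. (int m)\<^sup>2 dvd tn (g \<odot> Z) - 2 * \<sigma>}"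
    have b1: "real (card B1) \<le> 1/4 * real (card T')" using mid by (simp add: B1_def)
    have b2: "real (card B2) \<le> 1/4 * real (card T')"
    proof -
      have "real (card B2) \<le> (\<Sum>p\<in>{p :: nat. prime p \<and> n2 < p \<and> p \<le> z}. 2 * K * real (card T) * real p powr (-3/2))"
        unfolding B2_def
      proof (rule card_UN_bound[OF finite_primes])
        fix p assume "p \<in> {p :: nat. prime p \<and> n2 < p \<and> p \<le> z}"
        then have p: "prime p" "n2 < p" "p \<le> z" by auto
        have "R0 < real_of_int (int p)" using p(2) n2(3) by simp
        moreover have "real_of_int (int p) \<le> R powr (1/16)" using p(3) z(2) by simp
        ultimately have sp: "sparse_at K (int p) T" using Tp p(1) by simp
        have one: "real (card {g \<in> T. (int p)\<^sup>2 dvd tn (g \<odot> Z) - 2 * \<sigma>}) \<le> K * real p powr (-3/2) * real (card T)"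
          if "\<sigma> \<in> {1, -1}" for \<sigma>
        proof -
          have "real (card {g \<in> T. (int p)\<^sup>2 dvd tn (id2 \<odot> g \<odot> Z) - 2 * \<sigma>}) \<le> K * real_of_int (int p) powr (-3/2) * real (card T)"
            using sp that dt_id2 dtZ unfolding sparse_at_def by blast
          then show ?thesis by simp
        qed
        have "card ({g \<in> T. (int p)\<^sup>2 dvd tn (g \<odot> Z) - 2 * 1} \<union> {g \<in> T. (int p)\<^sup>2 dvd tn (g \<odot> Z) - 2 * (-1)})
          \<le> card {g \<in> T. (int p)\<^sup>2 dvd tn (g \<odot> Z) - 2 * 1} + card {g \<in> T. (int p)\<^sup>2 dvd tn (g \<odot> Z) - 2 * (-1)}"
          by (rule card_Un_le)
        then have "real (card ({g \<in> T. (int p)\<^sup>2 dvd tn (g \<odot> Z) - 2 * 1} \<union> {g \<in> T. (int p)\<^sup>2 dvd tn (g \<odot> Z) - 2 * (-1)}))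
          \<le> real (card {g \<in> T. (int p)\<^sup>2 dvd tn (g \<odot> Z) - 2 * 1}) + real (card {g \<in> T. (int p)\<^sup>2 dvd tn (g \<odot> Z) - 2 * (-1)})"
          unfolding of_nat_add[symmetric] of_nat_le_iff .
        also have "\<dots> \<le> K * real p powr (-3/2) * real (card T) + K * real p powr (-3/2) * real (card T)"
          by (intro add_mono one) auto
        also have "\<dots> = 2 * K * real (card T) * real p powr (-3/2)" by simp
        finally show "real (card ({g \<in> T. (int p)\<^sup>2 dvd tn (g \<odot> Z) - 2 * 1} \<union> {g \<in> T. (int p)\<^sup>2 dvd tn (g \<odot> Z) - 2 * (-1)}))
          \<le> 2 * K * real (card T) * real p powr (-3/2)" .
      qed
      also have "\<dots> = 2 * K * real (card T) * (\<Sum>p\<in>{p :: nat. prime p \<and> n2 < p \<and> p \<le> z}. real p powr (-3/2))"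
        by (simp only: sum_distrib_left)
      also have "\<dots> \<le> 2 * K * real (card T) * (\<Sum>p\<in>{n0<..z}. real p powr (-3/2))"
        using K n2(2) by (intro mult_left_mono sum_mono2) auto
      also have "\<dots> \<le> 2 * K * real (card T) * (1 / (8 * K * k1))"
        using K by (intro mult_left_mono n0) auto
      also have "\<dots> = real (card T) / (4 * k1)" using K by simp
      also have "\<dots> \<le> (k1 * real (card T')) / (4 * k1)" using T'(3) k1 by (intro divide_right_mono) auto
      also have "\<dots> = 1/4 * real (card T')" using k1 by simp
      finally show ?thesis .
    qed
    have b3: "real (card B3) \<le> 1/4 * real (card T')"
    proof -
      let ?L = "{g. dt g = 1 \<and> 2 < tn g \<and> real_of_int (tn g) \<le> N\<^sup>2 \<and>
        (\<exists>\<sigma>\<in>{1, -1}. \<exists>m > z. (int m)\<^sup>2 dvd tn g - 2 * \<sigma>)}"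
      have img: "(\<lambda>g. g \<odot> Z) ` B3 \<subseteq> ?L"
      proof
        fix h assume "h \<in> (\<lambda>g. g \<odot> Z) ` B3"
        then obtain g where g: "g \<in> T'" "h = g \<odot> Z" "\<exists>\<sigma>\<in>{1, -1}. \<exists>m > z. (int m)\<^sup>2 dvd tn (g \<odot> Z) - 2 * \<sigma>"
          unfolding B3_def by blast
        have "g \<in> T" using g(1) T'(2) by blast
        then have "dt h = 1" using dt_sg[OF TsgA[OF \<open>g \<in> T\<close>]] dtZ by (simp add: g(2))
        then show "h \<in> ?L" using tn2[OF g(1)] tnN[OF \<open>g \<in> T\<close>] g by simp
      qed
      have "finite ?L"
      proof (rule finite_subset)
        show "?L \<subseteq> (\<Union>t\<in>{3..\<lfloor>N\<^sup>2\<rfloor>}. {g. dt g = 1 \<and> tn g = t})" by (auto simp: le_floor_iff)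
        obtain C' :: real where "C' \<ge> 1" "\<forall>n :: int. n > 0 \<longrightarrow> real (card {(x, y :: int). x\<^sup>2 + y\<^sup>2 = n}) \<le> C' * real_of_int n powr 1"
          by (rule two_squares_bound[of 1]) auto
        then show "finite (\<Union>t\<in>{3..\<lfloor>N\<^sup>2\<rfloor>}. {g. dt g = 1 \<and> tn g = t})"
          by (intro finite_UN_I) (auto intro!: card_norm_level(1)[of 1 C'])
      qed
      then have "card B3 \<le> card ?L" by (rule card_inj_on_le[OF inj img])
      then have "real (card B3) \<le> real (card ?L)" by (simp only: of_nat_le_iff)
      also have "\<dots> \<le> C * (N\<^sup>2) powr (1 + 1/128) / real z"
      proof -
        have "N \<ge> 1" using N1 c0 R0 mult_mono[of 4 c0 2 R0] by simp
        then have "N\<^sup>2 \<ge> 1" by (rule one_le_power)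
        then show ?thesis using large z(1) by blast
      qed
      also have "\<dots> \<le> C * (N\<^sup>2) powr (1 + 1/128) / (R powr (1/16) / 2)"
      proof (rule divide_left_mono)
        show "R powr (1/16) / 2 \<le> real z" using z(3) by simp
        show "0 \<le> C * (N\<^sup>2) powr (1 + 1/128)" using C by simp
        have "R powr (1/16) / 2 > 0" "real z > 0" using R1 z(1) by (linarith, simp)
        then show "0 < real z * (R powr (1/16) / 2)" by (rule mult_pos_pos[rotated])
      qed
      also have "\<dots> = 2 * C * (N\<^sup>2) powr (1 + 1/128) / R powr (1/16)" by simp
      also have "\<dots> \<le> R powr (2 - \<eta>) / (4 * k1)" using Nbig unfolding R_def .
      also have "\<dots> \<le> (k1 * real (card T')) / (4 * k1)"
        using cT T'(3) k1 by (intro divide_right_mono) auto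
      also have "\<dots> = 1/4 * real (card T')" using k1 by simp
      finally show ?thesis .
    qed
    define G where "G = (\<lambda>g. g \<odot> Z) ` (T' - (B1 \<union> B2 \<union> B3))"
    have "good N G"
      unfolding good_def
    proof (intro conjI ballI)
      show "finite G" using T'(1) by (simp add: G_def)
      have finB: "finite (B1 \<union> B2 \<union> B3)"
        using finT T'(1) finite_primes unfolding B1_def B2_def B3_def by auto
      have "card T' \<le> card (T' - (B1 \<union> B2 \<union> B3)) + card (B1 \<union> B2 \<union> B3)"
        by (metis diff_card_le_card_Diff finB le_diff_conv)
      also have "card (B1 \<union> B2 \<union> B3) \<le> card B1 + card B2 + card B3"
        by (meson card_Un_le add_le_mono1 order_trans)
      also have "card (T' - (B1 \<union> B2 \<union> B3)) = card G" unfolding G_def by (rule card_image[OF inj, symmetric])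
      finally have "real (card T') \<le> real (card G + (card B1 + card B2 + card B3))"
        by (simp only: of_nat_le_iff)
      then have "real (card T') / 4 \<le> real (card G)" using b1 b2 b3 by simp
      moreover have "R powr (2 - \<eta>) / (4 * k1) \<le> (k1 * real (card T')) / (4 * k1)"
        using cT T'(3) k1 by (intro divide_right_mono) auto
      moreover have "(k1 * real (card T')) / (4 * k1) = real (card T') / 4" using k1 by simp
      moreover have "c * N powr (2 - \<eta>) = R powr (2 - \<eta>) / (4 * k1)"
        using c0 N0 by (simp add: c_def R_def powr_divide)
      ultimately show "c * N powr (2 - \<eta>) \<le> real (card G)" by linarith
      fix h assume "h \<in> G"
      then obtain g where g: "g \<in> T'" "g \<notin> B1" "g \<notin> B2" "g \<notin> B3" "h = g \<odot> Z" unfolding G_def by blast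
      have gT: "g \<in> T" using g(1) T'(2) by blast
      have "h = (g \<odot> w) \<odot> step x y" by (simp add: g(5) Z_def mm_assoc)
      moreover have "g \<odot> w \<in> sg A" using sg_mm[OF w(1) TsgA[OF gT]] .
      ultimately show "\<exists>g\<in>sg A. \<exists>x\<in>{1..int A}. \<exists>y\<in>{1..int A}. h = g \<odot> step x y" using xyA by blast
      show "real_of_int (tn h) < N\<^sup>2" unfolding g(5) by (rule tnN[OF gT])
      show "squarefree ((tn h)\<^sup>2 - 4)"
      proof (rule squarefree_criterion)
        fix p :: int assume p: "prime p" "p \<le> 32"
        then have "prime (nat p)" "nat p \<le> 32" "int (nat p) = p" using prime_gt_0_int[of p] by auto
        then show "[tn h = 15] (mod p\<^sup>2)" using tn15[OF g(1), of "nat p"] unfolding g(5) by simp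
      next
        fix p \<sigma> :: int assume p: "prime p" "p > 32" and \<sigma>: "\<sigma> = 1 \<or> \<sigma> = -1"
        define m where "m = nat p"
        have m: "prime m" "m > 32" "int m = p" using p by (auto simp: m_def)
        show "\<not> p\<^sup>2 dvd tn h - 2 * \<sigma>"
        proof
          assume dvd: "p\<^sup>2 dvd tn h - 2 * \<sigma>"
          have dvd': "(int m)\<^sup>2 dvd tn (g \<odot> Z) - 2 * \<sigma>" using dvd unfolding m(3) g(5) .
          consider "m \<le> n2" | "n2 < m" "m \<le> z" | "z < m" by linarith
          then show False
          proof cases
            case 1
            have "g \<odot> Z = (g \<odot> w) \<odot> step (Q1 * fst v) (Q1 * snd v)" by (simp add: Z_def mm_assoc x_def y_def)
            then have "(int m)\<^sup>2 dvd tn ((g \<odot> w) \<odot> step (Q1 * fst v) (Q1 * snd v)) - 2 * \<sigma>" using dvd' by (simp only:)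
            then have "Q v g" unfolding Q_def using 1 m(1,2) \<sigma> by blast
            then show False using g(1,2) by (simp add: B1_def)
          next
            case 2
            then show False using g(3) gT dvd' m(1) \<sigma> unfolding B2_def by blast
          next
            case 3
            then show False using g(1,4) dvd' \<sigma> unfolding B3_def by blast
          qed
        qed
      qed
    qed
    then show ?thesis by blast
  qed
  \<comment> \<open>The left side has order N^(2 + 1/64 - 1/16). Since \<eta> <= 1/64, it is smaller
    than N^(2 - \<eta>) by a factor of at least N^(1/32), which eventually exceeds the
    constants.\<close>
  have ev: "eventually (\<lambda>N. 2 * C * (N\<^sup>2) powr (1 + 1/128) / (N / c0) powr (1/16) \<le> (N / c0) powr (2 - \<eta>) / (4 * k1)) at_top"
  proof -
    have "eventually (\<lambda>N. N powr (1/32) \<ge> 8 * C * k1 * c0 powr 3) at_top"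
      by real_asymp
    then show ?thesis using eventually_ge_at_top[of 1]
    proof eventually_elim
      case (elim N)
      have cc: "c0 powr (1/16) * c0 powr (2 - \<eta>) \<le> c0 powr 3"
        using c0 \<eta> unfolding powr_add[symmetric] by (intro powr_mono) auto
      have "(N\<^sup>2) powr (1 + 1/128) = N powr (2 + 1/64)"
      proof -
        have "N\<^sup>2 = N powr 2" using elim by simp
        then show ?thesis by (simp only: powr_powr) simp
      qed
      then have "8 * C * k1 * (N\<^sup>2) powr (1 + 1/128) * (c0 powr (1/16) * c0 powr (2 - \<eta>))
        \<le> 8 * C * k1 * N powr (2 + 1/64) * c0 powr 3"
        using cc C k1 by (intro mult_mono) auto
      also have "\<dots> = (8 * C * k1 * c0 powr 3) * N powr (2 + 1/64)" by simp
      also have "\<dots> \<le> N powr (1/32) * N powr (2 + 1/64)" using elim by (intro mult_right_mono) auto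
      also have "\<dots> = N powr (2 + 3/64)" by (simp flip: powr_add)
      also have "\<dots> \<le> N powr (2 - \<eta> + 1/16)" using elim \<eta> by (intro powr_mono) auto
      also have "\<dots> = N powr (1/16) * N powr (2 - \<eta>)" by (simp add: add.commute flip: powr_add)
      finally have "8 * C * k1 * (N\<^sup>2) powr (1 + 1/128) * (c0 powr (1/16) * c0 powr (2 - \<eta>)) \<le> N powr (1/16) * N powr (2 - \<eta>)" .
      then show ?case using elim c0 k1 C by (simp add: powr_divide field_simps)
    qed
  qed
  show ?thesis
  proof (rule that[of A c])
    show "A \<ge> 1" "c > 0" using A(2) cpos by auto
    show "eventually (\<lambda>N. \<exists>G. finite G \<and>
      (\<forall>h\<in>G. (\<exists>g\<in>sg A. \<exists>x\<in>{1..int A}. \<exists>y\<in>{1..int A}. h = g \<odot> step x y) \<and>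
        real_of_int (tn h) < N\<^sup>2 \<and> squarefree ((tn h)\<^sup>2 - 4)) \<and>
      real (card G) \<ge> c * N powr (2 - \<eta>)) at_top"
      using ev eventually_ge_at_top[of "c0 * R0"]
    proof eventually_elim
      case (elim N)
      then show ?case using main unfolding good_def by blast
    qed
  qed
qed

section \<open>Matrices as vectors\<close>

fun mat_of :: "mat2 \<Rightarrow> int^2^2" where
  "mat_of (a, b, c, d) = vector [vector [a, b], vector [c, d]]"

lemma mat_of_nth:
  "mat_of (a, b, c, d) $ 1 $ 1 = a" "mat_of (a, b, c, d) $ 1 $ 2 = b"
  "mat_of (a, b, c, d) $ 2 $ 1 = c" "mat_of (a, b, c, d) $ 2 $ 2 = d"
  by simp_all

lemma inj_mat_of: "inj mat_of"
proof (rule injI)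
  fix g h assume "mat_of g = mat_of h"
  then show "g = h" by (cases g; cases h) (metis mat_of_nth)
qed

lemma mat_of_surj: "M = mat_of (M$1$1, M$1$2, M$2$1, M$2$2)"
  by (simp add: vec_eq_iff forall_2)

lemma mat_of_mm: "mat_of (g \<odot> h) = mat_of g ** mat_of h"
  by (cases g; cases h) (simp add: vec_eq_iff forall_2 matrix_matrix_mult_def sum_2)

lemma mat_of_id2: "mat_of id2 = mat 1"
  by (simp add: id2_def vec_eq_iff forall_2 mat_def)

lemma mat_of_step:
  "mat_of (step (int x) (int y)) = cf_matrix x ** cf_matrix y"
  by (simp add: step_def cf_matrix_def vec_eq_iff forall_2 matrix_matrix_mult_def sum_2)

text \<open>Moves the end value of the fold out of the recursion, so that words can be extended on
  the right.\<close>

lemma foldr_cf_matrix: "foldr (\<lambda>a M. cf_matrix a ** M) as M = foldr (\<lambda>a M. cf_matrix a ** M) as (mat 1) ** M"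
  by (induction as) (simp_all add: matrix_mul_lid matrix_mul_assoc)

lemma mat_of_step_word:
  assumes "mat_of g = foldr (\<lambda>a M. cf_matrix a ** M) as (mat 1)" "x \<ge> 0" "y \<ge> 0"
  shows "mat_of (g \<odot> step x y) = foldr (\<lambda>a M. cf_matrix a ** M) (as @ [nat x, nat y]) (mat 1)"
proof -
  have "mat_of (g \<odot> step x y) = mat_of g ** (cf_matrix (nat x) ** cf_matrix (nat y))"
    using mat_of_step[of "nat x" "nat y"] assms(2,3) by (simp add: mat_of_mm)
  also have "\<dots> = foldr (\<lambda>a M. cf_matrix a ** M) (as @ [nat x, nat y]) (mat 1)"
    unfolding assms(1) by (simp add: foldr_cf_matrix[of as "cf_matrix (nat x) ** cf_matrix (nat y)"] matrix_mul_rid)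
  finally show ?thesis .
qed

lemma sg_word:
  "g \<in> sg A \<Longrightarrow> \<exists>as. even (length as) \<and> set as \<subseteq> {1..A} \<and> mat_of g = foldr (\<lambda>a M. cf_matrix a ** M) as (mat 1)"
proof (induction rule: sg.induct)
  case id2
  then show ?case by (intro exI[of _ "[]"]) (simp add: mat_of_id2)
next
  case (step g x y)
  then obtain as where as: "even (length as)" "set as \<subseteq> {1..A}" "mat_of g = foldr (\<lambda>a M. cf_matrix a ** M) as (mat 1)"
    by blast
  have "mat_of (g \<odot> step x y) = foldr (\<lambda>a M. cf_matrix a ** M) (as @ [nat x, nat y]) (mat 1)"
    using as(3) by (rule mat_of_step_word) (use step.hyps in auto)
  then show ?case using as step.hyps by (intro exI[of _ "as @ [nat x, nat y]"]) auto
qed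

lemma mat_of_cf_semigroup:
  assumes "g \<in> sg A" "x \<in> {1..int A}" "y \<in> {1..int A}"
  shows "mat_of (g \<odot> step x y) \<in> cf_semigroup A"
proof -
  obtain as where as: "even (length as)" "set as \<subseteq> {1..A}" "mat_of g = foldr (\<lambda>a M. cf_matrix a ** M) as (mat 1)"
    using sg_word[OF assms(1)] by blast
  have "mat_of (g \<odot> step x y) = foldr (\<lambda>a M. cf_matrix a ** M) (as @ [nat x, nat y]) (mat 1)"
    using as(3) by (rule mat_of_step_word) (use assms in auto)
  moreover have "even (length (as @ [nat x, nat y]))" "set (as @ [nat x, nat y]) \<subseteq> {1..A}"
    using as assms by auto
  ultimately show ?thesis unfolding cf_semigroup_def by blast
qed

lemma trace_mat_of: "trace (transpose (mat_of g) ** mat_of g) = tn g"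
  by (cases g) (simp add: trace_def transpose_def matrix_matrix_mult_def sum_2 power2_eq_square)

lemma mat_of_SL2_ball:
  "map_matrix real_of_int (mat_of g) \<in> SL2_ball N \<longleftrightarrow> dt g = 1 \<and> real_of_int (tn g) < N\<^sup>2"
proof (cases g)
  case (fields a b c d)
  have "real_of_int a * real_of_int d - real_of_int b * real_of_int c = 1 \<longleftrightarrow> a * d - b * c = 1"
    by (metis of_int_diff of_int_eq_1_iff of_int_mult)
  then show ?thesis by (simp add: fields SL2_ball_def det_2)
qed

text \<open>\<open>card\<close> is 0 on infinite sets, so a lower bound obtained from a subset
  requires finiteness of the whole set.\<close>

lemma finite_SL2_ball: "finite {\<gamma>. map_matrix real_of_int \<gamma> \<in> SL2_ball N}"
proof -
  define n where "n = \<lfloor>N\<^sup>2\<rfloor>"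
  have "{\<gamma>. map_matrix real_of_int \<gamma> \<in> SL2_ball N} \<subseteq> mat_of ` ({-n..n} \<times> {-n..n} \<times> {-n..n} \<times> {-n..n})"
  proof
    fix \<gamma> :: "int^2^2" assume \<gamma>: "\<gamma> \<in> {\<gamma>. map_matrix real_of_int \<gamma> \<in> SL2_ball N}"
    obtain a b c d where g: "\<gamma> = mat_of (a, b, c, d)" using mat_of_surj by blast
    have "real_of_int (tn (a, b, c, d)) < N\<^sup>2" using \<gamma> unfolding g using mat_of_SL2_ball by blast
    then have le: "a\<^sup>2 + b\<^sup>2 + c\<^sup>2 + d\<^sup>2 \<le> n" unfolding n_def le_floor_iff by simp
    have sq: "\<bar>z\<bar> \<le> z\<^sup>2" for z :: int
      using self_le_power[of "\<bar>z\<bar>" 2] by (cases "z = 0") auto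
    have "\<bar>a\<bar> \<le> n" "\<bar>b\<bar> \<le> n" "\<bar>c\<bar> \<le> n" "\<bar>d\<bar> \<le> n"
      using le sq[of a] sq[of b] sq[of c] sq[of d] zero_le_power2[of a] zero_le_power2[of b]
        zero_le_power2[of c] zero_le_power2[of d] by linarith+
    then have "(a, b, c, d) \<in> {-n..n} \<times> {-n..n} \<times> {-n..n} \<times> {-n..n}" by (simp add: abs_le_iff)
    then show "\<gamma> \<in> mat_of ` ({-n..n} \<times> {-n..n} \<times> {-n..n} \<times> {-n..n})" unfolding g by (rule imageI)
  qed
  then show ?thesis by (rule finite_subset) simp
qed

theorem theorem1p8:
  fixes \<eta> :: real
  assumes "\<eta> > 0"
  shows "\<exists>A::nat. A \<ge> 1 \<and>
    (\<lambda>N::real. real (card {\<gamma> \<in> cf_semigroup A. map_matrix real_of_int \<gamma> \<in> SL2_ball N \<and>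
                              squarefree ((trace (transpose \<gamma> ** \<gamma>))\<^sup>2 - 4)}))
      \<in> \<Omega>[at_top](\<lambda>N. N powr (2 - \<eta>))"
proof -
  \<comment> \<open>\<open>many_squarefree\<close> covers exponents up to 1/64; for N >= 1 a smaller
    \<eta> gives a stronger bound.\<close>
  define \<eta>' where "\<eta>' = min \<eta> (1/64)"
  have \<eta>': "0 < \<eta>'" "\<eta>' \<le> 1/64" "\<eta>' \<le> \<eta>" using assms by (auto simp: \<eta>'_def)
  obtain A :: nat and c :: real where A: "A \<ge> 1" and c: "c > 0" and
    ev: "eventually (\<lambda>N. \<exists>G. finite G \<and>
      (\<forall>h\<in>G. (\<exists>g\<in>sg A. \<exists>x\<in>{1..int A}. \<exists>y\<in>{1..int A}. h = g \<odot> step x y) \<and>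
        real_of_int (tn h) < N\<^sup>2 \<and> squarefree ((tn h)\<^sup>2 - 4)) \<and>
      real (card G) \<ge> c * N powr (2 - \<eta>')) at_top"
    by (rule many_squarefree[OF \<eta>'(1,2)])
  let ?S = "\<lambda>N. {\<gamma> \<in> cf_semigroup A. map_matrix real_of_int \<gamma> \<in> SL2_ball N \<and>
                              squarefree ((trace (transpose \<gamma> ** \<gamma>))\<^sup>2 - 4)}"
  have "eventually (\<lambda>N. c * norm (N powr (2 - \<eta>)) \<le> norm (real (card (?S N)))) at_top"
    using ev eventually_ge_at_top[of 1]
  proof eventually_elim
    case (elim N)
    from elim(1) obtain G where G: "finite G" "real (card G) \<ge> c * N powr (2 - \<eta>')"
      and Gh: "\<forall>h\<in>G. (\<exists>g\<in>sg A. \<exists>x\<in>{1..int A}. \<exists>y\<in>{1..int A}. h = g \<odot> step x y) \<and>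
        real_of_int (tn h) < N\<^sup>2 \<and> squarefree ((tn h)\<^sup>2 - 4)"
      by (elim exE conjE) (rule that)
    have "mat_of ` G \<subseteq> ?S N"
    proof
      fix \<gamma> assume "\<gamma> \<in> mat_of ` G"
      then obtain h where h: "h \<in> G" "\<gamma> = mat_of h" by (rule imageE)
      from Gh[THEN bspec, OF h(1)] obtain g x y where gxy: "g \<in> sg A" "x \<in> {1..int A}" "y \<in> {1..int A}" "h = g \<odot> step x y"
        and tn: "real_of_int (tn h) < N\<^sup>2" "squarefree ((tn h)\<^sup>2 - 4)"
        by (elim conjE bexE) (rule that)
      have "dt h = 1" using dt_sg[OF gxy(1)] by (simp add: gxy(4))
      then show "\<gamma> \<in> ?S N"
        using mat_of_cf_semigroup[OF gxy(1-3)] tn mat_of_SL2_ball[of h N] trace_mat_of[of h]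
        by (simp add: h(2) gxy(4)[symmetric])
    qed
    moreover have "finite (?S N)"
      by (rule finite_subset[OF _ finite_SL2_ball[of N]]) blast
    ultimately have "card (mat_of ` G) \<le> card (?S N)" by (intro card_mono)
    moreover have "card (mat_of ` G) = card G"
      by (intro card_image inj_on_subset[OF inj_mat_of]) simp
    ultimately have "real (card G) \<le> real (card (?S N))" by simp
    moreover have "c * N powr (2 - \<eta>) \<le> c * N powr (2 - \<eta>')"
      using elim(2) \<eta>'(3) c by (intro mult_left_mono powr_mono) auto
    ultimately show ?case using G(2) by simp
  qed
  then have "(\<lambda>N. real (card (?S N))) \<in> \<Omega>[at_top](\<lambda>N. N powr (2 - \<eta>))"
    by (rule landau_omega.bigI[OF c])
  then show ?thesis using A by blast
qed

end
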